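(* For fixed $x,y\in\mathbb{R}$, the kernels $\mathbb{A}_\alpha(x,y)$ (for $\alpha\ge 0$, $\alpha<\min(x,y)$) and $\mathbb{B}_\alpha(x,y)$ (for $\alpha\le0$, $\alpha<\min(x,y)$) are continuous functions of $\alpha$, and the continuity holds down to (respectively up to) $\alpha=0$ from either side.
   Context: Powers of $z$ are principal branches (cut along $(-\infty,0]$); $\sigma_3=\mathrm{diag}(1,-1)$, $z^{a\sigma_3}=\mathrm{diag}(z^a,z^{-a})$, $e^{a\sigma_3}=\mathrm{diag}(e^a,e^{-a})$; and $$\mathfrak m(z)=z^{-\sigma_3/4}\,\tfrac{1}{\sqrt2}\begin{pmatrix}1&1\\-1&1\end{pmatrix}e^{-\frac{\pi i}{4}\sigma_3}.$$ The contour $\Sigma^{\leftarrow}$ consists of $(-\infty,0)$ and the two rays $\arg z=\pm\frac23\pi$, all oriented from infinity towards $0$; $\Sigma^{\to}$ is $\Sigma^{\leftarrow}$ together with $(0,\alpha)$ oriented from $0$ to $\alpha$. Subscripts $+$ and $-$ denote boundary values from the left and right sides of the oriented contour. A solution is a $2\times2$ matrix function $M$ analytic off the contour, with boundary values continuous away from $0$ (and $\alpha$), with at most logarithmic singularities at these points, satisfying the jump relations below and $M(z)=(I+O(z^{-1}))\,\mathfrak m(z)$ as $z\to\infty$. $RHP^{\to}$ ($\alpha\ge0$): $M_+=M_-\begin{pmatrix}1& e^{-\frac43z^{3/2}}\\ 0&1\end{pmatrix}$ on $(0,\alpha)$; $M_+=M_-\begin{pmatrix}1&0\\ e^{\frac43z^{3/2}}&1\end{pmatrix}$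 on $\arg z=\pm\frac23\pi$; $M_+=M_-\begin{pmatrix}0&1\\-1&0\end{pmatrix}$ on $(-\infty,0)$. $RHP^{\leftarrow}$ ($\alpha\le0$): $M_+=M_-\begin{pmatrix}1&0\\ e^{\frac43z^{3/2}+2\alpha z^{1/2}}&1\end{pmatrix}$ on $\arg z=\pm\frac23\pi$; $M_+=M_-\begin{pmatrix}0&1\\-1&0\end{pmatrix}$ on $(-\infty,0)$. Each problem has a unique solution, denoted $M^{\to}$ and $M^{\leftarrow}$; the two problems coincide at $\alpha=0$. For $|\arg z|<\frac23\pi$ set $$(f^{\to}_\alpha(z),g^{\to}_\alpha(z))=\tfrac{1}{\sqrt{2\pi}}e^{\frac{\pi i}{4}}e^{-\frac23z^{3/2}}\bigl(M^{\to}_{11}(z),M^{\to}_{21}(z)\bigr)\quad(z\notin[0,\alpha]),$$ $$(f^{\leftarrow}_\alpha(z),g^{\leftarrow}_\alpha(z))=\tfrac{1}{\sqrt{2\pi}}e^{\frac{\pi i}{4}}e^{-(\frac23z^{3/2}+\alpha z^{1/2})}\bigl(M^{\leftarrow}_{11}(z),M^{\leftarrow}_{21}(z)\bigr).$$ For real $x,y>\alpha$ the kernels are $$\mathbb{A}_\alpha(x,y)=\frac{f^{\to}_\alpha(x)g^{\to}_\alpha(y)-g^{\to}_\alpha(x)f^{\to}_\alpha(y)}{x-y},\qquad \mathbb{B}_\alpha(x,y)=\frac{f^{\leftarrow}_\alpha(x-\alpha)g^{\leftarrow}_\alpha(y-\alpha)-g^{\leftarrow}_\alpha(x-\alpha)f^{\leftarrow}_\alpha(y-\alpha)}{x-y},$$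 with values at $x=y$ defined by continuity; $\mathbb{A}_0=\mathbb{B}_0$. *)

theory Defs
  imports "HOL-Complex_Analysis.Complex_Analysis" "HOL-Library.Landau_Symbols"
begin

type_synonym cmat2 = "complex ^ 2 ^ 2"

definition mat2 :: "complex \<Rightarrow> complex \<Rightarrow> complex \<Rightarrow> complex \<Rightarrow> cmat2" where
  "mat2 a b c d = vector [vector [a, b], vector [c, d]]"

definition powr_sigma3 :: "complex \<Rightarrow> complex \<Rightarrow> cmat2" where
  "powr_sigma3 z a = mat2 (z powr a) 0 0 (z powr (- a))"

definition exp_sigma3 :: "complex \<Rightarrow> cmat2" where
  "exp_sigma3 a = mat2 (exp a) 0 0 (exp (- a))"

definition model_mat :: "complex \<Rightarrow> cmat2" where
  "model_mat z = powr_sigma3 z (- 1 / 4) ** ((1 / sqrt 2) *\<^sub>R mat2 1 1 (- 1) 1)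
     ** exp_sigma3 (- (of_real pi * \<i> / 4))"

definition ray :: "real \<Rightarrow> complex set" where
  "ray \<theta> = {of_real r * cis \<theta> | r. 0 < r}"

definition segment0 :: "real \<Rightarrow> complex set" where
  "segment0 \<alpha> = of_real ` {0<..<\<alpha>}"

text \<open>The contours include their finite endpoints, so that their complements are the open
  sets on which solutions are analytic.\<close>

definition contour_left :: "complex set" where
  "contour_left = insert 0 (ray pi \<union> ray (2 * pi / 3) \<union> ray (- (2 * pi / 3)))"

definition contour_right :: "real \<Rightarrow> complex set" where
  "contour_right \<alpha> = contour_left \<union> segment0 \<alpha> \<union> {of_real \<alpha>}"

text \<open>The open half-planes to the left and to the right of the line through \<open>s\<close> with direction
  \<open>d\<close>. At a point \<open>s\<close> of a straight contour piece they agree near \<open>s\<close> with the two sides of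
  that piece.\<close>

definition left_side :: "complex \<Rightarrow> complex \<Rightarrow> complex set" where
  "left_side s d = {w. Im ((w - s) * cnj d) > 0}"

definition right_side :: "complex \<Rightarrow> complex \<Rightarrow> complex set" where
  "right_side s d = {w. Im ((w - s) * cnj d) < 0}"

text \<open>\<open>M\<close> has continuous boundary values on both sides of the straight piece \<open>\<Gamma>\<close>, oriented in
  direction \<open>d\<close>, and they are related by the jump matrix \<open>J\<close>.\<close>

definition has_jump ::
  "(complex \<Rightarrow> cmat2) \<Rightarrow> complex set \<Rightarrow> complex \<Rightarrow> (complex \<Rightarrow> cmat2) \<Rightarrow> bool" where
  "has_jump M \<Gamma> d J \<longleftrightarrow>
     (\<exists>Mplus Mminus. continuous_on \<Gamma> Mplus \<and> continuous_on \<Gamma> Mminus \<and>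
        (\<forall>s\<in>\<Gamma>. (M \<longlongrightarrow> Mplus s) (at s within left_side s d) \<and>
               (M \<longlongrightarrow> Mminus s) (at s within right_side s d) \<and>
               Mplus s = Mminus s ** J s))"

definition analytic_off :: "(complex \<Rightarrow> cmat2) \<Rightarrow> complex set \<Rightarrow> bool" where
  "analytic_off M \<Sigma> \<longleftrightarrow> (\<forall>i j. (\<lambda>z. M z $ i $ j) analytic_on (- \<Sigma>))"

definition at_most_log_at :: "(complex \<Rightarrow> cmat2) \<Rightarrow> complex set \<Rightarrow> complex \<Rightarrow> bool" where
  "at_most_log_at M \<Sigma> p \<longleftrightarrow> (\<lambda>z. norm (M z)) \<in> O[at p within - \<Sigma>](\<lambda>z. ln (norm (z - p)))"

definition normalized_at_infinity :: "(complex \<Rightarrow> cmat2) \<Rightarrow> complex set \<Rightarrow> bool" where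
  "normalized_at_infinity M \<Sigma> \<longleftrightarrow>
     (\<exists>E. (\<forall>z\<in>- \<Sigma>. M z = (mat 1 + E z) ** model_mat z) \<and>
          (\<lambda>z. norm (E z)) \<in> O[inf at_infinity (principal (- \<Sigma>))](\<lambda>z. 1 / norm z))"

text \<open>The three infinite rays are oriented towards the origin, hence the directions
  \<open>- cis (\<plusminus> 2 * pi / 3)\<close>, and \<open>1\<close> for the negative real axis. The values of \<open>M\<close> on the contour
  itself are irrelevant.\<close>

definition RHP_right :: "real \<Rightarrow> (complex \<Rightarrow> cmat2) \<Rightarrow> bool" where
  "RHP_right \<alpha> M \<longleftrightarrow>
     analytic_off M (contour_right \<alpha>) \<and>
     has_jump M (segment0 \<alpha>) 1 (\<lambda>z. mat2 1 (exp (- (4 / 3 * z powr (3 / 2)))) 0 1) \<and>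
     (\<forall>\<theta>\<in>{2 * pi / 3, - (2 * pi / 3)}.
        has_jump M (ray \<theta>) (- cis \<theta>) (\<lambda>z. mat2 1 0 (exp (4 / 3 * z powr (3 / 2))) 1)) \<and>
     has_jump M (ray pi) 1 (\<lambda>z. mat2 0 1 (- 1) 0) \<and>
     at_most_log_at M (contour_right \<alpha>) 0 \<and>
     at_most_log_at M (contour_right \<alpha>) (of_real \<alpha>) \<and>
     normalized_at_infinity M (contour_right \<alpha>)"

definition RHP_left :: "real \<Rightarrow> (complex \<Rightarrow> cmat2) \<Rightarrow> bool" where
  "RHP_left \<alpha> M \<longleftrightarrow>
     analytic_off M contour_left \<and>
     (\<forall>\<theta>\<in>{2 * pi / 3, - (2 * pi / 3)}.
        has_jump M (ray \<theta>) (- cis \<theta>)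
          (\<lambda>z. mat2 1 0 (exp (4 / 3 * z powr (3 / 2) + 2 * of_real \<alpha> * z powr (1 / 2))) 1)) \<and>
     has_jump M (ray pi) 1 (\<lambda>z. mat2 0 1 (- 1) 0) \<and>
     at_most_log_at M contour_left 0 \<and>
     normalized_at_infinity M contour_left"

text \<open>The following functions are meaningful for \<open>\<bar>Arg z\<bar> < 2 * pi / 3\<close> off the contour of \<open>M\<close>.
  The kernels below use them only at positive reals off the contour.\<close>

definition f_right :: "(complex \<Rightarrow> cmat2) \<Rightarrow> complex \<Rightarrow> complex" where
  "f_right M z = 1 / of_real (sqrt (2 * pi)) * exp (of_real pi * \<i> / 4)
     * exp (- (2 / 3 * z powr (3 / 2))) * M z $ 1 $ 1"

definition g_right :: "(complex \<Rightarrow> cmat2) \<Rightarrow> complex \<Rightarrow> complex" where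
  "g_right M z = 1 / of_real (sqrt (2 * pi)) * exp (of_real pi * \<i> / 4)
     * exp (- (2 / 3 * z powr (3 / 2))) * M z $ 2 $ 1"

definition f_left :: "real \<Rightarrow> (complex \<Rightarrow> cmat2) \<Rightarrow> complex \<Rightarrow> complex" where
  "f_left \<alpha> M z = 1 / of_real (sqrt (2 * pi)) * exp (of_real pi * \<i> / 4)
     * exp (- (2 / 3 * z powr (3 / 2) + of_real \<alpha> * z powr (1 / 2))) * M z $ 1 $ 1"

definition g_left :: "real \<Rightarrow> (complex \<Rightarrow> cmat2) \<Rightarrow> complex \<Rightarrow> complex" where
  "g_left \<alpha> M z = 1 / of_real (sqrt (2 * pi)) * exp (of_real pi * \<i> / 4)
     * exp (- (2 / 3 * z powr (3 / 2) + of_real \<alpha> * z powr (1 / 2))) * M z $ 2 $ 1"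

definition kernel_quotient :: "(real \<Rightarrow> complex) \<Rightarrow> (real \<Rightarrow> complex) \<Rightarrow> real \<Rightarrow> real \<Rightarrow> complex" where
  "kernel_quotient f g x y = (f x * g y - g x * f y) / of_real (x - y)"

text \<open>On the diagonal the value is defined by continuity: it is the two-variable limit of the
  quotient from off the diagonal.\<close>

definition integrable_kernel :: "(real \<Rightarrow> complex) \<Rightarrow> (real \<Rightarrow> complex) \<Rightarrow> real \<Rightarrow> real \<Rightarrow> complex" where
  "integrable_kernel f g x y =
     (if x \<noteq> y then kernel_quotient f g x y
      else Lim (at (x, y) within {(u, v). u \<noteq> v}) (\<lambda>(u, v). kernel_quotient f g u v))"

text \<open>For \<open>RHP_right \<alpha> M\<close>, the dependence of this kernel on \<open>\<alpha>\<close> is only through \<open>M\<close>.\<close>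

definition kernel_A :: "(complex \<Rightarrow> cmat2) \<Rightarrow> real \<Rightarrow> real \<Rightarrow> complex" where
  "kernel_A M = integrable_kernel (\<lambda>x. f_right M (of_real x)) (\<lambda>x. g_right M (of_real x))"

definition kernel_B :: "real \<Rightarrow> (complex \<Rightarrow> cmat2) \<Rightarrow> real \<Rightarrow> real \<Rightarrow> complex" where
  "kernel_B \<alpha> M = integrable_kernel
     (\<lambda>x. f_left \<alpha> M (of_real (x - \<alpha>))) (\<lambda>x. g_left \<alpha> M (of_real (x - \<alpha>)))"

end

(*
  Multiplying a solution M by the exponentials of its phase theta and undoing the jumps on the two
  rays leaves a matrix with the constant unipotent jump (1 1; 0 1) on the whole half-line to the left
  of the endpoint alpha (for the left problem after the shift z -> z - alpha). Hence its first column
  u is entire, its second column is e + u Log(z - alpha) / (2 pi i) with e entire, and (u, e) has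
  determinant one. The kernels are, up to a constant factor, u(x) wedge u(y) / (x - y).

  For two parameters alpha and beta the quotient R of the corresponding matrices is holomorphic off
  [alpha, beta] and bounded at infinity, because the difference of the two phases is O(z^(-1/2)). Its
  limit C has determinant one, so u may be replaced by v = C^(-1) u without changing the wedge product.
  Since R is an entire function plus a rank one term with the factor
  log((z - beta) / (z - alpha)) = O(alpha - beta), Cauchy's formula and the maximum principle give
  v = u_beta + O(alpha - beta) uniformly on discs.
*)

theory Submission
  imports Defs "HOL-Real_Asymp.Real_Asymp"
begin

text \<open>The delicate point is the bound of the quotient at infinity. Two second rows of the
  model matrices contribute |z|^(1/4) each, so a phase difference of order z^(-1/2) is only just
  enough. For the left problems the shifted contours also differ: in a strip along each pair of
  parallel rays only one of the two ray jumps has been undone. There the real part of z^(3/2) is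
  negative and of full size, so the exponentials beat the powers.

  No bound for \<open>v\<close> that is uniform in \<alpha> is known in advance. The estimate
  supplies its own: its right-hand side is a small multiple of the maximum of \<open>v\<close> on
  the disc and is absorbed. Cauchy's formula is applied outside a circle, where the entire summand
  drops out, so the rank one term has to be estimated on one fixed circle only, whatever its growth
  at infinity.

  Each parameter set contains 0 whenever 0 is admissible, so the one-sided continuity at 0 needs no
  separate argument.\<close>

no_notation fps_nth (infixl "$" 75)


subsection \<open>Extension of holomorphic functions across lines and punctures\<close>

text \<open>Near \<open>t\<close> all values of \<open>f\<close> on \<open>X\<close> lie within e /
  2 of \<open>g t\<close>. The limit \<open>g t'\<close> at a nearby point inherits the closed
  bound, and the factor 1 / 2 makes it strict again.\<close>

lemma continuous_on_limits_within:
  fixes f g :: "'a::metric_space \<Rightarrow> 'b::metric_space"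
  assumes lim: "\<And>t. t \<in> B \<Longrightarrow> (f \<longlongrightarrow> g t) (at t within X)"
    and limpt: "\<And>t. t \<in> B \<Longrightarrow> t islimpt X"
  shows "continuous_on B g"
  unfolding continuous_on_iff
proof (intro ballI allI impI)
  fix t and e :: real assume t: "t \<in> B" and e: "e > 0"
  obtain d where d: "d > 0" "\<And>x. x \<in> X \<Longrightarrow> x \<noteq> t \<Longrightarrow> dist x t < d \<Longrightarrow> dist (f x) (g t) < e / 2"
    using lim[OF t, unfolded Lim_within] e half_gt_zero[OF e] by (metis zero_less_dist_iff)
  have "dist (g t') (g t) < e" if t': "t' \<in> B" "dist t' t < d" for t'
  proof (cases "t' = t")
    case False
    have nt: "at t' within X \<noteq> bot"
      using limpt[OF t'(1)] by (simp add: trivial_limit_within)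
    have "eventually (\<lambda>x. x \<in> ball t d - {t}) (at t' within X)"
      by (rule topological_tendstoD[OF tendsto_ident_at]) (use False t' in \<open>auto simp: dist_commute
        open_delete\<close>)
    moreover have "eventually (\<lambda>x. x \<in> X) (at t' within X)"
      by (simp add: eventually_at_filter)
    ultimately have "eventually (\<lambda>x. dist (f x) (g t) \<le> e / 2) (at t' within X)"
      by eventually_elim (use d in \<open>auto simp: dist_commute less_imp_le\<close>)
    then have "dist (g t') (g t) \<le> e / 2"
      using tendsto_upperbound[OF tendsto_dist[OF lim[OF t'(1)] tendsto_const] _ nt] by blast
    then show ?thesis using e by simp
  qed (use e in simp)
  then show "\<exists>d>0. \<forall>x'\<in>B. dist x' t < d \<longrightarrow> dist (g x') (g t) < e"
    using d(1) by blast
qed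


lemma isCont_tendsto_within: "isCont f z \<Longrightarrow> (f \<longlongrightarrow> f z) (at z within X)"
  by (rule tendsto_mono[OF at_le[OF subset_UNIV]]) (simp add: isCont_def)

text \<open>Pasting across a line describes the line by a normal vector; for direction
  \<open>d\<close> this is \<open>\<i> * d\<close>.\<close>

lemma inner_i_times: "(\<i> * d) \<bullet> w = Im (w * cnj d)"
  by (simp add: inner_complex_def algebra_simps)

lemma islimpt_sides:
  assumes "d \<noteq> 0"
  shows "t islimpt left_side t d" "t islimpt right_side t d"
proof -
  have *: "\<exists>x\<in>{w. Im ((w - t) * cnj d) * c > 0}. x \<noteq> t \<and> dist x t < e"
    if "e > 0" "c \<in> {1, -1}" for e c :: real
  proof (rule bexI)
    define x where "x = t + of_real (c * (e / 2 / norm d)) * (\<i> * d)"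
    show "x \<noteq> t \<and> dist x t < e"
      using assms that by (auto simp: x_def dist_norm norm_mult norm_divide)
    have "Im ((x - t) * cnj d) * c = (e / 2 / norm d) * (c * c) * (norm d)\<^sup>2"
      unfolding cmod_power2 by (simp add: x_def algebra_simps power2_eq_square)
    also have "\<dots> > 0" using assms that by auto
    finally show "x \<in> {w. Im ((w - t) * cnj d) * c > 0}" by simp
  qed
  show "t islimpt left_side t d" "t islimpt right_side t d"
    unfolding islimpt_approachable left_side_def right_side_def
    using *[of _ 1] *[of _ "-1"] by auto
qed

text \<open>Equal one-sided limits make \<open>f\<close> continuous across the line, and a
  continuous function that is holomorphic on both sides of a line is holomorphic.\<close>

lemma holomorphic_extend_across_line:
  fixes f :: "complex \<Rightarrow> complex"
  defines "L \<equiv> \<lambda>s d. {w. Im ((w - s) * cnj d) = 0}"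
  assumes d: "d \<noteq> 0"
    and hol: "f holomorphic_on ball s r - L s d"
    and lim: "\<And>t. t \<in> ball s r \<inter> L s d \<Longrightarrow>
      \<exists>l. (f \<longlongrightarrow> l) (at t within left_side t d) \<and> (f \<longlongrightarrow> l) (at t within right_side t d)"
  obtains h where "h holomorphic_on ball s r" "\<And>z. z \<in> ball s r - L s d \<Longrightarrow> h z = f z"
proof -
  obtain l where l: "\<And>t. t \<in> ball s r \<inter> L s d \<Longrightarrow>
       (f \<longlongrightarrow> l t) (at t within left_side t d) \<and> (f \<longlongrightarrow> l t) (at t within right_side t d)"
    using lim by metis
  define h where "h z = (if z \<in> L s d then l z else f z)" for z
  have hf: "h z = f z" if "z \<in> ball s r - L s d" for z
    using that by (simp add: h_def)
  have clL: "closed (L s d)"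
    unfolding L_def by (intro closed_Collect_eq continuous_intros)
  have "continuous_on (ball s r) h"
  proof (rule continuous_on_limits_within[where X = "- L s d" and f = f])
    fix t assume t: "t \<in> ball s r"
    have sides: "left_side t d \<union> right_side t d = - L s d" if "t \<in> L s d"
      using that by (auto simp: left_side_def right_side_def L_def algebra_simps)
    show "(f \<longlongrightarrow> h t) (at t within - L s d)"
    proof (cases "t \<in> L s d")
      case True
      then show ?thesis
        using l[of t] t by (simp add: h_def Lim_within_Un flip: sides)
    next
      case False
      have "open (ball s r - L s d)" using clL by auto
      then have "isCont f t"
        using holomorphic_on_imp_continuous_on[OF hol] False t
        by (auto simp: continuous_on_eq_continuous_at)
      then show ?thesis using False by (simp add: h_def isCont_tendsto_within)
    qed
    show "t islimpt - L s d"
    proof (cases "t \<in> L s d")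
      case True then show ?thesis using sides islimpt_sides(1)[OF d] by (metis islimpt_subset sup_ge1)
    next
      case False
      have "open (- L s d)" using clL by auto
      then show ?thesis using False by (metis ComplI interior_limit_point interior_open)
    qed
  qed
  moreover have "h holomorphic_on (ball s r \<inter> {z. (\<i> * d) \<bullet> z < Im (s * cnj d)})"
    by (rule holomorphic_transform[OF holomorphic_on_subset[OF hol]])
       (auto simp: inner_i_times L_def h_def algebra_simps)
  moreover have "h holomorphic_on (ball s r \<inter> {z. Im (s * cnj d) < (\<i> * d) \<bullet> z})"
    by (rule holomorphic_transform[OF holomorphic_on_subset[OF hol]])
       (auto simp: inner_i_times L_def h_def algebra_simps)
  ultimately have "h holomorphic_on ball s r"
    using holomorphic_on_paste_across_line[OF open_ball] d
    by (metis complex_i_not_zero mult_eq_0_iff)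
  then show ?thesis using that hf by blast
qed

text \<open>Each local extension is determined by \<open>f\<close> on the dense set
  \<open>X\<close>. Hence the single function \<open>Lim (at z within X) f\<close> agrees with all
  of them, and no compatibility on overlaps has to be checked.\<close>

lemma holomorphic_local_extensions:
  fixes f :: "complex \<Rightarrow> complex"
  assumes S: "open S" and dense: "\<And>z. z \<in> S \<Longrightarrow> z islimpt X"
    and loc: "\<And>s. s \<in> S \<Longrightarrow> \<exists>B h. open B \<and> s \<in> B \<and> h holomorphic_on B \<and> (\<forall>z\<in>B \<inter> X. h z = f z)"
  obtains g where "g holomorphic_on S" "\<And>z. z \<in> S \<inter> X \<Longrightarrow> g z = f z"
proof -
  define g where "g z = Lim (at z within X) f" for z
  have gh: "g z = h z" if "z \<in> S \<inter> B" "open B" "h holomorphic_on B" "\<forall>z\<in>B \<inter> X. h z = f z" for B h z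
  proof -
    have "isCont h z"
      using that holomorphic_on_imp_continuous_on[OF that(3)] by (auto simp: continuous_on_eq_continuous_at)
    then have "(h \<longlongrightarrow> h z) (at z within X)"
      by (rule isCont_tendsto_within)
    moreover have "eventually (\<lambda>x. h x = f x) (at z within X)"
    proof -
      have "eventually (\<lambda>x. x \<in> B) (at z within X)"
        by (rule topological_tendstoD[OF tendsto_ident_at]) (use that in auto)
      moreover have "eventually (\<lambda>x. x \<in> X) (at z within X)"
        by (simp add: eventually_at_filter)
      ultimately show ?thesis by eventually_elim (use that in auto)
    qed
    ultimately have "(f \<longlongrightarrow> h z) (at z within X)"
      by (metis (mono_tags, lifting) tendsto_cong)
    then show ?thesis
      unfolding g_def using dense that by (intro tendsto_Lim) (auto simp: trivial_limit_within)
  qed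
  have "g analytic_on S"
    unfolding analytic_on_def
  proof
    fix s assume s: "s \<in> S"
    obtain B h where B: "open B" "s \<in> B" "h holomorphic_on B" "\<forall>z\<in>B \<inter> X. h z = f z" using loc[OF s] by blast
    obtain e where e: "e > 0" "ball s e \<subseteq> S \<inter> B" using S B s by (metis IntI open_Int openE)
    have "g holomorphic_on ball s e"
      by (rule holomorphic_transform[OF holomorphic_on_subset[OF B(3)]]) (use e gh[OF _ B(1,3,4)] in
        \<open>auto simp: subset_iff\<close>)
    then show "\<exists>e>0. g holomorphic_on ball s e" using e by blast
  qed
  then have "g holomorphic_on S" by (rule analytic_imp_holomorphic)
  moreover have "g z = f z" if "z \<in> S \<inter> X" for z
    using that gh loc by (metis IntD1 IntD2 IntI)
  ultimately show ?thesis using that by blast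
qed

text \<open>Riemann's removable singularity theorem for a function known only on \<open>X\<close>.
  Gluing first gives \<open>g\<close> on the punctured disc; the bound for (z - p) g(z), given along
  \<open>X\<close>, passes to all z by density and continuity of \<open>g\<close>.\<close>

lemma holomorphic_extend_puncture:
  fixes f :: "complex \<Rightarrow> complex"
  assumes r: "r > 0" and dense: "\<And>z. z islimpt X"
    and loc: "\<And>s. s \<in> ball p r - {p} \<Longrightarrow> \<exists>B h. open B \<and> s \<in> B \<and> h holomorphic_on B \<and> (\<forall>z\<in>B \<inter> X. h z = f z)"
    and lim: "((\<lambda>z. (z - p) * f z) \<longlongrightarrow> 0) (at p within X)" and p: "p \<notin> X"
  shows "\<exists>B h. open B \<and> p \<in> B \<and> h holomorphic_on B \<and> (\<forall>z\<in>B \<inter> X. h z = f z)"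
proof -
  obtain g where g: "g holomorphic_on ball p r - {p}" "\<And>z. z \<in> (ball p r - {p}) \<inter> X \<Longrightarrow> g z = f z"
    using holomorphic_local_extensions[of "ball p r - {p}" X f] dense loc by (metis open_ball open_delete)
  have "((\<lambda>z. (z - p) * g z) \<longlongrightarrow> 0) (at p)"
    unfolding Lim_at
  proof (intro allI impI)
    fix e :: real assume e: "e > 0"
    obtain d where d: "d > 0" "\<And>x. x \<in> X \<Longrightarrow> x \<noteq> p \<Longrightarrow> dist x p < d \<Longrightarrow> dist ((x - p) * f x) 0 < e / 2"
      using lim[unfolded Lim_within] e half_gt_zero[OF e] by (metis zero_less_dist_iff)
    have "dist ((z - p) * g z) 0 < e" if z: "0 < dist z p" "dist z p < min d r" for z
    proof -
      have zb: "z \<in> ball p (min d r) - {p}" using z by (auto simp: dist_commute)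
      have "isCont g z"
        using holomorphic_on_imp_continuous_on[OF g(1)] zb
          by (auto simp: continuous_on_eq_continuous_at open_delete)
      then have "isCont (\<lambda>z. (z - p) * g z) z" by (intro continuous_intros)
      then have 1: "((\<lambda>z. (z - p) * g z) \<longlongrightarrow> (z - p) * g z) (at z within X)"
        by (rule isCont_tendsto_within)
      have "eventually (\<lambda>x. x \<in> ball p (min d r) - {p}) (at z within X)"
        by (rule topological_tendstoD[OF tendsto_ident_at]) (use zb in \<open>auto intro: open_delete\<close>)
      moreover have "eventually (\<lambda>x. x \<in> X) (at z within X)"
        by (simp add: eventually_at_filter)
      ultimately have "eventually (\<lambda>x. dist ((x - p) * g x) 0 \<le> e / 2) (at z within X)"
        by eventually_elim (use d g in \<open>auto simp: dist_commute less_imp_le\<close>)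
      then have "dist ((z - p) * g z) 0 \<le> e / 2"
        using dense[of z] by (intro tendsto_upperbound[OF tendsto_dist[OF 1 tendsto_const]])
          (simp_all add: trivial_limit_within)
      then show ?thesis using e by simp
    qed
    then show "\<exists>d>0. \<forall>x. 0 < dist x p \<and> dist x p < d \<longrightarrow> dist ((x - p) * g x) 0 < e"
      using d r by (intro exI[of _ "min d r"]) auto
  qed
  then obtain h where h: "h holomorphic_on ball p r" "\<And>z. z \<in> ball p r - {p} \<Longrightarrow> h z = g z"
    using holomorphic_on_extend_lim[OF g(1)] r by auto
  have "h z = f z" if "z \<in> ball p r \<inter> X" for z
  proof -
    have "z \<in> ball p r - {p}" using that p by blast
    then show ?thesis using h(2) g(2) that by force
  qed
  then show ?thesis
    using h(1) r centre_in_ball open_ball by metis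
qed

subsection \<open>The contours\<close>

lemma mem_ray_pi: "z \<in> ray pi \<longleftrightarrow> Im z = 0 \<and> Re z < 0"
proof
  assume "Im z = 0 \<and> Re z < 0"
  then show "z \<in> ray pi" unfolding ray_def
    by (auto intro!: exI[of _ "- Re z"] simp: complex_eq_iff)
qed (auto simp: ray_def)

lemma cos_sin_two_thirds_pi: "cos (2 * pi / 3) = - 1 / 2" "sin (2 * pi / 3) = sqrt 3 / 2"
  using cos_120 sin_120 by simp_all

lemma mem_ray_up: "z \<in> ray (2 * pi / 3) \<longleftrightarrow> Re z < 0 \<and> Im z = - sqrt 3 * Re z"
proof
  assume "Re z < 0 \<and> Im z = - sqrt 3 * Re z"
  then show "z \<in> ray (2 * pi / 3)" unfolding ray_def
    by (auto intro!: exI[of _ "- 2 * Re z"] simp: complex_eq_iff cos_sin_two_thirds_pi)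
qed (auto simp: ray_def cos_sin_two_thirds_pi)

lemma mem_ray_down: "z \<in> ray (- (2 * pi / 3)) \<longleftrightarrow> Re z < 0 \<and> Im z = sqrt 3 * Re z"
proof
  assume "Re z < 0 \<and> Im z = sqrt 3 * Re z"
  then show "z \<in> ray (- (2 * pi / 3))" unfolding ray_def
    by (auto intro!: exI[of _ "- 2 * Re z"] simp: complex_eq_iff cos_sin_two_thirds_pi)
qed (auto simp: ray_def cos_sin_two_thirds_pi)

lemma mem_segment0: "z \<in> segment0 a \<longleftrightarrow> Im z = 0 \<and> 0 < Re z \<and> Re z < a"
  unfolding segment0_def by (auto simp: image_iff complex_eq_iff)

text \<open>Both rays satisfy one equation, which forces Re z to be nonpositive. This turns
  questions about the contour into real arithmetic.\<close>

lemma mem_contour_right: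
  assumes "a \<ge> 0"
  shows "z \<in> contour_right a \<longleftrightarrow> Im z = 0 \<and> Re z \<le> a \<or> \<bar>Im z\<bar> = - sqrt 3 * Re z"
proof -
  have "\<bar>Im z\<bar> = - sqrt 3 * Re z \<longleftrightarrow> z = 0 \<or> z \<in> ray (2 * pi / 3) \<or> z \<in> ray (- (2 * pi / 3))"
    unfolding mem_ray_up mem_ray_down
    by (smt (verit, del_insts) complex_eq_iff mult_minus_left mult_nonneg_nonneg mult_neg_neg mult_pos_pos
      mult_eq_0_iff real_sqrt_gt_zero zero_complex.sel mult_pos_neg)
  moreover have "Im z = 0 \<and> Re z \<le> a \<longleftrightarrow> z = 0 \<or> z \<in> ray pi \<or> z \<in> segment0 a \<or> z = of_real a"
    unfolding mem_ray_pi mem_segment0 using assms by (auto simp: complex_eq_iff)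
  ultimately show ?thesis unfolding contour_right_def contour_left_def by auto
qed

lemma contour_right_0: "contour_right 0 = contour_left"
  by (auto simp: contour_right_def contour_left_def segment0_def)

lemma closed_contour_right: "a \<ge> 0 \<Longrightarrow> closed (contour_right a)"
proof -
  assume "a \<ge> 0"
  then have "contour_right a = {z. Im z = 0} \<inter> {z. Re z \<le> a} \<union> {z. \<bar>Im z\<bar> = - sqrt 3 * Re z}"
    using mem_contour_right by auto
  then show ?thesis
    by (auto intro!: closed_Collect_eq closed_Collect_le continuous_intros closed_Un closed_Int)
qed

text \<open>Three lines through 0 cover the contour. Negligibility, unlike a direct density
  argument, survives the union of two shifted contours in
  \<open>represents_pairing_bounded\<close>.\<close>

lemma negligible_contour_right:
  assumes "a \<ge> 0" shows "negligible (contour_right a)"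
proof (rule negligible_subset)
  show "negligible ({z. \<i> \<bullet> z = 0} \<union> {z. (\<i> + of_real (sqrt 3)) \<bullet> z = 0} \<union> {z. (\<i> - of_real (sqrt 3)) \<bullet> z
    = 0})"
    by (intro negligible_Un negligible_hyperplane) (auto simp: complex_eq_iff)
  show "contour_right a \<subseteq> {z. \<i> \<bullet> z = 0} \<union> {z. (\<i> + of_real (sqrt 3)) \<bullet> z = 0} \<union> {z. (\<i> - of_real (sqrt 3))
    \<bullet> z = 0}"
    using mem_contour_right[OF assms] by (auto simp: inner_complex_def)
qed

lemma islimpt_compl_negligible:
  fixes z :: "'a::euclidean_space"
  assumes "negligible X" shows "z islimpt - X"
  unfolding islimpt_def
proof (intro allI impI, rule ccontr)
  fix T assume T: "z \<in> T" "open T" "\<not> (\<exists>y\<in>- X. y \<in> T \<and> y \<noteq> z)"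
  then have "T \<subseteq> insert z X" by auto
  then have "negligible T" using assms by (metis negligible_insert negligible_subset)
  then show False using open_not_negligible T by blast
qed

lemma Ln_half_planes:
  shows "0 < Im z \<Longrightarrow> Ln z = Ln (- z) + \<i> * pi" "Im z < 0 \<Longrightarrow> Ln z = Ln (- z) - \<i> * pi"
  using Ln_minus[of z] by (cases "z = 0"; simp)+

text \<open>The function \<open>Ln (- w)\<close> has its cut on the positive axis, so it is
  continuous at \<open>t\<close> and differs from \<open>Ln w\<close> by a constant on each
  side.\<close>

lemma Ln_tendsto_sides:
  assumes "Im t = 0" "Re t < 0"
  shows "(Ln \<longlongrightarrow> Ln (- t) + \<i> * pi) (at t within {w. Im w > 0})"
    and "(Ln \<longlongrightarrow> Ln (- t) - \<i> * pi) (at t within {w. Im w < 0})"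
proof -
  have *: "((\<lambda>w. Ln (- w) + c) \<longlongrightarrow> Ln (- t) + c) (at t within X)" for X c
    by (rule isCont_tendsto_within, intro continuous_intros)
       (use assms in \<open>auto simp: complex_nonpos_Reals_iff\<close>)
  have "\<forall>\<^sub>F w in at t within {w. Im w > 0}. Ln (- w) + \<i> * pi = Ln w"
    using Ln_half_planes(1) by (simp add: eventually_at_filter)
  then show "(Ln \<longlongrightarrow> Ln (- t) + \<i> * pi) (at t within {w. Im w > 0})"
    by (rule Lim_transform_eventually[OF *])
  have "\<forall>\<^sub>F w in at t within {w. Im w < 0}. Ln (- w) + - (\<i> * pi) = Ln w"
    using Ln_half_planes(2) by (simp add: eventually_at_filter)
  from Lim_transform_eventually[OF * this]
  show "(Ln \<longlongrightarrow> Ln (- t) - \<i> * pi) (at t within {w. Im w < 0})"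
    by simp
qed

subsection \<open>Phases, branches and matching of boundary values\<close>

lemma mat2_nth [simp]:
  "mat2 a b c d $ 1 $ 1 = a" "mat2 a b c d $ 1 $ 2 = b"
  "mat2 a b c d $ 2 $ 1 = c" "mat2 a b c d $ 2 $ 2 = d"
  by (simp_all add: mat2_def)

lemma matrix_mult_2_nth: "((A :: cmat2) ** B) $ i $ j = A $ i $ 1 * B $ 1 $ j + A $ i $ 2 * B $ 2 $ j"
  by (simp add: matrix_matrix_mult_def sum_2)

definition phase :: "real \<Rightarrow> complex \<Rightarrow> complex" where
  "phase \<kappa> z = 2 / 3 * z powr (3 / 2) + of_real \<kappa> * z powr (1 / 2)"

text \<open>An entire function of the logarithm, so the one-sided limits of the phase on the cut
  come from those of \<open>Ln\<close>.\<close>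

definition phase_Ln :: "real \<Rightarrow> complex \<Rightarrow> complex" where
  "phase_Ln \<kappa> w = 2 / 3 * exp (3 / 2 * w) + of_real \<kappa> * exp (1 / 2 * w)"

text \<open>The multiple of the second column that undoes the ray jump between a ray and the
  negative axis. With all rays oriented towards 0, this region is the minus side of the upper ray
  and the plus side of the lower one, whence the opposite signs.\<close>

definition sector :: "complex \<Rightarrow> complex" where
  "sector z = (if \<bar>Im z\<bar> < - sqrt 3 * Re z then of_real (sgn (Im z)) else 0)"

text \<open>The factor is chosen such that the jump across the cut, upper minus lower value, is
  exactly 1.\<close>

definition branch_log :: "real \<Rightarrow> complex \<Rightarrow> complex" where
  "branch_log a z = Ln (z - of_real a) / (2 * of_real pi * \<i>)"

definition col1 :: "real \<Rightarrow> (complex \<Rightarrow> cmat2) \<Rightarrow> 2 \<Rightarrow> complex \<Rightarrow> complex" where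
  "col1 \<kappa> M i z = exp (- phase \<kappa> z) * M z $ i $ 1 + sector z * exp (phase \<kappa> z) * M z $ i $ 2"

definition col2 :: "real \<Rightarrow> real \<Rightarrow> (complex \<Rightarrow> cmat2) \<Rightarrow> 2 \<Rightarrow> complex \<Rightarrow> complex" where
  "col2 \<kappa> a M i z = exp (phase \<kappa> z) * M z $ i $ 2 - branch_log a z * col1 \<kappa> M i z"

lemma phase_eq_Ln: "z \<noteq> 0 \<Longrightarrow> phase \<kappa> z = phase_Ln \<kappa> (Ln z)"
  by (simp add: phase_def phase_Ln_def powr_def)

text \<open>Both exponents, 3/2 and 1/2, are half-odd, so a turn by 2 pi multiplies each term by -1.
  The phase therefore changes sign across the negative axis.\<close>

lemma phase_Ln_flip: "phase_Ln \<kappa> (w + \<i> * pi) = - phase_Ln \<kappa> (w - \<i> * pi)"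
proof -
  have "3 / 2 * (w + \<i> * pi) = 3 / 2 * (w - \<i> * pi) + 3 * (\<i> * pi)"
    by (simp add: field_simps)
  then have "exp (3 / 2 * (w + \<i> * pi)) = exp (3 / 2 * (w - \<i> * pi) + 3 * (\<i> * pi))"
    by (rule arg_cong)
  also have "\<dots> = exp (3 / 2 * (w - \<i> * pi)) * exp (\<i> * pi) ^ 3"
    by (simp only: exp_add exp_of_nat_mult[of 3, simplified])
  also have "\<dots> = - exp (3 / 2 * (w - \<i> * pi))"
    by (simp add: exp_Euler mult.commute)
  finally have 1: "exp (3 / 2 * (w + \<i> * pi)) = - exp (3 / 2 * (w - \<i> * pi))" .
  have "1 / 2 * (w + \<i> * pi) = 1 / 2 * (w - \<i> * pi) + \<i> * pi"
    by (simp add: field_simps)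
  then have "exp (1 / 2 * (w + \<i> * pi)) = exp (1 / 2 * (w - \<i> * pi) + \<i> * pi)"
    by (rule arg_cong)
  also have "\<dots> = - exp (1 / 2 * (w - \<i> * pi))"
    by (simp add: exp_add exp_Euler)
  finally have 2: "exp (1 / 2 * (w + \<i> * pi)) = - exp (1 / 2 * (w - \<i> * pi))" .
  show ?thesis unfolding phase_Ln_def 1 2 by simp
qed

lemma phase_tendsto:
  assumes "(Ln \<longlongrightarrow> L) (at t within X)" "t \<noteq> 0"
  shows "(phase \<kappa> \<longlongrightarrow> phase_Ln \<kappa> L) (at t within X)"
proof (rule Lim_transform_eventually)
  show "((\<lambda>z. phase_Ln \<kappa> (Ln z)) \<longlongrightarrow> phase_Ln \<kappa> L) (at t within X)"
    unfolding phase_Ln_def by (intro tendsto_intros assms(1))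
  have "\<forall>\<^sub>F z in at t within X. z \<in> - {0}"
    by (rule topological_tendstoD[OF tendsto_ident_at]) (use assms in auto)
  then show "\<forall>\<^sub>F z in at t within X. phase_Ln \<kappa> (Ln z) = phase \<kappa> z"
    by eventually_elim (simp add: phase_eq_Ln)
qed

lemma isCont_Ln_off_cut: "\<not> (Im t = 0 \<and> Re t \<le> 0) \<Longrightarrow> isCont Ln t"
  by (intro continuous_intros) (auto simp: complex_nonpos_Reals_iff)

lemma phase_tendsto_off_cut:
  assumes "\<not> (Im t = 0 \<and> Re t \<le> 0)"
  shows "(phase \<kappa> \<longlongrightarrow> phase \<kappa> t) (at t within X)"
proof -
  have "t \<noteq> 0" using assms by auto
  then show ?thesis using phase_tendsto[OF isCont_tendsto_within[OF isCont_Ln_off_cut[OF assms]], of \<kappa> X]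
    by (simp add: phase_eq_Ln)
qed

lemma branch_log_tendsto_off_cut:
  assumes "\<not> (Im t = 0 \<and> Re t \<le> a)"
  shows "(branch_log a \<longlongrightarrow> branch_log a t) (at t within X)"
  unfolding branch_log_def[abs_def]
  by (rule isCont_tendsto_within, intro continuous_intros) (use assms in
    \<open>auto simp: complex_nonpos_Reals_iff\<close>)

lemma branch_log_tendsto_sides:
  assumes "Im t = 0" "Re t < a"
  obtains l where "(branch_log a \<longlongrightarrow> l + 1) (at t within {w. Im w > 0})"
    "(branch_log a \<longlongrightarrow> l) (at t within {w. Im w < 0})"
proof -
  define l where "l = (Ln (- (t - of_real a)) - \<i> * pi) / (2 * of_real pi * \<i>)"
  have l1: "l + 1 = (Ln (- (t - of_real a)) + \<i> * pi) / (2 * of_real pi * \<i>)"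
    by (simp add: l_def field_simps)
  have sh: "filterlim (\<lambda>z. z - of_real a) (at (t - of_real a) within X) (at t within (\<lambda>z. z - of_real a)
    -` X)" for X
    unfolding filterlim_at by (intro conjI tendsto_intros) (auto simp: eventually_at_filter)
  have "((\<lambda>z. Ln (z - of_real a)) \<longlongrightarrow> Ln (- (t - of_real a)) + \<i> * pi) (at t within (\<lambda>z. z - of_real a) -` {w.
    Im w > 0})"
    by (rule filterlim_compose[OF Ln_tendsto_sides(1) sh]) (use assms in auto)
  then have 1: "(branch_log a \<longlongrightarrow> l + 1) (at t within {w. Im w > 0})"
    unfolding branch_log_def[abs_def] l1 by (intro tendsto_intros) (simp_all add: vimage_def)
  have "((\<lambda>z. Ln (z - of_real a)) \<longlongrightarrow> Ln (- (t - of_real a)) - \<i> * pi) (at t within (\<lambda>z. z - of_real a) -` {w.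
    Im w < 0})"
    by (rule filterlim_compose[OF Ln_tendsto_sides(2) sh]) (use assms in auto)
  then have 2: "(branch_log a \<longlongrightarrow> l) (at t within {w. Im w < 0})"
    unfolding branch_log_def[abs_def] l_def by (intro tendsto_intros) (simp_all add: vimage_def)
  show ?thesis using that 1 2 .
qed

lemma eventually_at_open: "open U \<Longrightarrow> t \<in> U \<Longrightarrow> \<forall>\<^sub>F z in at t within X. z \<in> U"
  by (rule topological_tendstoD[OF tendsto_ident_at])

lemma eventually_at_in: "\<forall>\<^sub>F z in at t within X. z \<in> X"
  by (simp add: eventually_at_filter)

lemma cols_tendsto:
  assumes M: "(M \<longlongrightarrow> P) F" and ph: "(phase \<kappa> \<longlongrightarrow> ph) F"
    and s: "\<forall>\<^sub>F z in F. sector z = s" and l: "(branch_log a \<longlongrightarrow> l) F"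
  shows "(col1 \<kappa> M i \<longlongrightarrow> exp (- ph) * P $ i $ 1 + s * exp ph * P $ i $ 2) F"
    and "(col2 \<kappa> a M i \<longlongrightarrow> exp ph * P $ i $ 2 - l * (exp (- ph) * P $ i $ 1 + s * exp ph * P $ i $ 2)) F"
proof -
  have "(sector \<longlongrightarrow> s) F"
    using s by (rule tendsto_eventually)
  then show 1: "(col1 \<kappa> M i \<longlongrightarrow> exp (- ph) * P $ i $ 1 + s * exp ph * P $ i $ 2) F"
    unfolding col1_def[abs_def] by (intro tendsto_intros M ph)
  show "(col2 \<kappa> a M i \<longlongrightarrow> exp ph * P $ i $ 2 - l * (exp (- ph) * P $ i $ 1 + s * exp ph * P $ i $ 2)) F"
    unfolding col2_def[abs_def] by (intro tendsto_intros M ph l 1)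
qed

section \<open>Matching of the modified columns across each piece of the contour\<close>

definition cols_match :: "real \<Rightarrow> real \<Rightarrow> (complex \<Rightarrow> cmat2) \<Rightarrow> complex \<Rightarrow> complex \<Rightarrow> bool" where
  "cols_match \<kappa> a M t d \<longleftrightarrow> (\<forall>i. \<forall>f\<in>{col1 \<kappa> M i, col2 \<kappa> a M i}.
     \<exists>l. (f \<longlongrightarrow> l) (at t within left_side t d) \<and> (f \<longlongrightarrow> l) (at t within right_side t d))"

text \<open>Separates analysis from algebra: after the limits of phase, sector and logarithm on both
  sides, only two identities in an arbitrary boundary value \<open>N\<close> from the right are
  left; the value from the left is then \<open>N ** J t\<close>.\<close>

lemma cols_matchI:
  assumes jump: "has_jump M \<Gamma> d J" "t \<in> \<Gamma>"
    and ph: "(phase \<kappa> \<longlongrightarrow> php) (at t within left_side t d)" "(phase \<kappa> \<longlongrightarrow> phm) (at t within right_side t d)"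
    and s: "\<forall>\<^sub>F z in at t within left_side t d. sector z = sp" "\<forall>\<^sub>F z in at t within right_side t d.
      sector z = sm"
    and l: "(branch_log a \<longlongrightarrow> lp) (at t within left_side t d)"
      "(branch_log a \<longlongrightarrow> lm) (at t within right_side t d)"
    and match: "\<And>(N :: cmat2) i. exp (- php) * (N ** J t) $ i $ 1 + sp * exp php * (N ** J t) $ i $ 2
        = exp (- phm) * N $ i $ 1 + sm * exp phm * N $ i $ 2"
      "\<And>(N :: cmat2) i. exp php * (N ** J t) $ i $ 2 - lp * (exp (- phm) * N $ i $ 1 + sm * exp phm
        * N $ i $ 2)
        = exp phm * N $ i $ 2 - lm * (exp (- phm) * N $ i $ 1 + sm * exp phm * N $ i $ 2)"
  shows "cols_match \<kappa> a M t d"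
proof -
  obtain P N where P: "(M \<longlongrightarrow> P) (at t within left_side t d)" and N: "(M \<longlongrightarrow> N) (at t within right_side t d)"
    and PN: "P = N ** J t"
    using jump unfolding has_jump_def by blast
  \<comment> \<open>The first identity of \<open>match\<close> rewrites \<open>col1\<close> also
    inside the limit of \<open>col2\<close>. This is why the factor of \<open>lp\<close> in the
    second identity is already in terms of the right side.\<close>
  note L = cols_tendsto[OF P ph(1) s(1) l(1), unfolded PN match]
  note R = cols_tendsto[OF N ph(2) s(2) l(2)]
  show ?thesis unfolding cols_match_def using L R by blast
qed

lemma left_right_side_1:
  "Im t = 0 \<Longrightarrow> left_side t 1 = {w. Im w > 0}" "Im t = 0 \<Longrightarrow> right_side t 1 = {w. Im w < 0}"
  by (auto simp: left_side_def right_side_def)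

text \<open>The jump exchanges the columns up to sign while the phase changes sign, so the
  exponentials fit again. The signs of \<open>sector\<close> make \<open>col1\<close> continuous,
  and the second column gains exactly \<open>col1\<close>, which the logarithm compensates.\<close>

lemma cols_match_negative:
  assumes "a \<ge> 0" "has_jump M (ray pi) 1 (\<lambda>z. mat2 0 1 (- 1) 0)" "t \<in> ray pi"
  shows "cols_match \<kappa> a M t 1"
proof -
  have t: "Im t = 0" "Re t < 0" "t \<noteq> 0" using assms by (auto simp: mem_ray_pi)
  note sides = left_right_side_1[OF t(1)]
  define ph where "ph = phase_Ln \<kappa> (Ln (- t) - \<i> * pi)"
  obtain l where l: "(branch_log a \<longlongrightarrow> l + 1) (at t within {w. Im w > 0})"
    "(branch_log a \<longlongrightarrow> l) (at t within {w. Im w < 0})"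
    using branch_log_tendsto_sides[of t a] t assms(1) by (metis less_le_trans)
  have ph: "(phase \<kappa> \<longlongrightarrow> - ph) (at t within {w. Im w > 0})" "(phase \<kappa> \<longlongrightarrow> ph) (at t within {w. Im w < 0})"
    using phase_tendsto[OF Ln_tendsto_sides(1)[OF t(1,2)] t(3), of \<kappa>] phase_tendsto[OF
      Ln_tendsto_sides(2)[OF t(1,2)] t(3), of \<kappa>]
    by (simp_all add: ph_def phase_Ln_flip)
  have "open {z. \<bar>Im z\<bar> < - sqrt 3 * Re z}"
    by (intro open_Collect_less continuous_intros)
  then have ev: "\<forall>\<^sub>F z in at t within X. z \<in> {z. \<bar>Im z\<bar> < - sqrt 3 * Re z}" for X
    by (rule eventually_at_open) (use t in \<open>simp add: mult_pos_neg\<close>)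
  have s: "\<forall>\<^sub>F z in at t within {w. Im w > 0}. sector z = 1"
    using ev eventually_at_in by eventually_elim (simp add: sector_def)
  have s': "\<forall>\<^sub>F z in at t within {w. Im w < 0}. sector z = - 1"
    using ev eventually_at_in by eventually_elim (simp add: sector_def)
  show ?thesis
    by (rule cols_matchI[OF assms(2,3), unfolded sides, OF ph s s' l])
       (simp_all add: matrix_mult_2_nth algebra_simps)
qed

text \<open>Conjugation by the exponentials turns the upper triangular entry into 1: the second
  column gains \<open>col1\<close>, as on the negative axis.\<close>

lemma cols_match_segment:
  assumes "has_jump M (segment0 a) 1 (\<lambda>z. mat2 1 (exp (- (2 * phase \<kappa> z))) 0 1)" "t \<in> segment0 a"
  shows "cols_match \<kappa> a M t 1"
proof -
  have t: "Im t = 0" "0 < Re t" "Re t < a" using assms by (auto simp: mem_segment0)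
  note sides = left_right_side_1[OF t(1)]
  obtain l where l: "(branch_log a \<longlongrightarrow> l + 1) (at t within {w. Im w > 0})"
    "(branch_log a \<longlongrightarrow> l) (at t within {w. Im w < 0})"
    using branch_log_tendsto_sides[of t a] t by metis
  have ph: "(phase \<kappa> \<longlongrightarrow> phase \<kappa> t) (at t within X)" for X
    by (rule phase_tendsto_off_cut) (use t in auto)
  have "open {z. 0 < Re z}"
    by (intro open_Collect_less continuous_intros)
  then have "\<forall>\<^sub>F z in at t within X. z \<in> {z. 0 < Re z}" for X
    by (rule eventually_at_open) (use t in simp)
  then have s: "\<forall>\<^sub>F z in at t within X. sector z = 0" for X
    by eventually_elim (smt (verit) mem_Collect_eq mult_neg_pos real_sqrt_gt_zero sector_def)
  have "exp (- (2 * phase \<kappa> t)) = exp (- phase \<kappa> t) * exp (- phase \<kappa> t)"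
    by (simp flip: exp_add)
  then show ?thesis
    by (intro cols_matchI[OF assms, unfolded sides, OF ph ph s s l])
       (simp_all add: matrix_mult_2_nth algebra_simps exp_minus_inverse)
qed

text \<open>Phase and logarithm are continuous here. The jump adds
  \<open>exp (2 * phase \<kappa> t)\<close> times the second column to the first, which after the
  factor \<open>exp (- phase \<kappa> t)\<close> is the \<open>sector\<close> term present on the
  right side only.\<close>

lemma cols_match_ray_up:
  assumes "a \<ge> 0" "has_jump M (ray (2 * pi / 3)) (- cis (2 * pi / 3)) (\<lambda>z. mat2 1 0 (exp (2 * phase \<kappa> z))
    1)" "t \<in> ray (2 * pi / 3)"
  shows "cols_match \<kappa> a M t (- cis (2 * pi / 3))"
proof -
  have t: "Re t < 0" "Im t = - sqrt 3 * Re t"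
    using assms(3) by (auto simp: mem_ray_up)
  have cis: "cis (2 * pi / 3) = Complex (- 1 / 2) ( sqrt 3 / 2)"
    by (simp add: complex_eq_iff cos_sin_two_thirds_pi)
  have sides: "left_side t (- cis (2 * pi / 3)) = {w. 0 < Im w + sqrt 3 * Re w}"
    "right_side t (- cis (2 * pi / 3)) = {w. Im w + sqrt 3 * Re w < 0}"
    unfolding left_side_def right_side_def cis using t by (auto simp: algebra_simps)
  have t0: "0 < Im t" using t by (simp add: mult_pos_neg)
  have ph: "(phase \<kappa> \<longlongrightarrow> phase \<kappa> t) (at t within X)" for X
    by (rule phase_tendsto_off_cut) (use t0 in auto)
  have l: "(branch_log a \<longlongrightarrow> branch_log a t) (at t within X)" for X
    by (rule branch_log_tendsto_off_cut) (use t0 in auto)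
  have "open {z. 0 < Im z}"
    by (intro open_Collect_less continuous_intros)
  then have ev: "\<forall>\<^sub>F z in at t within X. z \<in> {z. 0 < Im z}" for X
    by (rule eventually_at_open) (use t0 in simp)
  have s: "\<forall>\<^sub>F z in at t within {w. 0 < Im w + sqrt 3 * Re w}. sector z = 0"
    using ev eventually_at_in by eventually_elim (simp add: sector_def)
  have s': "\<forall>\<^sub>F z in at t within {w. Im w + sqrt 3 * Re w < 0}. sector z = 1"
    using ev eventually_at_in by eventually_elim (simp add: sector_def)
  have "exp (2 * phase \<kappa> t) = exp (phase \<kappa> t) * exp (phase \<kappa> t)"
    by (simp flip: exp_add)
  then show ?thesis
    by (intro cols_matchI[OF assms(2,3), unfolded sides, OF ph ph s s' l l])
       (simp_all add: matrix_mult_2_nth algebra_simps exp_minus_inverse)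
qed

text \<open>Now the sector lies on the left, so its term has to cancel the jump and carries the sign
  -1.\<close>

lemma cols_match_ray_down:
  assumes "a \<ge> 0" "has_jump M (ray (- (2 * pi / 3))) (- cis (- (2 * pi / 3))) (\<lambda>z.
    mat2 1 0 (exp (2 * phase \<kappa> z)) 1)" "t \<in> ray (- (2 * pi / 3))"
  shows "cols_match \<kappa> a M t (- cis (- (2 * pi / 3)))"
proof -
  have t: "Re t < 0" "Im t = sqrt 3 * Re t"
    using assms(3) by (auto simp: mem_ray_down)
  have cis: "cis (- (2 * pi / 3)) = Complex (- 1 / 2) (- sqrt 3 / 2)"
    by (simp add: complex_eq_iff cos_sin_two_thirds_pi)
  have sides: "left_side t (- cis (- (2 * pi / 3))) = {w. sqrt 3 * Re w - Im w < 0}"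
    "right_side t (- cis (- (2 * pi / 3))) = {w. 0 < sqrt 3 * Re w - Im w}"
    unfolding left_side_def right_side_def cis using t by (auto simp: algebra_simps)
  have t0: "Im t < 0" using t by (simp add: mult_pos_neg)
  have ph: "(phase \<kappa> \<longlongrightarrow> phase \<kappa> t) (at t within X)" for X
    by (rule phase_tendsto_off_cut) (use t0 in auto)
  have l: "(branch_log a \<longlongrightarrow> branch_log a t) (at t within X)" for X
    by (rule branch_log_tendsto_off_cut) (use t0 in auto)
  have "open {z. Im z < 0}"
    by (intro open_Collect_less continuous_intros)
  then have ev: "\<forall>\<^sub>F z in at t within X. z \<in> {z. Im z < 0}" for X
    by (rule eventually_at_open) (use t0 in simp)
  have s: "\<forall>\<^sub>F z in at t within {w. sqrt 3 * Re w - Im w < 0}. sector z = - 1"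
    using ev eventually_at_in by eventually_elim (simp add: sector_def)
  have s': "\<forall>\<^sub>F z in at t within {w. 0 < sqrt 3 * Re w - Im w}. sector z = 0"
    using ev eventually_at_in by eventually_elim (simp add: sector_def)
  have "exp (2 * phase \<kappa> t) = exp (phase \<kappa> t) * exp (phase \<kappa> t)"
    by (simp flip: exp_add)
  then show ?thesis
    by (intro cols_matchI[OF assms(2,3), unfolded sides, OF ph ph s s' l l])
       (simp_all add: matrix_mult_2_nth algebra_simps exp_minus_inverse)
qed

subsection \<open>Entire extension of the columns\<close>

text \<open>The common form of the two problems: \<kappa> = 0 and endpoint a = \<alpha> for the
  right one, \<kappa> = \<alpha> and a = 0 for the left one.\<close>

locale airy_rhp =
  fixes \<kappa> a :: real and M :: "complex \<Rightarrow> cmat2"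
  assumes a_nonneg: "a \<ge> 0"
    and analytic: "analytic_off M (contour_right a)"
    and jump_segment: "has_jump M (segment0 a) 1 (\<lambda>z. mat2 1 (exp (- (2 * phase \<kappa> z))) 0 1)"
    and jump_up: "has_jump M (ray (2 * pi / 3)) (- cis (2 * pi / 3)) (\<lambda>z. mat2 1 0 (exp (2 * phase \<kappa> z)) 1)"
    and jump_down: "has_jump M (ray (- (2 * pi / 3))) (- cis (- (2 * pi / 3))) (\<lambda>z.
      mat2 1 0 (exp (2 * phase \<kappa> z)) 1)"
    and jump_negative: "has_jump M (ray pi) 1 (\<lambda>z. mat2 0 1 (- 1) 0)"
    and log_0: "at_most_log_at M (contour_right a) 0"
    and log_a: "at_most_log_at M (contour_right a) (of_real a)"
    and normalized: "normalized_at_infinity M (contour_right a)"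
begin

abbreviation \<Sigma> :: "complex set" where "\<Sigma> \<equiv> contour_right a"

lemmas mem_\<Sigma> = mem_contour_right[OF a_nonneg]

lemma open_compl: "open (- \<Sigma>)"
  using closed_contour_right[OF a_nonneg] by auto

lemma dense: "z islimpt - \<Sigma>"
  by (rule islimpt_compl_negligible[OF negligible_contour_right[OF a_nonneg]])

lemma sector_holomorphic: "sector holomorphic_on - \<Sigma>"
proof -
  let ?U = "{z. \<bar>Im z\<bar> < - sqrt 3 * Re z} \<inter> {z. Im z > 0}"
  let ?L = "{z. \<bar>Im z\<bar> < - sqrt 3 * Re z} \<inter> {z. Im z < 0}"
  let ?R = "{z. \<bar>Im z\<bar> > - sqrt 3 * Re z}"
  have op: "open ?U" "open ?L" "open ?R"
    by (intro open_Int open_Collect_less continuous_intros)+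
  have "sector holomorphic_on ?U \<longleftrightarrow> (\<lambda>_. 1) holomorphic_on ?U"
    by (rule holomorphic_cong) (auto simp: sector_def)
  moreover have "sector holomorphic_on ?L \<longleftrightarrow> (\<lambda>_. -1) holomorphic_on ?L"
    by (rule holomorphic_cong) (auto simp: sector_def)
  moreover have "sector holomorphic_on ?R \<longleftrightarrow> (\<lambda>_. 0) holomorphic_on ?R"
    by (rule holomorphic_cong) (auto simp: sector_def)
  ultimately have "sector holomorphic_on ?U \<union> ?L \<union> ?R"
    using op by (intro holomorphic_on_Un open_Un) auto
  moreover have "- \<Sigma> \<subseteq> ?U \<union> ?L \<union> ?R"
  proof
    fix z assume z: "z \<in> - \<Sigma>"
    have "Re z < 0" if "\<bar>Im z\<bar> < - sqrt 3 * Re z"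
      using that by (smt (verit) mult_minus_left mult_nonneg_nonneg real_sqrt_ge_zero)
    then show "z \<in> ?U \<union> ?L \<union> ?R" using z a_nonneg unfolding Compl_iff mem_\<Sigma> by force
  qed
  ultimately show ?thesis by (rule holomorphic_on_subset)
qed

lemma off_cut:
  assumes "z \<in> - \<Sigma>" shows "z \<notin> \<real>\<^sub>\<le>\<^sub>0" "z - of_real a \<notin> \<real>\<^sub>\<le>\<^sub>0"
  using assms a_nonneg by (auto simp: mem_\<Sigma> complex_nonpos_Reals_iff)

lemma phase_holomorphic: "phase \<kappa> holomorphic_on - \<Sigma>"
  unfolding phase_def[abs_def] using off_cut(1) by (intro holomorphic_intros) auto

lemma entry_holomorphic: "(\<lambda>z. M z $ i $ j) holomorphic_on - \<Sigma>"
  using analytic unfolding analytic_off_def by (simp add: analytic_imp_holomorphic)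

lemma col1_holomorphic: "col1 \<kappa> M i holomorphic_on - \<Sigma>"
  unfolding col1_def[abs_def]
  by (intro holomorphic_intros phase_holomorphic sector_holomorphic entry_holomorphic)

lemma col2_holomorphic: "col2 \<kappa> a M i holomorphic_on - \<Sigma>"
  unfolding col2_def[abs_def] branch_log_def
  using off_cut(2) by (intro holomorphic_intros phase_holomorphic sector_holomorphic entry_holomorphic
    col1_holomorphic) auto

text \<open>The open set \<open>U\<close> isolates one straight piece: inside it the contour is the
  full line through \<open>s\<close>, as the extension across a line requires.\<close>

lemma cols_extend_across_piece:
  assumes d: "d \<noteq> 0" and U: "open U" "s \<in> U"
    and line: "\<And>w. w \<in> U \<Longrightarrow> w \<in> \<Sigma> \<longleftrightarrow> Im ((w - s) * cnj d) = 0"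
    and match: "\<And>t. t \<in> U \<inter> \<Sigma> \<Longrightarrow> cols_match \<kappa> a M t d"
    and f: "f \<in> {col1 \<kappa> M i, col2 \<kappa> a M i}"
  shows "\<exists>B h. open B \<and> s \<in> B \<and> h holomorphic_on B \<and> (\<forall>z\<in>B \<inter> - \<Sigma>. h z = f z)"
proof -
  obtain r where r: "r > 0" "ball s r \<subseteq> U" using U by (meson openE)
  have f_hol: "f holomorphic_on - \<Sigma>" using f col1_holomorphic col2_holomorphic by auto
  obtain h where h: "h holomorphic_on ball s r"
    "\<And>z. z \<in> ball s r - {w. Im ((w - s) * cnj d) = 0} \<Longrightarrow> h z = f z"
  proof (rule holomorphic_extend_across_line[OF d, of f s r])
    show "f holomorphic_on ball s r - {w. Im ((w - s) * cnj d) = 0}"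
      by (rule holomorphic_on_subset[OF f_hol]) (use r line in auto)
    fix t assume "t \<in> ball s r \<inter> {w. Im ((w - s) * cnj d) = 0}"
    then have "t \<in> U \<inter> \<Sigma>" using r line by auto
    then show "\<exists>l. (f \<longlongrightarrow> l) (at t within left_side t d) \<and> (f \<longlongrightarrow> l) (at t within right_side t d)"
      using match f unfolding cols_match_def by blast
  next
    fix h assume "h holomorphic_on ball s r" "\<And>z. z \<in> ball s r - {w. Im ((w - s) * cnj d) = 0} \<Longrightarrow> h z = f z"
    then show thesis by (rule that)
  qed
  then show ?thesis using r line by (intro exI[of _ "ball s r"] exI[of _ h]) auto
qed

lemma cols_extend_regular:
  assumes s: "s \<noteq> 0" "s \<noteq> of_real a" and f: "f \<in> {col1 \<kappa> M i, col2 \<kappa> a M i}"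
  shows "\<exists>B h. open B \<and> s \<in> B \<and> h holomorphic_on B \<and> (\<forall>z\<in>B \<inter> - \<Sigma>. h z = f z)"
proof -
  have f_hol: "f holomorphic_on - \<Sigma>" using f col1_holomorphic col2_holomorphic by auto
  \<comment> \<open>Keeps the two rays out of the right half-plane, where only the segment can meet
    the contour.\<close>
  have sq: "- (sqrt 3 * x) < y" "y \<noteq> - (sqrt 3 * x)" if "x > 0" "0 \<le> y" for x y :: real
    using that by (smt (verit) mult_pos_pos real_sqrt_gt_zero)+
  consider "s \<notin> \<Sigma>" | "s \<in> ray pi" | "s \<in> segment0 a" | "s \<in> ray (2 * pi / 3)" | "s \<in> ray (- (2 * pi / 3))"
    using s unfolding contour_right_def contour_left_def by blast
  then show ?thesis
  proof cases
    case 1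
    then show ?thesis using open_compl f_hol by blast
  next
    case 2
    show ?thesis
    proof (rule cols_extend_across_piece[OF _ _ _ _ _ f])
      \<comment> \<open>The open sector between the two rays meets the contour in the negative axis
        only. The strip and the two quadrants of the other cases isolate their pieces in the same
        way.\<close>
      show "open {z. \<bar>Im z\<bar> < - sqrt 3 * Re z}" by (intro open_Collect_less continuous_intros)
      show "s \<in> {z. \<bar>Im z\<bar> < - sqrt 3 * Re z}" using 2 by (auto simp: mem_ray_pi mult_pos_neg)
      have neg: "Re w < 0" if "w \<in> {z. \<bar>Im z\<bar> < - sqrt 3 * Re z}" for w
      proof -
        have "sqrt 3 * Re w < 0" using that abs_ge_zero[of "Im w"] by (simp del: abs_ge_zero)
        then show ?thesis by (simp add: mult_less_0_iff)
      qed
      show "w \<in> \<Sigma> \<longleftrightarrow> Im ((w - s) * cnj 1) = 0" if "w \<in> {z. \<bar>Im z\<bar> < - sqrt 3 * Re z}" for w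
        using that 2 neg[OF that] a_nonneg by (auto simp: mem_\<Sigma> mem_ray_pi)
      show "cols_match \<kappa> a M t 1" if "t \<in> {z. \<bar>Im z\<bar> < - sqrt 3 * Re z} \<inter> \<Sigma>" for t
        using that neg by (intro cols_match_negative[OF a_nonneg jump_negative]) (auto simp: mem_\<Sigma>
          mem_ray_pi)
    qed simp
  next
    case 3
    show ?thesis
    proof (rule cols_extend_across_piece[OF _ _ _ _ _ f])
      show "open {z. 0 < Re z \<and> Re z < a}" by (intro open_Collect_conj open_Collect_less continuous_intros)
      show "s \<in> {z. 0 < Re z \<and> Re z < a}" using 3 by (auto simp: mem_segment0)
      show "w \<in> \<Sigma> \<longleftrightarrow> Im ((w - s) * cnj 1) = 0" if "w \<in> {z. 0 < Re z \<and> Re z < a}" for w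
        using that 3 sq(2)[of "Re w" "\<bar>Im w\<bar>"] by (auto simp: mem_\<Sigma> mem_segment0)
      show "cols_match \<kappa> a M t 1" if "t \<in> {z. 0 < Re z \<and> Re z < a} \<inter> \<Sigma>" for t
        using that sq(2)[of "Re t" "\<bar>Im t\<bar>"]
        by (intro cols_match_segment[OF jump_segment]) (auto simp: mem_\<Sigma> mem_segment0)
    qed simp
  next
    case 4
    have cis: "cis (2 * pi / 3) = Complex (- 1 / 2) (sqrt 3 / 2)"
      by (simp add: complex_eq_iff cos_sin_two_thirds_pi)
    show ?thesis
    proof (rule cols_extend_across_piece[OF _ _ _ _ _ f])
      show "open {z. Re z < 0 \<and> 0 < Im z}" by (intro open_Collect_conj open_Collect_less continuous_intros)
      show "s \<in> {z. Re z < 0 \<and> 0 < Im z}" using 4 by (auto simp: mem_ray_up mult_pos_neg)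
      show "w \<in> \<Sigma> \<longleftrightarrow> Im ((w - s) * cnj (- cis (2 * pi / 3))) = 0" if "w \<in> {z. Re z < 0 \<and> 0 < Im z}" for w
        using that 4 unfolding mem_ray_up cis by (auto simp: mem_\<Sigma> algebra_simps)
      show "cols_match \<kappa> a M t (- cis (2 * pi / 3))" if "t \<in> {z. Re z < 0 \<and> 0 < Im z} \<inter> \<Sigma>" for t
        using that by (intro cols_match_ray_up[OF a_nonneg jump_up]) (auto simp: mem_\<Sigma> mem_ray_up)
    qed simp
  next
    case 5
    have cis: "cis (- (2 * pi / 3)) = Complex (- 1 / 2) (- sqrt 3 / 2)"
      by (simp add: complex_eq_iff cos_sin_two_thirds_pi)
    show ?thesis
    proof (rule cols_extend_across_piece[OF _ _ _ _ _ f])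
      show "open {z. Re z < 0 \<and> Im z < 0}" by (intro open_Collect_conj open_Collect_less continuous_intros)
      show "s \<in> {z. Re z < 0 \<and> Im z < 0}" using 5 by (auto simp: mem_ray_down mult_pos_neg)
      show "w \<in> \<Sigma> \<longleftrightarrow> Im ((w - s) * cnj (- cis (- (2 * pi / 3)))) = 0" if "w \<in> {z. Re z < 0 \<and> Im z < 0}" for w
        using that 5 unfolding mem_ray_down cis by (auto simp: mem_\<Sigma> algebra_simps)
      show "cols_match \<kappa> a M t (- cis (- (2 * pi / 3)))" if "t \<in> {z. Re z < 0 \<and> Im z < 0} \<inter> \<Sigma>" for t
        using that by (intro cols_match_ray_down[OF a_nonneg jump_down]) (auto simp: mem_\<Sigma> mem_ray_down)
    qed simp
  qed
qed

end

section \<open>Growth of the columns at the endpoints\<close>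

lemma norm_entry_le: "norm ((A :: cmat2) $ i $ j) \<le> norm A"
  by (rule order_trans[OF Finite_Cartesian_Product.norm_nth_le Finite_Cartesian_Product.norm_nth_le])

lemma norm_exp_phase_le:
  assumes "norm z \<le> R"
  shows "norm (exp (phase \<kappa> z)) \<le> exp (R powr (3 / 2) + \<bar>\<kappa>\<bar> * R powr (1 / 2))"
    and "norm (exp (- phase \<kappa> z)) \<le> exp (R powr (3 / 2) + \<bar>\<kappa>\<bar> * R powr (1 / 2))"
proof -
  have "norm (phase \<kappa> z) \<le> norm (2 / 3 * z powr (3 / 2)) + norm (of_real \<kappa> * z powr (1 / 2))"
    unfolding phase_def by (rule norm_triangle_ineq)
  also have "\<dots> = 2 / 3 * norm z powr (3 / 2) + \<bar>\<kappa>\<bar> * norm z powr (1 / 2)"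
    by (simp add: norm_mult norm_powr_real_powr')
  also have "\<dots> \<le> 1 * R powr (3 / 2) + \<bar>\<kappa>\<bar> * R powr (1 / 2)"
    using assms by (intro add_mono mult_mono powr_mono2) auto
  finally have "norm (phase \<kappa> z) \<le> R powr (3 / 2) + \<bar>\<kappa>\<bar> * R powr (1 / 2)" by simp
  then show "norm (exp (phase \<kappa> z)) \<le> exp (R powr (3 / 2) + \<bar>\<kappa>\<bar> * R powr (1 / 2))"
    "norm (exp (- phase \<kappa> z)) \<le> exp (R powr (3 / 2) + \<bar>\<kappa>\<bar> * R powr (1 / 2))"
    using norm_exp[of "phase \<kappa> z"] norm_exp[of "- phase \<kappa> z"]
      by (smt (verit) exp_le_cancel_iff norm_minus_cancel)+
qed

lemma norm_sector_le: "norm (sector z) \<le> 1"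
  by (simp add: sector_def sgn_real_def)

lemma norm_Ln_le_abs_ln:
  assumes "z \<noteq> 0" shows "norm (Ln z) \<le> \<bar>ln (norm z)\<bar> + pi"
proof -
  have "\<bar>Im (Ln z)\<bar> \<le> pi" using mpi_less_Im_Ln[OF assms] Im_Ln_le_pi[OF assms] by simp
  then show ?thesis using cmod_le[of "Ln z"] assms by simp
qed

text \<open>The square is needed because \<open>col2\<close> multiplies \<open>branch_log\<close> by
  an entry of \<open>M\<close> that may itself be logarithmic.\<close>

lemma tendsto_times_ln_squared:
  "((\<lambda>z. norm (z - p) * (ln (norm (z - p)))\<^sup>2) \<longlongrightarrow> 0) (at p within X)"
proof -
  have "((\<lambda>x :: real. x * (ln x)\<^sup>2) \<longlongrightarrow> 0) (at_right 0)" by real_asymp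
  moreover have "filterlim (\<lambda>z. norm (z - p)) (at_right 0) (at p within X)"
    unfolding filterlim_at
  proof
    show "\<forall>\<^sub>F z in at p within X. norm (z - p) \<in> {0<..} \<and> norm (z - p) \<noteq> 0"
      by (auto simp: eventually_at_filter)
    have "((\<lambda>z. norm (z - p)) \<longlongrightarrow> norm (p - p)) (at p within X)" by (intro tendsto_intros)
    then show "((\<lambda>z. norm (z - p)) \<longlongrightarrow> 0) (at p within X)" by simp
  qed
  ultimately show ?thesis by (rule filterlim_compose)
qed

text \<open>Allows constants to be absorbed into the logarithm near \<open>p\<close>.\<close>

lemma eventually_abs_ln_ge_1: "\<forall>\<^sub>F z in at p within X. 1 \<le> \<bar>ln (norm (z - p))\<bar>"
  unfolding eventually_at
proof (intro exI[of _ "exp (- 1)"] conjI ballI impI)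
  fix z assume "z \<noteq> p \<and> dist z p < exp (- 1)"
  then have "0 < norm (z - p)" "norm (z - p) < exp (- 1)" by (auto simp: dist_norm)
  then have "ln (norm (z - p)) < - 1" using ln_less_cancel_iff[of "norm (z - p)" "exp (- 1)"] by simp
  then show "1 \<le> \<bar>ln (norm (z - p))\<bar>" by simp
qed simp

context airy_rhp
begin

lemma log_p: "p \<in> {0, of_real a} \<Longrightarrow> at_most_log_at M \<Sigma> p"
  using log_0 log_a by auto

text \<open>At p = a the logarithm itself is singular; at p = 0 different from a it stays bounded,
  and a bounded quantity is below a multiple of the large
  \<open>\<bar>ln (norm (z - p))\<bar>\<close>. The summand \<open>pi\<close> accounts for the
  argument, and 1 / (2 pi) is rounded up to 1.\<close>

lemma branch_log_log_bound:
  assumes p: "p \<in> {0, of_real a}"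
  obtains C where "C \<ge> 0" "\<forall>\<^sub>F z in at p within - \<Sigma>. norm (branch_log a z) \<le> C * \<bar>ln (norm (z - p))\<bar>"
proof -
  have "\<exists>K\<ge>0. \<forall>\<^sub>F z in at p within - \<Sigma>. \<bar>ln (norm (z - of_real a))\<bar> \<le> K * \<bar>ln (norm (z - p))\<bar>"
  proof (cases "p = of_real a")
    case True then show ?thesis by (intro exI[of _ 1]) auto
  next
    case False
    then have "a \<noteq> 0" "p = 0" using p by auto
    have "((\<lambda>z. \<bar>ln (norm (z - of_real a))\<bar>) \<longlongrightarrow> \<bar>ln (norm (0 - complex_of_real a))\<bar>) (at 0 within - \<Sigma>)"
      using \<open>a \<noteq> 0\<close> by (intro tendsto_intros) auto
    then have "\<forall>\<^sub>F z in at p within - \<Sigma>. \<bar>ln (norm (z - of_real a))\<bar> < \<bar>ln \<bar>a\<bar>\<bar> + 1"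
      using \<open>p = 0\<close> by (intro order_tendstoD(2)[where y = "\<bar>ln \<bar>a\<bar>\<bar>"]) simp_all
    with eventually_abs_ln_ge_1[of p "- \<Sigma>"]
    have "\<forall>\<^sub>F z in at p within - \<Sigma>. \<bar>ln (norm (z - of_real a))\<bar> \<le> (\<bar>ln \<bar>a\<bar>\<bar> + 1) * \<bar>ln (norm (z - p))\<bar>"
    proof eventually_elim
      case (elim z)
      have "\<bar>ln (norm (z - of_real a))\<bar> \<le> (\<bar>ln \<bar>a\<bar>\<bar> + 1) * 1"
        using elim(2) by simp
      also have "\<dots> \<le> (\<bar>ln \<bar>a\<bar>\<bar> + 1) * \<bar>ln (norm (z - p))\<bar>"
        by (rule mult_left_mono[OF elim(1)]) simp
      finally show ?case .
    qed
    then show ?thesis by (intro exI[of _ "\<bar>ln \<bar>a\<bar>\<bar> + 1"]) auto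
  qed
  then obtain K where K: "K \<ge> 0" "\<forall>\<^sub>F z in at p within - \<Sigma>. \<bar>ln (norm (z - of_real a))\<bar>
    \<le> K * \<bar>ln (norm (z - p))\<bar>"
    by blast
  have "\<forall>\<^sub>F z in at p within - \<Sigma>. norm (branch_log a z) \<le> (K + pi) * \<bar>ln (norm (z - p))\<bar>"
    using K(2) eventually_abs_ln_ge_1 eventually_at_in
  proof eventually_elim
    case (elim z)
    then have "z - of_real a \<noteq> 0" using off_cut(2)[of z] by auto
    have "norm (branch_log a z) = norm (Ln (z - of_real a)) / (2 * pi)"
      by (simp add: branch_log_def norm_divide norm_mult)
    also have "\<dots> \<le> norm (Ln (z - of_real a)) / 1"
      by (rule divide_left_mono) (use pi_ge_two in auto)
    also have "\<dots> \<le> \<bar>ln (norm (z - of_real a))\<bar> + pi * 1"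
      using norm_Ln_le_abs_ln[OF \<open>z - of_real a \<noteq> 0\<close>] by simp
    also have "\<dots> \<le> K * \<bar>ln (norm (z - p))\<bar> + pi * \<bar>ln (norm (z - p))\<bar>"
      using elim by (intro add_mono mult_left_mono) auto
    finally show ?case by (simp add: algebra_simps)
  qed
  then show ?thesis using that[of "K + pi"] K(1) by auto
qed

lemma cols_log_bound:
  assumes p: "p \<in> {0, of_real a}" and f: "f \<in> {col1 \<kappa> M i, col2 \<kappa> a M i}"
  obtains C where "\<forall>\<^sub>F z in at p within - \<Sigma>. norm (f z) \<le> C * (ln (norm (z - p)))\<^sup>2"
proof -
  let ?F = "at p within - \<Sigma>" and ?l = "\<lambda>z. \<bar>ln (norm (z - p))\<bar>"
  obtain m where m: "m > 0" "\<forall>\<^sub>F z in ?F. norm (M z) \<le> m * ?l z"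
    using log_p[OF p] unfolding at_most_log_at_def by (auto elim!: landau_o.bigE)
  define R where "R = norm p + 1"
  define K where "K = exp (R powr (3 / 2) + \<bar>\<kappa>\<bar> * R powr (1 / 2))"
  have "\<forall>\<^sub>F z in ?F. z \<in> {z. norm z < R}"
    by (rule eventually_at_open) (auto simp: R_def intro!: open_Collect_less continuous_intros)
  then have e: "\<forall>\<^sub>F z in ?F. norm (exp (phase \<kappa> z)) \<le> K \<and> norm (exp (- phase \<kappa> z)) \<le> K"
    unfolding K_def by eventually_elim (blast intro: norm_exp_phase_le less_imp_le)
  obtain c where c: "c \<ge> 0" "\<forall>\<^sub>F z in ?F. norm (branch_log a z) \<le> c * ?l z"
    by (rule branch_log_log_bound[OF p])
  have K0: "K > 0" by (simp add: K_def)
  have 1: "\<forall>\<^sub>F z in ?F. norm (col1 \<kappa> M i z) \<le> 2 * K * m * ?l z"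
    using m(2) e
  proof eventually_elim
    case (elim z)
    have "norm (col1 \<kappa> M i z) \<le> norm (exp (- phase \<kappa> z)) * norm (M z $ i $ 1) + norm (sector z) * norm
      (exp (phase \<kappa> z)) * norm (M z $ i $ 2)"
      unfolding col1_def by (rule order_trans[OF norm_triangle_ineq]) (simp add: norm_mult)
    also have "\<dots> \<le> K * (m * ?l z) + 1 * K * (m * ?l z)"
      using elim norm_sector_le[of z] norm_entry_le[of "M z" i 1] norm_entry_le[of "M z" i 2] K0
      by (intro add_mono mult_mono) auto
    finally show ?case by (simp add: algebra_simps)
  qed
  have 2: "\<forall>\<^sub>F z in ?F. norm (col2 \<kappa> a M i z) \<le> K * m * ?l z + c * ?l z * (2 * K * m * ?l z)"
    using m(2) e c(2) 1
  proof eventually_elim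
    case (elim z)
    have "norm (col2 \<kappa> a M i z) \<le> norm (exp (phase \<kappa> z)) * norm (M z $ i $ 2) + norm (branch_log a z) * norm
      (col1 \<kappa> M i z)"
      unfolding col2_def by (rule order_trans[OF norm_triangle_ineq4]) (simp add: norm_mult)
    also have "\<dots> \<le> K * (m * ?l z) + c * ?l z * (2 * K * m * ?l z)"
      using elim norm_entry_le[of "M z" i 2] K0 c m
      by (intro add_mono mult_mono) auto
    finally show ?case by (simp add: algebra_simps)
  qed
  have sq: "x \<le> (ln (norm (z - p)))\<^sup>2" if "1 \<le> ?l z" "x = ?l z" for x z
    using mult_right_mono[OF that(1), of "?l z"] that(2) by (simp add: power2_eq_square)
  from f consider "f = col1 \<kappa> M i" | "f = col2 \<kappa> a M i" by auto
  then show ?thesis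
  proof cases
    case 1
    have "\<forall>\<^sub>F z in ?F. norm (f z) \<le> 2 * K * m * (ln (norm (z - p)))\<^sup>2"
      using \<open>\<forall>\<^sub>F z in ?F. norm (col1 \<kappa> M i z) \<le> 2 * K * m * ?l z\<close> eventually_abs_ln_ge_1
    proof eventually_elim
      case (elim z)
      have "2 * K * m * ?l z \<le> 2 * K * m * (ln (norm (z - p)))\<^sup>2"
        using sq[OF elim(2) refl] K0 m by (intro mult_left_mono) auto
      then show ?case using elim(1) 1 by simp
    qed
    then show ?thesis by (rule that)
  next
    case 2
    have "\<forall>\<^sub>F z in ?F. norm (f z) \<le> (K * m + 2 * c * K * m) * (ln (norm (z - p)))\<^sup>2"
      using \<open>\<forall>\<^sub>F z in ?F. norm (col2 \<kappa> a M i z) \<le> _ z\<close> eventually_abs_ln_ge_1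
    proof eventually_elim
      case (elim z)
      have "K * m * ?l z \<le> K * m * (ln (norm (z - p)))\<^sup>2"
        using sq[OF elim(2) refl] K0 m by (intro mult_left_mono) auto
      moreover have "c * ?l z * (2 * K * m * ?l z) = 2 * c * K * m * (ln (norm (z - p)))\<^sup>2"
        by (simp add: power2_eq_square algebra_simps)
      ultimately show ?case using elim(1) unfolding 2 distrib_right by linarith
    qed
    then show ?thesis by (rule that)
  qed
qed

text \<open>A squared logarithm is beaten by one factor z - p, so both endpoints are
  removable.\<close>

lemma cols_removable:
  assumes p: "p \<in> {0, of_real a}" and f: "f \<in> {col1 \<kappa> M i, col2 \<kappa> a M i}"
  shows "((\<lambda>z. (z - p) * f z) \<longlongrightarrow> 0) (at p within - \<Sigma>)"
proof -
  obtain C where C: "\<forall>\<^sub>F z in at p within - \<Sigma>. norm (f z) \<le> C * (ln (norm (z - p)))\<^sup>2"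
    by (rule cols_log_bound[OF p f])
  have "((\<lambda>z. C * (norm (z - p) * (ln (norm (z - p)))\<^sup>2)) \<longlongrightarrow> C * 0) (at p within - \<Sigma>)"
    by (intro tendsto_intros tendsto_times_ln_squared)
  then have "((\<lambda>z. C * (norm (z - p) * (ln (norm (z - p)))\<^sup>2)) \<longlongrightarrow> 0) (at p within - \<Sigma>)"
    by simp
  moreover have "\<forall>\<^sub>F z in at p within - \<Sigma>. norm ((z - p) * f z)
    \<le> C * (norm (z - p) * (ln (norm (z - p)))\<^sup>2)"
    using C
  proof eventually_elim
    case (elim z)
    then show ?case using mult_left_mono[OF elim norm_ge_zero[of "z - p"]]
      by (simp add: norm_mult mult.left_commute)
  qed
  ultimately show ?thesis by (rule Lim_null_comparison[rotated])
qed

theorem cols_entire: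
  assumes f: "f \<in> {col1 \<kappa> M i, col2 \<kappa> a M i}"
  obtains g where "g holomorphic_on UNIV" "\<And>z. z \<in> - \<Sigma> \<Longrightarrow> g z = f z"
proof -
  have p_mem: "0 \<in> \<Sigma>" "of_real a \<in> \<Sigma>"
    by (auto simp: contour_right_def contour_left_def)
  have "\<exists>B h. open B \<and> s \<in> B \<and> h holomorphic_on B \<and> (\<forall>z\<in>B \<inter> - \<Sigma>. h z = f z)" for s
  proof (cases "s \<in> {0, of_real a}")
    case True
    \<comment> \<open>The radius keeps the other endpoint out of the ball; for a = 0 there is no
      other one.\<close>
    define r where "r = (if a = 0 then 1 else \<bar>a\<bar>)"
    show ?thesis
    proof (rule holomorphic_extend_puncture[where p = s and r = r])
      show "r > 0" by (simp add: r_def)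
      show "((\<lambda>z. (z - s) * f z) \<longlongrightarrow> 0) (at s within - \<Sigma>)" by (rule cols_removable[OF True f])
      show "s \<notin> - \<Sigma>" using True p_mem by auto
      show "\<exists>B h. open B \<and> t \<in> B \<and> h holomorphic_on B \<and> (\<forall>z\<in>B \<inter> - \<Sigma>. h z = f z)" if "t \<in> ball s r - {s}"
        for t
        using that True by (intro cols_extend_regular[OF _ _ f]) (auto simp: r_def dist_norm split:
          if_splits)
    qed (rule dense)
  next
    case False
    then show ?thesis by (intro cols_extend_regular[OF _ _ f]) auto
  qed
  from holomorphic_local_extensions[OF open_UNIV dense this] that show thesis by auto
qed

end

subsection \<open>Normalization at infinity\<close>

text \<open>The constant factor of the second column of \<open>model_mat\<close>;
  \<open>half_cis'\<close> is that of the first, up to sign. Only their product 1 / 2 and the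
  modulus of the square matter.\<close>

definition half_cis :: complex where "half_cis = exp (of_real pi * \<i> / 4) / of_real (sqrt 2)"
definition half_cis' :: complex where "half_cis' = exp (- (of_real pi * \<i> / 4)) / of_real (sqrt 2)"

lemma half_cis_mult: "half_cis * half_cis' = 1 / 2" "half_cis' * half_cis = 1 / 2"
  by (simp_all add: half_cis_def half_cis'_def exp_minus_inverse mult.commute flip: of_real_mult)

lemma norm_half_cis_square: "norm (half_cis\<^sup>2) = 1 / 2"
proof -
  have "norm (exp (of_real pi * \<i> / 4)) = 1" using norm_exp_i_times[of "pi / 4"] by (simp add: mult.commute)
  then show ?thesis by (simp add: half_cis_def norm_power norm_divide power_divide)
qed

lemma model_mat_nth:
  "model_mat z $ 1 $ 1 = half_cis' * z powr (- 1 / 4)" "model_mat z $ 1 $ 2 = half_cis * z powr (- 1 / 4)"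
  "model_mat z $ 2 $ 1 = - half_cis' * z powr (1 / 4)" "model_mat z $ 2 $ 2 = half_cis * z powr (1 / 4)"
  by (simp_all add: model_mat_def powr_sigma3_def exp_sigma3_def matrix_mult_2_nth half_cis_def
    half_cis'_def scaleR_conv_of_real[where 'a = complex])

lemma powr_quarter:
  assumes "z \<noteq> 0"
  shows "z powr (- 1 / 4) = inverse (z powr (1 / 4))" "(z powr (1 / 4))\<^sup>2 = csqrt z" "z powr (1 / 4) \<noteq> 0"
proof -
  show "z powr (- 1 / 4) = inverse (z powr (1 / 4))" "z powr (1 / 4) \<noteq> 0"
    using assms by (simp_all add: powr_def flip: exp_minus)
  have "(z powr (1 / 4))\<^sup>2 = z powr (1 / 4 + 1 / 4)"
    unfolding power2_eq_square powr_add ..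
  then show "(z powr (1 / 4))\<^sup>2 = csqrt z" by (simp add: csqrt_conv_powr)
qed

text \<open>As a polynomial in the square root, the phase can be compared with another one by pure
  algebra.\<close>

lemma phase_csqrt:
  assumes "z \<noteq> 0" shows "phase \<kappa> z = 2 / 3 * csqrt z ^ 3 + of_real \<kappa> * csqrt z"
proof -
  have "csqrt z ^ 3 = exp (of_nat 3 * (1 / 2 * Ln z))"
    using assms by (simp only: csqrt_conv_powr powr_def exp_of_nat_mult) simp
  then show ?thesis using assms by (simp add: phase_def csqrt_conv_powr powr_def)
qed

lemma cmat2_det_mult:
  fixes A B :: cmat2
  shows "(A ** B) $ 1 $ 1 * (A ** B) $ 2 $ 2 - (A ** B) $ 1 $ 2 * (A ** B) $ 2 $ 1 =
    (A $ 1 $ 1 * A $ 2 $ 2 - A $ 1 $ 2 * A $ 2 $ 1) * (B $ 1 $ 1 * B $ 2 $ 2 - B $ 1 $ 2 * B $ 2 $ 1)"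
  unfolding matrix_mult_2_nth by algebra

lemma model_mat_det:
  assumes "z \<noteq> 0"
  shows "model_mat z $ 1 $ 1 * model_mat z $ 2 $ 2 - model_mat z $ 1 $ 2 * model_mat z $ 2 $ 1 = 1"
proof -
  have "z powr (- 1 / 4) * z powr (1 / 4) = 1" using powr_quarter[OF assms] by simp
  moreover have "2 * (half_cis * half_cis') = 1" by (simp add: half_cis_mult)
  ultimately show ?thesis unfolding model_mat_nth by algebra
qed

context airy_rhp
begin

lemma normalized_explicit:
  obtains E K N where "N > 0" "K > 0"
    "\<And>z. z \<in> - \<Sigma> \<Longrightarrow> M z = (mat 1 + E z) ** model_mat z"
    "\<And>z i j. z \<in> - \<Sigma> \<Longrightarrow> norm z \<ge> N \<Longrightarrow> norm (E z $ i $ j) \<le> K / norm z"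
proof -
  obtain E where E: "\<forall>z\<in>- \<Sigma>. M z = (mat 1 + E z) ** model_mat z"
    "(\<lambda>z. norm (E z)) \<in> O[inf at_infinity (principal (- \<Sigma>))](\<lambda>z. 1 / norm z)"
    using normalized unfolding normalized_at_infinity_def by blast
  obtain K where K: "K > 0" "\<forall>\<^sub>F z in inf at_infinity (principal (- \<Sigma>)). norm (norm (E z))
    \<le> K * norm (1 / norm z)"
    using landau_o.bigE[OF E(2)] by blast
  then obtain N where N: "\<And>z. norm z \<ge> N \<Longrightarrow> z \<in> - \<Sigma> \<Longrightarrow> norm (E z) \<le> K / norm z"
    unfolding eventually_inf_principal eventually_at_infinity by auto
  have "norm (E z $ i $ j) \<le> K / norm z" if "norm z \<ge> max N 1" "z \<in> - \<Sigma>" for z i j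
    using N[of z] norm_entry_le[of "E z" i j] that by linarith
  then show ?thesis using that[of "max N 1" K E] K(1) E(1) by auto
qed

text \<open>The \<open>sector\<close> and \<open>branch_log\<close> terms add a multiple of one
  column to the other, and the two exponentials are reciprocal; neither changes the
  determinant.\<close>

lemma cols_det:
  "col1 \<kappa> M 1 z * col2 \<kappa> a M 2 z - col2 \<kappa> a M 1 z * col1 \<kappa> M 2 z = M z $ 1 $ 1 * M z $ 2 $ 2
    - M z $ 1 $ 2 * M z $ 2 $ 1"
proof -
  define e e' s l where "e = exp (phase \<kappa> z)" and "e' = exp (- phase \<kappa> z)" and "s = sector z" and
    "l = branch_log a z"
  have "e * e' = 1" by (simp add: e_def e'_def exp_minus_inverse)
  then show ?thesis unfolding col1_def col2_def e_def[symmetric] e'_def[symmetric] s_def[symmetric]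
    l_def[symmetric]
    by algebra
qed

lemma det_tendsto_1:
  "((\<lambda>z. M z $ 1 $ 1 * M z $ 2 $ 2 - M z $ 1 $ 2 * M z $ 2 $ 1) \<longlongrightarrow> 1) (inf at_infinity (principal (- \<Sigma>)))"
proof -
  let ?F = "inf at_infinity (principal (- \<Sigma>))"
  obtain E K N where E: "N > 0" "K > 0"
    "\<And>z. z \<in> - \<Sigma> \<Longrightarrow> M z = (mat 1 + E z) ** model_mat z"
    "\<And>z i j. z \<in> - \<Sigma> \<Longrightarrow> norm z \<ge> N \<Longrightarrow> norm (E z $ i $ j) \<le> K / norm z"
    using normalized_explicit by metis
  have E0: "((\<lambda>z. E z $ i $ j) \<longlongrightarrow> 0) ?F" for i j
  proof (rule Lim_null_comparison)
    show "\<forall>\<^sub>F z in ?F. norm (E z $ i $ j) \<le> K / norm z"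
      unfolding eventually_inf_principal eventually_at_infinity using E(4) by blast
    have "((\<lambda>z :: complex. K / norm z) \<longlongrightarrow> 0) at_infinity"
      by (intro tendsto_divide_0[OF tendsto_const] filterlim_at_top_imp_at_infinity filterlim_norm_at_top)
    then show "((\<lambda>z. K / norm z) \<longlongrightarrow> 0) ?F" by (rule filterlim_mono) auto
  qed
  have "((\<lambda>z. (1 + E z $ 1 $ 1) * (1 + E z $ 2 $ 2) - E z $ 1 $ 2 * E z $ 2 $ 1) \<longlongrightarrow> (1 + 0) * (1 + 0)
    - 0 * 0) ?F"
    by (intro tendsto_intros E0)
  moreover have "\<forall>\<^sub>F z in ?F. (1 + E z $ 1 $ 1) * (1 + E z $ 2 $ 2) - E z $ 1 $ 2 * E z $ 2 $ 1
      = M z $ 1 $ 1 * M z $ 2 $ 2 - M z $ 1 $ 2 * M z $ 2 $ 1"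
    unfolding eventually_inf_principal
  proof (intro always_eventually allI impI)
    fix z assume z: "z \<in> - \<Sigma>"
    then have "z \<noteq> 0" by (auto simp: contour_right_def contour_left_def)
    show "(1 + E z $ 1 $ 1) * (1 + E z $ 2 $ 2) - E z $ 1 $ 2 * E z $ 2 $ 1
      = M z $ 1 $ 1 * M z $ 2 $ 2 - M z $ 1 $ 2 * M z $ 2 $ 1"
      unfolding E(3)[OF z] cmat2_det_mult model_mat_det[OF \<open>z \<noteq> 0\<close>] by (simp add: mat_def)
  qed
  ultimately show ?thesis using Lim_transform_eventually by force
qed

text \<open>A continuous function inherits the bound on the contour from the dense complement, at
  the price of a weak inequality.\<close>

lemma eventually_at_infinity_closure:
  assumes "continuous_on UNIV (g :: complex \<Rightarrow> complex)" "\<forall>\<^sub>F z in inf at_infinity (principal (- \<Sigma>)).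
    norm (g z - c) < e"
  shows "\<forall>\<^sub>F z in at_infinity. norm (g z - c) \<le> e"
proof -
  obtain N where N: "\<And>z. norm z \<ge> N \<Longrightarrow> z \<in> - \<Sigma> \<Longrightarrow> norm (g z - c) < e"
    using assms(2) unfolding eventually_inf_principal eventually_at_infinity by blast
  have "norm (g z - c) \<le> e" if z: "norm z \<ge> N + 1" for z
  proof (rule tendsto_upperbound[where F = "at z within - \<Sigma>" and f = "\<lambda>z. norm (g z - c)"])
    have "isCont g z" using assms(1) by (simp add: continuous_on_eq_continuous_at)
    then show "((\<lambda>z. norm (g z - c)) \<longlongrightarrow> norm (g z - c)) (at z within - \<Sigma>)"
      by (intro tendsto_intros isCont_tendsto_within)
    have "\<forall>\<^sub>F w in at z within - \<Sigma>. w \<in> {w. norm w > N}"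
      by (rule eventually_at_open) (use z in \<open>auto intro!: open_Collect_less continuous_intros\<close>)
    with eventually_at_in show "\<forall>\<^sub>F w in at z within - \<Sigma>. norm (g w - c) \<le> e"
      by eventually_elim (use N in \<open>force intro: less_imp_le\<close>)
    show "at z within - \<Sigma> \<noteq> bot" using dense by (simp add: trivial_limit_within)
  qed
  then show ?thesis unfolding eventually_at_infinity by blast
qed

text \<open>The determinant of the extended columns is entire with limit 1 at infinity, hence
  constant by Liouville's theorem.\<close>

lemma entire_cols:
  obtains u e where "\<And>i. u i holomorphic_on UNIV" "\<And>i. e i holomorphic_on UNIV"
    "\<And>i z. z \<in> - \<Sigma> \<Longrightarrow> u i z = col1 \<kappa> M i z" "\<And>i z. z \<in> - \<Sigma> \<Longrightarrow> e i z = col2 \<kappa> a M i z"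
    "\<And>z. u 1 z * e 2 z - e 1 z * u 2 z = 1"
proof -
  have "\<forall>i. \<exists>g. g holomorphic_on UNIV \<and> (\<forall>z\<in>-\<Sigma>. g z = col1 \<kappa> M i z)"
    "\<forall>i. \<exists>g. g holomorphic_on UNIV \<and> (\<forall>z\<in>-\<Sigma>. g z = col2 \<kappa> a M i z)"
    by (metis cols_entire insertCI)+
  then obtain u e where u: "\<And>i. u i holomorphic_on UNIV" "\<And>i z. z \<in> -\<Sigma> \<Longrightarrow> u i z = col1 \<kappa> M i z"
    and e: "\<And>i. e i holomorphic_on UNIV" "\<And>i z. z \<in> -\<Sigma> \<Longrightarrow> e i z = col2 \<kappa> a M i z"
    by metis
  define D where "D z = u 1 z * e 2 z - e 1 z * u 2 z" for z
  have D: "D holomorphic_on UNIV" unfolding D_def[abs_def] by (intro holomorphic_intros u e)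
  have "(D \<longlongrightarrow> 1) (inf at_infinity (principal (- \<Sigma>)))"
    by (rule Lim_transform_eventually[OF det_tendsto_1])
       (auto simp: eventually_inf_principal D_def u e cols_det intro!: always_eventually)
  have "(D \<longlongrightarrow> 1) at_infinity"
  proof (rule tendstoI)
    fix r :: real assume "r > 0"
    then have "\<forall>\<^sub>F z in inf at_infinity (principal (- \<Sigma>)). norm (D z - 1) < r / 2"
      using tendstoD[OF \<open>(D \<longlongrightarrow> 1) (inf at_infinity _)\<close>, of "r / 2"] by (simp add: dist_norm)
    then have "\<forall>\<^sub>F z in at_infinity. norm (D z - 1) \<le> r / 2"
      by (rule eventually_at_infinity_closure[OF holomorphic_on_imp_continuous_on[OF D]])
    then show "\<forall>\<^sub>F z in at_infinity. dist (D z) 1 < r"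
      by eventually_elim (use \<open>r > 0\<close> in \<open>simp add: dist_norm\<close>)
  qed
  then have "D z = 1" for z using Liouville_weak[OF D] by blast
  then show ?thesis using that[of u e] u e unfolding D_def by blast
qed

end

subsection \<open>Comparison of two phases\<close>

text \<open>Principal square roots of two points in the same open half-plane lie in the same closed
  quadrant, so their sum cannot cancel: its square modulus is at least the sum of the two, hence at
  least twice the product of the moduli.\<close>

lemma norm_csqrt_sum_ge:
  assumes "Im p * Im q > 0"
  shows "norm (csqrt p) * norm (csqrt q) \<le> (norm (csqrt p + csqrt q))\<^sup>2"
proof -
  have "Im (csqrt p) * Im (csqrt q) \<ge> 0"
    using assms by (auto simp: zero_less_mult_iff zero_le_mult_iff complex_Re_le_cmod)
  moreover have "Re (csqrt p) * Re (csqrt q) \<ge> 0"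
    by (intro mult_nonneg_nonneg) (rule Re_csqrt)+
  ultimately have "(norm (csqrt p))\<^sup>2 + (norm (csqrt q))\<^sup>2 \<le> (norm (csqrt p + csqrt q))\<^sup>2"
    unfolding cmod_power2 by (simp add: power2_eq_square algebra_simps)
  moreover have "2 * (norm (csqrt p) * norm (csqrt q)) \<le> (norm (csqrt p))\<^sup>2 + (norm (csqrt q))\<^sup>2"
    using sum_squares_bound[of "norm (csqrt p)" "norm (csqrt q)"] by simp
  moreover have "0 \<le> norm (csqrt p) * norm (csqrt q)" by simp
  ultimately show ?thesis by linarith
qed

text \<open>The shift \<open>z \<mapsto> z - s\<close> is chosen such that the \<open>\<surd>z\<close>-terms of the two phases cancel.\<close>

lemma phase_difference:
  assumes "p = z - of_real s" "q = z - of_real t" "p \<noteq> 0" "q \<noteq> 0"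
  defines "D \<equiv> csqrt q - csqrt p"
  shows "phase s p - phase t q = - of_real (s + t) * D / 2 - D ^ 3 / 6"
    and "D * (csqrt p + csqrt q) = of_real (s - t)"
proof -
  define P Q where "P = csqrt p" and "Q = csqrt q"
  have "P\<^sup>2 = z - of_real s" "Q\<^sup>2 = z - of_real t" by (simp_all add: P_def Q_def assms)
  then have *: "of_real s - of_real t = Q\<^sup>2 - P\<^sup>2" by simp
  then show "D * (csqrt p + csqrt q) = of_real (s - t)"
    unfolding D_def P_def[symmetric] Q_def[symmetric] by (simp add: algebra_simps power2_eq_square)
  \<comment> \<open>Since s = z - P^2, the phase at \<open>p\<close> equals z P - P^3 / 3, and
    likewise for \<open>q\<close>. The factor 12 clears the denominators.\<close>
  have "12 * (2 / 3 * P ^ 3 + of_real s * P - (2 / 3 * Q ^ 3 + of_real t * Q))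
    = 12 * (- (of_real s + of_real t) * (Q - P) / 2 - (Q - P) ^ 3 / 6)"
    using * by (simp add: field_simps) algebra
  then have "2 / 3 * P ^ 3 + of_real s * P - (2 / 3 * Q ^ 3 + of_real t * Q)
    = - (of_real s + of_real t) * (Q - P) / 2 - (Q - P) ^ 3 / 6"
    unfolding mult_cancel_left by (metis zero_neq_numeral)
  then show "phase s p - phase t q = - of_real (s + t) * D / 2 - D ^ 3 / 6"
    unfolding D_def phase_csqrt[OF assms(3)] phase_csqrt[OF assms(4)] P_def[symmetric] Q_def[symmetric]
      by simp
qed

text \<open>The weight is the growth of the product of two second-row entries of the model matrices.
  It is at most the modulus of the sum of the roots, while difference times sum of the roots is the
  constant s - t. The weight is also at least 1, which bounds the difference itself and so controls
  the cubic term.\<close>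

lemma phase_difference_bound:
  assumes "p = z - of_real s" "q = z - of_real t" "Im z \<noteq> 0"
    and large: "1 \<le> norm p" "1 \<le> norm q"
  shows "norm (phase s p - phase t q) * (norm (p powr (1 / 4)) * norm (q powr (1 / 4)))
     \<le> \<bar>s + t\<bar> * \<bar>s - t\<bar> + \<bar>s - t\<bar> ^ 3"
proof -
  define D S where "D = csqrt q - csqrt p" and "S = csqrt p + csqrt q"
  define r where "r = norm (p powr (1 / 4)) * norm (q powr (1 / 4))"
  have nz: "p \<noteq> 0" "q \<noteq> 0" using large by auto
  have n: "norm (csqrt w) = (norm (w powr (1 / 4)))\<^sup>2" if "w \<noteq> 0" for w
    using powr_quarter(2)[OF that] by (metis norm_power)
  have "Im p * Im q > 0" using assms(1-3) by (simp add: zero_less_mult_iff) linarith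
  then have "r\<^sup>2 \<le> (norm S)\<^sup>2"
    using norm_csqrt_sum_ge[of p q] unfolding n[OF nz(1)] n[OF nz(2)] r_def S_def
      by (simp add: power_mult_distrib)
  then have rS: "r \<le> norm S" by (rule power2_le_imp_le) simp
  have n4: "norm (w powr (1 / 4)) \<ge> 1" if "norm w \<ge> 1" for w :: complex
    using that ge_one_powr_ge_zero by (simp add: norm_powr_real_powr')
  have r1: "1 \<le> r" unfolding r_def using mult_mono[OF n4[OF large(1)] n4[OF large(2)]] by simp
  have DS: "norm D * norm S = \<bar>s - t\<bar>"
    using arg_cong[OF phase_difference(2)[OF assms(1,2) nz], of norm]
    unfolding D_def S_def norm_mult norm_of_real .
  have Dr: "norm D * r \<le> \<bar>s - t\<bar>"
    using mult_left_mono[OF rS, of "norm D"] DS by simp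
  have D1: "norm D \<le> \<bar>s - t\<bar>"
    using Dr mult_left_mono[OF r1, of "norm D"] by simp
  have "norm (phase s p - phase t q) \<le> norm (of_real (s + t) * D / 2) + norm (D ^ 3 / 6)"
    unfolding phase_difference(1)[OF assms(1,2) nz] D_def[symmetric]
    by (rule order_trans[OF norm_triangle_ineq4]) (simp add: norm_mult norm_divide del: of_real_add
      minus_add_distrib)
  also have "\<dots> \<le> \<bar>s + t\<bar> * norm D + norm D ^ 3"
    unfolding norm_divide norm_mult norm_power norm_of_real norm_numeral
    using mult_nonneg_nonneg[OF abs_ge_zero[of "s + t"] norm_ge_zero[of D]] zero_le_power[OF
      norm_ge_zero[of D], of 3]
    by linarith
  finally have "norm (phase s p - phase t q) * r \<le> (\<bar>s + t\<bar> * norm D + norm D ^ 3) * r"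
    using r1 by (intro mult_right_mono) auto
  also have "\<dots> = \<bar>s + t\<bar> * (norm D * r) + norm D ^ 2 * (norm D * r)"
    by (simp add: algebra_simps power2_eq_square power3_eq_cube)
  also have "\<dots> \<le> \<bar>s + t\<bar> * \<bar>s - t\<bar> + \<bar>s - t\<bar> ^ 2 * \<bar>s - t\<bar>"
    using r1 by (intro add_mono mult_left_mono mult_mono Dr power_mono D1) auto
  finally show ?thesis unfolding r_def by (simp add: power2_eq_square power3_eq_cube)
qed

text \<open>For two points at the same height, different sector values mean that the boundary of the
  sector separates them, so both are within \<open>d\<close> of it. Far out this forces a negative
  real part and a height comparable to the modulus. The constant 3 arises from |w| <= 2 |Im w| + d
  with d < |w| / 3.\<close>

lemma sector_mismatch:
  assumes "Im p = Im q" "\<bar>Re p - Re q\<bar> \<le> d" "sector p \<noteq> sector q" "w \<in> {p, q}" "norm w > 3 * d"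
  shows "Re w < 0" "norm w \<le> 3 * \<bar>Im w\<bar>"
proof -
  define y where "y = \<bar>Im p\<bar>"
  have sq: "1 \<le> sqrt 3" "sqrt 3 \<le> 2" by (auto intro: real_le_lsqrt)
  have "(y < - sqrt 3 * Re p) \<noteq> (y < - sqrt 3 * Re q)"
    using assms(1,3) unfolding sector_def y_def by (auto split: if_splits)
  then obtain i j where ij: "{i, j} = {Re p, Re q}" "y < - sqrt 3 * i" "y \<ge> - sqrt 3 * j"
    by (metis insert_commute not_le)
  have d: "\<bar>i - j\<bar> \<le> d" using ij(1) assms(2) by (auto simp: doubleton_eq_iff)
  have w: "Re w \<in> {i, j}" "\<bar>Im w\<bar> = y" using assms(1,4) ij(1) by (auto simp: y_def)
  have y0: "y \<ge> 0" by (simp add: y_def)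
  have i0: "i < 0" using ij(2) y0 sq by (smt (verit) mult_nonneg_nonneg mult_minus_left)
  have j1: "- j \<le> y"
  proof (cases "j \<ge> 0")
    case False
    then have "- j \<le> sqrt 3 * - j" using sq mult_right_mono[of 1 "sqrt 3" "- j"] by simp
    then show ?thesis using ij(3) by simp
  qed (use y0 in simp)
  have nw: "norm w \<le> \<bar>Re w\<bar> + y" using cmod_le[of w] w(2) by simp
  show neg: "Re w < 0"
  proof (rule ccontr)
    \<comment> \<open>Then \<open>w\<close> is the point outside the sector and both points are
      within \<open>d\<close> of the imaginary axis. The inner one gives y < 2 d, hence |w| <= 3
      d.\<close>
    assume "\<not> Re w < 0"
    then have "Re w = j" "j \<ge> 0" using w i0 by auto
    then have "- i \<le> d" "j \<le> d" using d i0 by auto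
    have "y < sqrt 3 * - i" using ij(2) by simp
    also have "\<dots> \<le> 2 * d" using \<open>- i \<le> d\<close> i0 sq by (intro mult_mono) auto
    finally show False using nw assms(5) \<open>Re w = j\<close> \<open>j \<le> d\<close> \<open>j \<ge> 0\<close> by simp
  qed
  have "- Re w \<le> y + d" using w(1) j1 d by auto
  then show "norm w \<le> 3 * \<bar>Im w\<bar>" using nw neg w(2) assms(5) by simp
qed

text \<open>With root A + i B the real part of the cube is A (A^2 - 3 B^2). A negative Re w makes
  the bracket at most -(A^2 + B^2), and |w| <= 3 |Im w| = 6 A |B| forces A to be at least one sixth
  of the modulus of the root.\<close>

lemma Re_csqrt_cubed_le:
  assumes "Re w < 0" "norm w \<le> 3 * \<bar>Im w\<bar>" "w \<noteq> 0"
  shows "Re (csqrt w ^ 3) \<le> - (norm (csqrt w) ^ 3 / 6)"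
proof -
  define A B where "A = Re (csqrt w)" and "B = Im (csqrt w)"
  have P: "csqrt w = Complex A B" by (simp only: A_def B_def complex.collapse)
  have "Complex A B ^ 2 = w" using P by (metis power2_csqrt)
  then have R: "Re w = A\<^sup>2 - B\<^sup>2" and I: "Im w = 2 * A * B" by (auto simp: power2_eq_square)
  define n where "n = norm (csqrt w)"
  have n2: "n\<^sup>2 = A\<^sup>2 + B\<^sup>2" by (simp add: n_def P cmod_power2)
  have nw: "norm w = n\<^sup>2" unfolding n_def by (metis norm_power power2_csqrt)
  have n0: "n > 0" using assms(3) by (simp add: n_def)
  have A0: "A \<ge> 0" unfolding A_def by (rule Re_csqrt)
  have Bn: "\<bar>B\<bar> \<le> n" unfolding n_def P using abs_Im_le_cmod[of "Complex A B"] by simp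
  have "n * n \<le> 6 * A * \<bar>B\<bar>" using assms(2) nw I A0 by (simp add: abs_mult power2_eq_square)
  also have "\<dots> \<le> 6 * A * n" using A0 Bn by (intro mult_left_mono) auto
  finally have An: "n \<le> 6 * A" using n0 by simp
  have "A\<^sup>2 - 3 * B\<^sup>2 \<le> - n\<^sup>2" using R assms(1) n2 by linarith
  then have "A * (A\<^sup>2 - 3 * B\<^sup>2) \<le> A * - n\<^sup>2" using A0 by (rule mult_left_mono)
  also have "\<dots> \<le> n / 6 * - n\<^sup>2" using An by (intro mult_right_mono_neg) auto
  finally have "A * (A\<^sup>2 - 3 * B\<^sup>2) \<le> - (n ^ 3 / 6)" by (simp add: power2_eq_square power3_eq_cube)
  moreover have "Re (csqrt w ^ 3) = A * (A\<^sup>2 - 3 * B\<^sup>2)"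
    unfolding P by (simp add: power3_eq_cube power2_eq_square algebra_simps)
  ultimately show ?thesis by (simp add: n_def)
qed

text \<open>With x = |w|^(1/4) the cubic term contributes at most -x^6 / 9, where 1/9 = 2/3 * 1/6.
  The threshold says x >= 9 (|\<kappa>| + 1), which lets it absorb |\<kappa>| x^2 from the square
  root term and one more x that pays for the weight.\<close>

lemma exp_phase_decay:
  assumes "Re w < 0" "norm w \<le> 3 * \<bar>Im w\<bar>" and large: "norm w \<ge> (9 * (\<bar>\<kappa>\<bar> + 1)) ^ 4"
  shows "norm (exp (phase \<kappa> w)) * norm (w powr (1 / 4)) \<le> 1"
proof -
  define x where "x = norm (w powr (1 / 4))"
  define c where "c = 9 * (\<bar>\<kappa>\<bar> + 1)"
  have c: "c \<ge> 9" by (simp add: c_def)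
  have w0: "w \<noteq> 0" using assms by auto
  have n: "norm (csqrt w) = x\<^sup>2"
    using powr_quarter(2)[OF w0] unfolding x_def by (metis norm_power)
  have x0: "x \<ge> 0" by (simp add: x_def)
  have "x ^ 4 = (norm (csqrt w))\<^sup>2" unfolding n by simp
  also have "\<dots> = norm w" by (metis norm_power power2_csqrt)
  finally have x4: "x ^ 4 = norm w" .
  have "c ^ 4 \<le> x ^ 4" using large x4 by (simp add: c_def)
  then have xc: "c \<le> x" using x0 by (rule power_le_imp_le_base[of _ 3, simplified])
  have "Re (phase \<kappa> w) = 2 / 3 * Re (csqrt w ^ 3) + \<kappa> * Re (csqrt w)"
    unfolding phase_csqrt[OF w0] by simp
  also have "\<dots> \<le> 2 / 3 * - ((x\<^sup>2) ^ 3 / 6) + \<bar>\<kappa>\<bar> * x\<^sup>2"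
  proof (intro add_mono mult_left_mono)
    show "Re (csqrt w ^ 3) \<le> - ((x\<^sup>2) ^ 3 / 6)" using Re_csqrt_cubed_le[OF assms(1,2) w0] n by simp
    have "\<kappa> * Re (csqrt w) \<le> \<bar>\<kappa>\<bar> * \<bar>Re (csqrt w)\<bar>" by (metis abs_ge_self abs_mult)
    also have "\<dots> \<le> \<bar>\<kappa>\<bar> * x\<^sup>2" using abs_Re_le_cmod[of "csqrt w"] n by (intro mult_left_mono) auto
    finally show "\<kappa> * Re (csqrt w) \<le> \<bar>\<kappa>\<bar> * x\<^sup>2" .
  qed simp
  finally have R: "Re (phase \<kappa> w) \<le> \<bar>\<kappa>\<bar> * x\<^sup>2 - x ^ 6 / 9" by (simp add: power_mult[symmetric])
  have "x + \<bar>\<kappa>\<bar> * x\<^sup>2 \<le> (\<bar>\<kappa>\<bar> + 1) * x\<^sup>2"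
    using xc c by (simp add: algebra_simps power2_eq_square)
  also have "\<dots> \<le> (x ^ 4 / 9) * x\<^sup>2"
  proof (rule mult_right_mono)
    have "c * 1 \<le> x * x ^ 3" using xc c by (intro mult_mono one_le_power) auto
    then show "\<bar>\<kappa>\<bar> + 1 \<le> x ^ 4 / 9" by (simp add: c_def power_Suc[symmetric] del: power_Suc)
  qed simp
  also have "\<dots> = x ^ 6 / 9" by (simp add: power_add[symmetric])
  finally have "x + Re (phase \<kappa> w) \<le> 0" using R by simp
  have "norm (exp (phase \<kappa> w)) * x \<le> exp (Re (phase \<kappa> w)) * exp x"
  proof (intro mult_mono)
    show "x \<le> exp x" using exp_ge_add_one_self[of x] by linarith
  qed (auto simp: x0)
  also have "\<dots> = exp (x + Re (phase \<kappa> w))" by (simp add: exp_add)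
  also have "\<dots> \<le> 1" using \<open>x + Re (phase \<kappa> w) \<le> 0\<close> by simp
  finally show ?thesis by (simp add: x_def)
qed

section \<open>Boundedness of the pairing of two model matrices\<close>

lemma norm_exp_diff_le: "norm (exp w - exp (- w)) \<le> 2 * exp (norm w) * norm (w :: complex)"
proof -
  have "norm (exp v - 1) \<le> exp (norm w) * norm w" if "norm v = norm w" for v :: complex
    using Taylor_exp_field[of v 0] that by simp
  from this[of w] this[of "- w"] norm_triangle_ineq4[of "exp w - 1" "exp (- w) - 1"] show ?thesis by simp
qed

text \<open>What is left of the pairing of two solutions once the left factors
  \<open>mat 1 + E\<close> are pulled out; \<open>k\<close> and \<open>n\<close> are rows of the two
  model matrices. The last term is the mismatch of the two sectors.\<close>

definition model_pairing :: "real \<Rightarrow> real \<Rightarrow> complex \<Rightarrow> complex \<Rightarrow> 2 \<Rightarrow> 2 \<Rightarrow> complex" where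
  "model_pairing s t p q k n =
     exp (- (phase s p - phase t q)) * model_mat p $ k $ 1 * model_mat q $ n $ 2
     - exp (phase s p - phase t q) * model_mat p $ k $ 2 * model_mat q $ n $ 1
     + (sector p - sector q) * exp (phase s p) * exp (phase t q) * model_mat p $ k $ 2 * model_mat
       q $ n $ 2"

text \<open>Equal rows produce the difference of exp(-\<delta>) and exp(\<delta>), which is small
  enough to compensate the growth |z|^(1/2). Different rows produce their sum, which is merely
  bounded, but the quarter powers then occur as a quotient. The mismatch term lives near the rays
  and decays there.\<close>

lemma model_pairing_bounded:
  obtains X N where "\<And>z k n. Im z \<noteq> 0 \<Longrightarrow> norm z \<ge> N \<Longrightarrow>
    norm (model_pairing s t (z - of_real s) (z - of_real t) k n) \<le> X"
proof
  define K where "K = \<bar>s + t\<bar> * \<bar>s - t\<bar> + \<bar>s - t\<bar> ^ 3"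
  \<comment> \<open>One summand per requirement: the two shifts, the threshold of
    \<open>sector_mismatch\<close>, norm at least 1, and the thresholds of
    \<open>exp_phase_decay\<close> for both phases.\<close>
  define N where "N = \<bar>s\<bar> + \<bar>t\<bar> + 3 * \<bar>s - t\<bar> + 1 + (9 * (\<bar>s\<bar> + 1)) ^ 4 + (9 * (\<bar>t\<bar> + 1)) ^ 4"
  fix z and k n :: 2
  assume z: "Im z \<noteq> 0" "norm z \<ge> N"
  define p q where "p = z - of_real s" and "q = z - of_real t"
  define x y where "x = p powr (1 / 4)" and "y = q powr (1 / 4)"
  define \<delta> where "\<delta> = phase s p - phase t q"
  define \<eta> where "\<eta> = (sector p - sector q) * exp (phase s p) * exp (phase t q)"
  have K0: "K \<ge> 0" by (simp add: K_def)
  have "norm z \<le> norm p + \<bar>s\<bar>" "norm z \<le> norm q + \<bar>t\<bar>"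
    using norm_triangle_ineq[of p "of_real s"] norm_triangle_ineq[of q "of_real t"]
      by (simp_all add: p_def q_def)
  moreover have "0 \<le> (9 * (\<bar>s\<bar> + 1)) ^ 4" "0 \<le> (9 * (\<bar>t\<bar> + 1)) ^ 4" by simp_all
  ultimately have large: "norm p > 3 * \<bar>s - t\<bar>" "norm q > 3 * \<bar>s - t\<bar>" "1 \<le> norm p" "1 \<le> norm q"
    "norm p \<ge> (9 * (\<bar>s\<bar> + 1)) ^ 4" "norm q \<ge> (9 * (\<bar>t\<bar> + 1)) ^ 4"
    using z(2) abs_ge_zero[of "s - t"] abs_ge_zero[of s] abs_ge_zero[of t] unfolding N_def by linarith+
  have nz: "p \<noteq> 0" "q \<noteq> 0" using large by auto
  have "x ^ 4 = p" "y ^ 4 = q"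
    using powr_quarter(2)[OF nz(1)] powr_quarter(2)[OF nz(2)] power_mult[of x 2 2] power_mult[of y 2 2]
    by (simp_all add: x_def y_def)
  then have x4: "norm x ^ 4 = norm p" "norm y ^ 4 = norm q"
    by (simp_all flip: norm_power)
  have x1: "1 \<le> norm x" "1 \<le> norm y"
    unfolding x_def y_def using large by (simp_all add: norm_powr_real_powr' ge_one_powr_ge_zero)
  \<comment> \<open>The two shifted points have comparable moduli, so the quotients of their quarter
    powers are bounded.\<close>
  have "norm (p - q) = \<bar>s - t\<bar>" unfolding p_def q_def
    by (simp add: norm_minus_commute flip: of_real_diff)
  then have "norm p \<le> 2 * norm q" "norm q \<le> 2 * norm p"
    using large(1-4) norm_triangle_ineq2[of p q] norm_triangle_ineq2[of q p]
      by (simp_all add: norm_minus_commute)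
  then have "norm x ^ 4 \<le> (2 * norm y) ^ 4" "norm y ^ 4 \<le> (2 * norm x) ^ 4"
    using x4 large by (simp_all add: power_mult_distrib)
  then have xy: "norm x \<le> 2 * norm y" "norm y \<le> 2 * norm x"
    by (auto intro: power_le_imp_le_base[of _ 3, simplified])
  have \<delta>: "norm \<delta> * (norm x * norm y) \<le> K"
    unfolding \<delta>_def x_def y_def K_def using z(1) large
      by (intro phase_difference_bound[OF p_def q_def]) auto
  have xy1: "1 \<le> norm x * norm y" using mult_mono[OF x1] by simp
  have \<delta>K: "norm \<delta> \<le> K" using \<delta> mult_left_mono[OF xy1 norm_ge_zero[of \<delta>]] by simp
  have e: "norm (exp \<delta>) \<le> exp K" "norm (exp (- \<delta>)) \<le> exp K"
    using norm_exp[of \<delta>] norm_exp[of "- \<delta>"] \<delta>K by (auto intro: order_trans simp del: norm_exp_eq_Re)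
  have d: "norm (exp (- \<delta>) - exp \<delta>) * (norm x * norm y) \<le> 2 * exp K * K"
  proof -
    have "norm (exp (- \<delta>) - exp \<delta>) * (norm x * norm y) \<le> 2 * exp (norm \<delta>) * norm \<delta> * (norm x * norm y)"
      using norm_exp_diff_le[of \<delta>] by (intro mult_right_mono) (simp_all add: norm_minus_commute)
    also have "\<dots> = 2 * exp (norm \<delta>) * (norm \<delta> * (norm x * norm y))" by simp
    also have "\<dots> \<le> 2 * exp K * K" using \<delta> \<delta>K K0 by (intro mult_mono) auto
    finally show ?thesis .
  qed
  have \<eta>: "norm \<eta> * (norm x * norm y) \<le> 2"
  proof (cases "sector p = sector q")
    case False
    have mis: "Re w < 0" "norm w \<le> 3 * \<bar>Im w\<bar>" if "w \<in> {p, q}" for w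
      using sector_mismatch[of p q "\<bar>s - t\<bar>" w] False that large by (auto simp: p_def q_def)
    have "norm (sector p - sector q) \<le> 2"
      using norm_triangle_ineq4[of "sector p" "sector q"] norm_sector_le[of p] norm_sector_le[of q]
        by linarith
    moreover have "norm (exp (phase s p)) * norm x \<le> 1" "norm (exp (phase t q)) * norm y \<le> 1"
      unfolding x_def y_def using mis large by (auto intro!: exp_phase_decay simp del: norm_exp_eq_Re)
    ultimately have "norm (sector p - sector q) * ((norm (exp (phase s p)) * norm x)
      * (norm (exp (phase t q)) * norm y)) \<le> 2 * (1 * 1)"
      by (intro mult_mono) auto
    then show ?thesis by (simp add: \<eta>_def norm_mult ac_simps)
  qed (simp add: \<eta>_def)
  have ix: "norm (inverse x * inverse y) \<le> norm (x * y)" "norm (inverse x * y) \<le> 2" "norm (x * inverse y)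
    \<le> 2"
  proof -
    have "norm (inverse x) * norm (inverse y) \<le> 1 * 1"
      using x1 by (intro mult_mono) (simp_all add: norm_inverse inverse_le_1_iff)
    then show "norm (inverse x * inverse y) \<le> norm (x * y)" using xy1 by (simp add: norm_mult)
    have "norm (inverse x * y) = norm y / norm x" "norm (x * inverse y) = norm x / norm y"
      by (simp_all add: norm_mult norm_inverse divide_inverse mult.commute)
    then show "norm (inverse x * y) \<le> 2" "norm (x * inverse y) \<le> 2"
      using x1 xy by (simp_all add: divide_le_eq)
  qed
  have \<eta>c: "norm (\<eta> * half_cis\<^sup>2) * norm (x * y) \<le> 1"
    using \<eta> by (simp add: norm_mult norm_half_cis_square)
  have "norm (\<eta> * half_cis\<^sup>2) * 1 \<le> norm (\<eta> * half_cis\<^sup>2) * norm (x * y)"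
    using xy1 by (intro mult_left_mono) (simp_all add: norm_mult)
  then have \<eta>c1: "norm (\<eta> * half_cis\<^sup>2) \<le> 1" using \<eta>c by simp
  \<comment> \<open>Equal rows. The weight x y also covers the first rows, where the inverse quarter
    powers are at most as large.\<close>
  have big: "norm (w * ((exp (- \<delta>) - exp \<delta>) / 2 * e + \<eta> * half_cis\<^sup>2)) \<le> exp K * K + 1"
    if w: "norm w \<le> norm (x * y)" and e: "norm e = 1" for w e
  proof -
    have "norm (w * ((exp (- \<delta>) - exp \<delta>) / 2 * e + \<eta> * half_cis\<^sup>2))
      \<le> norm (x * y) * (norm (exp (- \<delta>) - exp \<delta>) / 2 + norm (\<eta> * half_cis\<^sup>2))"
      unfolding norm_mult[of w] using w e norm_triangle_ineq[of "(exp (- \<delta>) - exp \<delta>) / 2 * e"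
        "\<eta> * half_cis\<^sup>2"]
      by (intro mult_mono) (simp_all add: norm_mult norm_divide)
    also have "\<dots> = norm (exp (- \<delta>) - exp \<delta>) * (norm x * norm y) / 2 + norm (\<eta> * half_cis\<^sup>2) * norm (x * y)"
      by (simp add: norm_mult algebra_simps)
    finally show ?thesis using d \<eta>c by linarith
  qed
  \<comment> \<open>Different rows: no cancellation of the exponentials, but also no growing
    weight.\<close>
  have mid: "norm (w * ((exp (- \<delta>) + exp \<delta>) / 2 * e + \<eta> * half_cis\<^sup>2)) \<le> 2 * (exp K + 1)"
    if w: "norm w \<le> 2" and e1: "norm e = 1" for w e
  proof -
    have "norm ((exp (- \<delta>) + exp \<delta>) / 2 * e + \<eta> * half_cis\<^sup>2) \<le> norm (exp (- \<delta>) + exp \<delta>) / 2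
      + norm (\<eta> * half_cis\<^sup>2)"
      by (rule order_trans[OF norm_triangle_ineq]) (simp add: norm_mult norm_divide e1)
    also have "\<dots> \<le> exp K + 1"
      using norm_triangle_ineq[of "exp (- \<delta>)" "exp \<delta>"] e \<eta>c1 by linarith
    finally show ?thesis unfolding norm_mult[of w] using w by (intro mult_mono) auto
  qed
  have K1: "exp K * K + 1 \<le> 2 * (exp K + 1) + exp K * K" "2 * (exp K + 1) \<le> 2 * (exp K + 1) + exp K * K"
    using K0 exp_gt_zero[of K] by simp_all
  have m: "model_mat p $ 1 $ 1 = half_cis' * inverse x" "model_mat p $ 1 $ 2 = half_cis * inverse x"
     "model_mat p $ 2 $ 1 = - half_cis' * x" "model_mat p $ 2 $ 2 = half_cis * x"
     "model_mat q $ 1 $ 1 = half_cis' * inverse y" "model_mat q $ 1 $ 2 = half_cis * inverse y"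
     "model_mat q $ 2 $ 1 = - half_cis' * y" "model_mat q $ 2 $ 2 = half_cis * y"
    unfolding model_mat_nth x_def y_def powr_quarter(1)[OF nz(1)] powr_quarter(1)[OF nz(2)] by simp_all
  have pair: "model_pairing s t p q k n = exp (- \<delta>) * model_mat p $ k $ 1 * model_mat q $ n $ 2
     - exp \<delta> * model_mat p $ k $ 2 * model_mat q $ n $ 1 + \<eta> * model_mat p $ k $ 2 * model_mat q $ n $ 2"
       for k n
    by (simp add: model_pairing_def \<delta>_def \<eta>_def)
  \<comment> \<open>Folding 1 / 2 back into the product of the two constants gives the four entries
    the exact form of the estimates above.\<close>
  have half: "w / 2 = half_cis * half_cis' * w" for w :: complex
    by (simp add: half_cis_mult)
  have "E * (c' * X) * (c * Y) - E' * (c * X) * (c' * Y) + h * (c * X) * (c * Y)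
    = (X * Y) * (c * c' * (E - E') * 1 + h * c\<^sup>2)"
    "E * (c' * X) * (c * Y) - E' * (c * X) * (- c' * Y) + h * (c * X) * (c * Y)
      = (X * Y) * (c * c' * (E + E') * 1 + h * c\<^sup>2)"
    "E * (- c' * X) * (c * Y) - E' * (c * X) * (c' * Y) + h * (c * X) * (c * Y)
      = (X * Y) * (c * c' * (E + E') * - 1 + h * c\<^sup>2)"
    "E * (- c' * X) * (c * Y) - E' * (c * X) * (- c' * Y) + h * (c * X) * (c * Y)
      = (X * Y) * (c * c' * (E - E') * - 1 + h * c\<^sup>2)"
    for E E' c c' X Y h :: complex
    by (simp_all add: algebra_simps power2_eq_square)
  note cases = this[of "exp (- \<delta>)" half_cis' _ half_cis _ "exp \<delta>" \<eta>, folded half]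
  have "norm (model_pairing s t p q 1 1) \<le> 2 * (exp K + 1) + exp K * K"
    unfolding pair m cases(1) by (rule order_trans[OF big K1(1)]) (use ix in simp_all)
  moreover have "norm (model_pairing s t p q 1 2) \<le> 2 * (exp K + 1) + exp K * K"
    unfolding pair m cases(2) by (rule order_trans[OF mid K1(2)]) (use ix in simp_all)
  moreover have "norm (model_pairing s t p q 2 1) \<le> 2 * (exp K + 1) + exp K * K"
    unfolding pair m cases(3) by (rule order_trans[OF mid K1(2)]) (use ix in simp_all)
  moreover have "norm (model_pairing s t p q 2 2) \<le> 2 * (exp K + 1) + exp K * K"
    unfolding pair m cases(4) by (rule order_trans[OF big K1(1)]) (use ix in simp_all)
  ultimately have "norm (model_pairing s t p q k n) \<le> 2 * (exp K + 1) + exp K * K"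
    using exhaust_2[of k] exhaust_2[of n] by auto
  then show "norm (model_pairing s t (z - of_real s) (z - of_real t) k n) \<le> 2 * (exp K + 1) + exp K * K"
    by (simp add: p_def q_def)
qed

subsection \<open>Frames and their pairing\<close>

definition entire_frame :: "(2 \<Rightarrow> complex \<Rightarrow> complex) \<Rightarrow> (2 \<Rightarrow> complex \<Rightarrow> complex) \<Rightarrow> bool" where
  "entire_frame u e \<longleftrightarrow> (\<forall>i. u i holomorphic_on UNIV) \<and> (\<forall>i. e i holomorphic_on UNIV)
     \<and> (\<forall>z. u 1 z * e 2 z - e 1 z * u 2 z = 1)"

text \<open>The value at \<beta> minus the value at \<alpha> of \<open>branch_log\<close>, written
  with one logarithm: the two cuts run to infinity, while this function is holomorphic off the
  segment between \<alpha> and \<beta>.\<close>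

definition log_ratio :: "real \<Rightarrow> real \<Rightarrow> complex \<Rightarrow> complex" where
  "log_ratio \<alpha> \<beta> z = Ln ((z - of_real \<beta>) / (z - of_real \<alpha>)) / (2 * of_real pi * \<i>)"

text \<open>For A = (u, e + b u) and B = (u', e' + b' u') with b, b' the logarithms, the expression
  is an entry of A J B^T, where J has rows (0, 1) and (-1, 0). Since det B = 1 this is A B^(-1) J,
  the quotient without any inverse.\<close>

definition pairing_bounded where
  "pairing_bounded \<alpha> u e \<beta> u' e' \<longleftrightarrow> (\<exists>K N. \<forall>z i l. norm z \<ge> N \<longrightarrow>
     norm (u i z * e' l z - e i z * u' l z + log_ratio \<alpha> \<beta> z * u i z * u' l z :: complex) \<le> K)"
  for u e u' e' :: "2 \<Rightarrow> complex \<Rightarrow> complex"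

text \<open>The frames live in the unshifted variable, so the endpoint is s + a and frames for
  different parameters can be compared at the same z.\<close>

definition represents where
  "represents s a M u e \<longleftrightarrow> entire_frame u e \<and>
     (\<forall>i z. z - of_real s \<notin> contour_right a \<longrightarrow>
        u i z = col1 s M i (z - of_real s) \<and> e i z = col2 s a M i (z - of_real s))"

lemma (in airy_rhp) represents_exists: "\<exists>u e. represents \<kappa> a M u e"
proof -
  obtain u e where *: "\<And>i. u i holomorphic_on UNIV" "\<And>i. e i holomorphic_on UNIV"
    "\<And>i z. z \<in> - \<Sigma> \<Longrightarrow> u i z = col1 \<kappa> M i z" "\<And>i z. z \<in> - \<Sigma> \<Longrightarrow> e i z = col2 \<kappa> a M i z"
    "\<And>z. u 1 z * e 2 z - e 1 z * u 2 z = 1"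
    using entire_cols by metis
  have "(\<lambda>z. f (z - of_real \<kappa>)) holomorphic_on UNIV" if "f holomorphic_on UNIV" for f :: "complex \<Rightarrow> complex"
  proof -
    have "f \<circ> (\<lambda>z. z - of_real \<kappa>) holomorphic_on UNIV"
      by (rule holomorphic_on_compose_gen[OF _ that]) (auto intro!: holomorphic_intros)
    then show ?thesis by (simp add: o_def)
  qed
  then have "represents \<kappa> a M (\<lambda>i z. u i (z - of_real \<kappa>)) (\<lambda>i z. e i (z - of_real \<kappa>))"
    using * unfolding represents_def entire_frame_def by auto
  then show ?thesis by blast
qed

text \<open>The growing factor \<open>model_mat\<close> is kept separate because its growth is
  compensated only in the pairing with another solution.\<close>

lemma (in airy_rhp) factor_bounded:
  "\<exists>(G :: complex \<Rightarrow> 2 \<Rightarrow> 2 \<Rightarrow> complex) B N. B > 0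
     \<and> (\<forall>z i j. z \<notin> \<Sigma> \<longrightarrow> M z $ i $ j = G z i 1 * model_mat z $ 1 $ j + G z i 2 * model_mat z $ 2 $ j)
     \<and> (\<forall>z i k. z \<notin> \<Sigma> \<longrightarrow> norm z \<ge> N \<longrightarrow> norm (G z i k) \<le> B)"
proof -
  obtain E K N where E: "N > 0" "K > 0"
    "\<And>z. z \<in> - \<Sigma> \<Longrightarrow> M z = (mat 1 + E z) ** model_mat z"
    "\<And>z i j. z \<in> - \<Sigma> \<Longrightarrow> norm z \<ge> N \<Longrightarrow> norm (E z $ i $ j) \<le> K / norm z"
    using normalized_explicit by metis
  have "norm ((mat 1 + E z) $ i $ k) \<le> 1 + K" if z: "z \<notin> \<Sigma>" "norm z \<ge> max N 1" for z and i k :: 2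
  proof -
    have "norm (E z $ i $ k) \<le> K / norm z" using E(4) z by simp
    also have "\<dots> \<le> K" using z E(2) by (simp add: divide_le_eq mult_le_cancel_left1)
    finally have "norm (E z $ i $ k) \<le> K" .
    moreover have "norm ((mat 1 :: cmat2) $ i $ k) \<le> 1" by (simp add: mat_def)
    ultimately show ?thesis
      using norm_triangle_ineq[of "(mat 1 :: cmat2) $ i $ k" "E z $ i $ k"] by simp
  qed
  moreover have "M z $ i $ j = (mat 1 + E z) $ i $ 1 * model_mat z $ 1 $ j + (mat 1 + E z) $ i $ 2
    * model_mat z $ 2 $ j"
    if "z \<notin> \<Sigma>" for z i j
    using E(3)[of z] that by (simp add: matrix_mult_2_nth)
  ultimately show ?thesis
    using E(2) by (intro exI[of _ "\<lambda>z i k. (mat 1 + E z) $ i $ k"] exI[of _ "1 + K"] exI[of _ "max N 1"])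
      simp
qed

lemma entire_isCont: "f holomorphic_on UNIV \<Longrightarrow> isCont f z" for z :: complex
  using holomorphic_on_imp_continuous_on[of f UNIV] by (simp add: continuous_on_eq_continuous_at)

text \<open>Both points lie in the same open half-plane, so their arguments differ by less than pi
  and the difference is the principal logarithm of the quotient.\<close>

lemma Ln_ratio:
  assumes "Im z \<noteq> 0"
  shows "Ln ((z - of_real \<beta>) / (z - of_real \<alpha>)) = Ln (z - of_real \<beta>) - Ln (z - of_real \<alpha>)"
proof (rule Ln_unique)
  define p q where "p = z - of_real \<beta>" and "q = z - of_real \<alpha>"
  have nz: "p \<noteq> 0" "q \<noteq> 0" using assms by (auto simp: p_def q_def complex_eq_iff)
  show "exp (Ln (z - of_real \<beta>) - Ln (z - of_real \<alpha>)) = (z - of_real \<beta>) / (z - of_real \<alpha>)"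
    using nz by (simp add: exp_diff p_def q_def)
  have "\<bar>Im (Ln p) - Im (Ln q)\<bar> < pi"
  proof (cases "Im z > 0")
    case True
    then have "0 < Im (Ln p)" "Im (Ln p) < pi" "0 < Im (Ln q)" "Im (Ln q) < pi"
      using Im_Ln_pos_lt_imp[of p] Im_Ln_pos_lt_imp[of q] by (auto simp: p_def q_def)
    then show ?thesis by simp
  next
    case False
    then have "Im p < 0" "Im q < 0" using assms by (auto simp: p_def q_def)
    then have "Im (Ln p) < 0" "Im (Ln q) < 0" "- pi < Im (Ln p)" "- pi < Im (Ln q)"
      using nz Im_Ln_pos_le[of p] Im_Ln_pos_le[of q] mpi_less_Im_Ln[of p] mpi_less_Im_Ln[of q] Im_Ln_le_pi
      by (auto simp: not_le[symmetric])
    then show ?thesis by simp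
  qed
  then show "- pi < Im (Ln (z - of_real \<beta>) - Ln (z - of_real \<alpha>))"
    "Im (Ln (z - of_real \<beta>) - Ln (z - of_real \<alpha>)) \<le> pi"
    by (auto simp: p_def q_def)
qed

text \<open>The quotient differs from 1 by less than 1 in modulus, hence has positive real
  part.\<close>

lemma log_ratio_holomorphic_at:
  fixes z :: complex
  assumes "norm (z - of_real \<alpha>) > \<bar>\<alpha> - \<beta>\<bar>"
  shows "(z - of_real \<beta>) / (z - of_real \<alpha>) \<notin> \<real>\<^sub>\<le>\<^sub>0" "z \<noteq> of_real \<alpha>"
proof -
  show nz: "z \<noteq> of_real \<alpha>" using assms by auto
  have "(z - of_real \<beta>) / (z - of_real \<alpha>) = 1 + of_real (\<alpha> - \<beta>) / (z - of_real \<alpha>)"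
    using nz by (simp add: field_simps)
  moreover have "norm (of_real (\<alpha> - \<beta>) / (z - of_real \<alpha>)) < 1"
    using assms nz by (simp add: norm_divide del: of_real_diff)
  ultimately show "(z - of_real \<beta>) / (z - of_real \<alpha>) \<notin> \<real>\<^sub>\<le>\<^sub>0"
    using abs_Re_le_cmod[of "of_real (\<alpha> - \<beta>) / (z - of_real \<alpha>)"]
    by (auto simp: complex_nonpos_Reals_iff simp del: of_real_diff)
qed

text \<open>The logarithms are left out here; they recombine to \<open>log_ratio\<close> in the next
  lemma. Expanding both solutions in their model matrices gives four terms, each a bounded
  coefficient times a \<open>model_pairing\<close>.\<close>

lemma pairing_of_solutions_bounded:
  assumes A: "airy_rhp s a M" and B: "airy_rhp t b M'"
  obtains K N where "\<And>z i l. Im z \<noteq> 0 \<Longrightarrow> norm z \<ge> N \<Longrightarrow> z - of_real s \<notin> contour_right a \<Longrightarrow>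
    z - of_real t \<notin> contour_right b
     \<Longrightarrow> norm (col1 s M i (z - of_real s) * (exp (phase t (z - of_real t)) * M' (z - of_real t) $ l $ 2)
       - exp (phase s (z - of_real s)) * M (z - of_real s) $ i $ 2 * col1 t M' l (z - of_real t)) \<le> K"
proof -
  obtain X N0 where X: "\<And>z k n. Im z \<noteq> 0 \<Longrightarrow> norm z \<ge> N0 \<Longrightarrow>
    norm (model_pairing s t (z - of_real s) (z - of_real t) k n) \<le> X"
    using model_pairing_bounded[of s t] by metis
  obtain G :: "complex \<Rightarrow> 2 \<Rightarrow> 2 \<Rightarrow> complex" and C N1 where G: "C > 0"
    "\<And>z i j. z \<notin> contour_right a \<Longrightarrow> M z $ i $ j = G z i 1 * model_mat z $ 1 $ j + G z i 2 * model_mat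
      z $ 2 $ j"
    "\<And>z i k. z \<notin> contour_right a \<Longrightarrow> norm z \<ge> N1 \<Longrightarrow> norm (G z i k) \<le> C"
    using airy_rhp.factor_bounded[OF A] by blast
  obtain H :: "complex \<Rightarrow> 2 \<Rightarrow> 2 \<Rightarrow> complex" and D N2 where H: "D > 0"
    "\<And>z i j. z \<notin> contour_right b \<Longrightarrow> M' z $ i $ j = H z i 1 * model_mat z $ 1 $ j + H z i 2 * model_mat
      z $ 2 $ j"
    "\<And>z i k. z \<notin> contour_right b \<Longrightarrow> norm z \<ge> N2 \<Longrightarrow> norm (H z i k) \<le> D"
    using airy_rhp.factor_bounded[OF B] by blast
  show thesis
  proof (rule that)
    fix z and i l :: 2
    assume z: "Im z \<noteq> 0" "norm z \<ge> max N0 (max (N1 + \<bar>s\<bar>) (N2 + \<bar>t\<bar>))"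
      and off: "z - of_real s \<notin> contour_right a" "z - of_real t \<notin> contour_right b"
    define p q where "p = z - of_real s" and "q = z - of_real t"
    note off = off[folded p_def q_def]
    have "norm z \<le> norm p + \<bar>s\<bar>" "norm z \<le> norm q + \<bar>t\<bar>"
      using norm_triangle_ineq[of p "of_real s"] norm_triangle_ineq[of q "of_real t"]
        by (simp_all add: p_def q_def)
    then have "norm p \<ge> N1" "norm q \<ge> N2" using z by auto
    then have GH: "norm (G p i k) \<le> C" "norm (H q l k) \<le> D" for k using G(3) H(3) off by auto
    have tm: "norm (G p i k * H q l n * model_pairing s t p q k n) \<le> C * D * X" for k n
      unfolding norm_mult using GH X[OF z(1), of k n] z(2) G(1) H(1)
      by (intro mult_mono) (auto simp: p_def q_def)
    define e e' f f' where "e = exp (phase s p)" and "e' = exp (- phase s p)" and "f = exp (phase t q)" and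
      "f' = exp (- phase t q)"
    have pairing: "model_pairing s t p q k n = e' * f * model_mat p $ k $ 1 * model_mat q $ n $ 2
     - e * f' * model_mat p $ k $ 2 * model_mat q $ n $ 1
     + (sector p - sector q) * e * f * model_mat p $ k $ 2 * model_mat q $ n $ 2" for k n
      by (simp add: model_pairing_def e_def e'_def f_def f'_def exp_diff exp_minus divide_inverse
        mult.commute)
    have "col1 s M i p * (exp (phase t q) * M' q $ l $ 2) - exp (phase s p) * M p $ i $ 2 * col1 t M' l q
      = e' * f * M p $ i $ 1 * M' q $ l $ 2 - e * f' * M p $ i $ 2 * M' q $ l $ 1 + (sector p - sector q)
        * e * f * M p $ i $ 2 * M' q $ l $ 2"
      unfolding col1_def e_def[symmetric] e'_def[symmetric] f_def[symmetric] f'_def[symmetric]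
      by (simp add: algebra_simps)
    also have "\<dots> = G p i 1 * H q l 1 * model_pairing s t p q 1 1 + G p i 1 * H q l 2 * model_pairing s t p q
      1 2
      + (G p i 2 * H q l 1 * model_pairing s t p q 2 1 + G p i 2 * H q l 2 * model_pairing s t p q 2 2)"
      unfolding pairing G(2)[OF off(1)] H(2)[OF off(2)] by (simp add: algebra_simps)
    finally have eq: "col1 s M i p * (exp (phase t q) * M' q $ l $ 2) - exp (phase s p) * M p $ i $ 2 * col1
      t M' l q = \<dots>" .
    show "norm (col1 s M i (z - of_real s) * (exp (phase t (z - of_real t)) * M' (z - of_real t) $ l $ 2)
       - exp (phase s (z - of_real s)) * M (z - of_real s) $ i $ 2 * col1 t M' l (z - of_real t))
      \<le> (C * D * X + C * D * X) + (C * D * X + C * D * X)"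
      unfolding p_def[symmetric] q_def[symmetric] eq
      by (intro norm_triangle_le add_mono tm)
  qed
qed

lemma represents_pairing_bounded:
  assumes A: "airy_rhp s a M" and B: "airy_rhp t b M'"
    and u: "represents s a M u e" and u': "represents t b M' u' e'"
  shows "pairing_bounded (s + a) u e (t + b) u' e'"
proof -
  obtain K N where KN: "\<And>z i l. Im z \<noteq> 0 \<Longrightarrow> norm z \<ge> N \<Longrightarrow> z - of_real s \<notin> contour_right a \<Longrightarrow>
    z - of_real t \<notin> contour_right b
     \<Longrightarrow> norm (col1 s M i (z - of_real s) * (exp (phase t (z - of_real t)) * M' (z - of_real t) $ l $ 2)
       - exp (phase s (z - of_real s)) * M (z - of_real s) $ i $ 2 * col1 t M' l (z - of_real t)) \<le> K"
    using pairing_of_solutions_bounded[OF A B] by metis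
  define R where "R i l z = u i z * e' l z - e i z * u' l z + log_ratio (s + a) (t + b) z * u i z * u' l z"
    for i l z
  \<comment> \<open>The real axis and both shifted contours: off this null set the columns are
    explicit and the two logarithms combine.\<close>
  define Y where "Y = {z. \<i> \<bullet> z = 0} \<union> (\<lambda>w. of_real s + w) ` contour_right a \<union> (\<lambda>w. of_real t + w) `
    contour_right b"
  have "negligible Y" unfolding Y_def
    using A B by (intro negligible_Un negligible_hyperplane negligible_translation negligible_contour_right)
      (auto simp: airy_rhp_def)
  then have lim: "z islimpt - Y" for z by (rule islimpt_compl_negligible)
  have Y: "Im z \<noteq> 0 \<and> z - of_real s \<notin> contour_right a \<and> z - of_real t \<notin> contour_right b" if "z \<in> - Y" for z
    using that unfolding Y_def by (auto simp: image_iff inner_complex_def algebra_simps)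
  have R_le: "norm (R i l z) \<le> K" if "z \<in> - Y" "norm z \<ge> N" for i l z
  proof -
    note Yz = Y[OF that(1)]
    have lr: "log_ratio (s + a) (t + b) z = branch_log b (z - of_real t) - branch_log a (z - of_real s)"
      unfolding log_ratio_def Ln_ratio[OF conjunct1[OF Yz]] branch_log_def
        by (simp add: diff_divide_distrib algebra_simps)
    have "R i l z = col1 s M i (z - of_real s) * (exp (phase t (z - of_real t)) * M' (z
      - of_real t) $ l $ 2)
       - exp (phase s (z - of_real s)) * M (z - of_real s) $ i $ 2 * col1 t M' l (z - of_real t)"
    proof -
      have cols: "u i z = col1 s M i (z - of_real s)" "e i z = col2 s a M i (z - of_real s)"
        "u' l z = col1 t M' l (z - of_real t)" "e' l z = col2 t b M' l (z - of_real t)"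
        using u u' Yz unfolding represents_def by simp_all
      show ?thesis unfolding R_def lr cols col2_def by (simp add: algebra_simps)
    qed
    then show ?thesis using KN[of z i l] Yz that(2) by simp
  qed
  \<comment> \<open>For such z the function \<open>log_ratio\<close> is holomorphic at z, so R is
    continuous there and the bound extends to the points of \<open>Y\<close>.\<close>
  have "norm (R i l z) \<le> K" if z: "norm z \<ge> \<bar>N\<bar> + 1 + \<bar>s + a\<bar> + \<bar>s + a - (t + b)\<bar>" for i l z
  proof (rule tendsto_upperbound[where F = "at z within - Y" and f = "\<lambda>z. norm (R i l z)"])
    have "norm z \<le> norm (z - of_real (s + a)) + \<bar>s + a\<bar>"
      using norm_triangle_ineq[of "z - of_real (s + a)" "of_real (s + a)"] by (simp del: of_real_add)
    then have "norm (z - of_real (s + a)) > \<bar>s + a - (t + b)\<bar>" using z by linarith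
    note lr = log_ratio_holomorphic_at[OF this]
    have c: "isCont (u i) z" "isCont (e i) z" "isCont (u' l) z" "isCont (e' l) z"
      using u u' unfolding represents_def entire_frame_def by (blast intro: entire_isCont)+
    have "isCont (R i l) z"
      unfolding R_def log_ratio_def using lr by (intro continuous_intros c) auto
    then show "((\<lambda>z. norm (R i l z)) \<longlongrightarrow> norm (R i l z)) (at z within - Y)"
      by (intro tendsto_intros isCont_tendsto_within)
    have "\<forall>\<^sub>F w in at z within - Y. w \<in> {w. norm w > N}"
      by (rule eventually_at_open) (use z in \<open>auto intro!: open_Collect_less continuous_intros\<close>)
    with eventually_at_in show "\<forall>\<^sub>F w in at z within - Y. norm (R i l w) \<le> K"
      by eventually_elim (use R_le in \<open>force intro: less_imp_le\<close>)
    show "at z within - Y \<noteq> bot" using lim by (simp add: trivial_limit_within)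
  qed
  then show ?thesis unfolding pairing_bounded_def R_def by blast
qed

subsection \<open>Closeness of frames\<close>

lemma contour_integral_circlepaths_annulus:
  assumes hol: "f holomorphic_on {w. norm (w - c) > r}" and r: "0 \<le> r" "r < \<rho>" "\<rho> \<le> N"
  shows "contour_integral (circlepath c \<rho>) f = contour_integral (circlepath c N) f"
proof (rule Cauchy_theorem_homotopic_loops[OF _ _ hol])
  show "open {w. norm (w - c) > r}" by (intro open_Collect_less continuous_intros)
  show "homotopic_loops {w. norm (w - c) > r} (circlepath c \<rho>) (circlepath c N)"
  proof (rule homotopic_loops_linear)
    fix t :: real assume "t \<in> {0..1}"
    show "closed_segment (circlepath c \<rho> t) (circlepath c N t) \<subseteq> {w. norm (w - c) > r}"
    proof
      fix w assume "w \<in> closed_segment (circlepath c \<rho> t) (circlepath c N t)"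
      then obtain s where s: "0 \<le> s" "s \<le> 1"
        "w = (1 - s) *\<^sub>R circlepath c \<rho> t + s *\<^sub>R circlepath c N t" by (auto simp: in_segment)
      then have "w - c = of_real ((1 - s) * \<rho> + s * N) * exp (2 * of_real pi * \<i> * of_real t)"
        by (simp add: circlepath scaleR_conv_of_real algebra_simps)
      then have "norm (w - c) = \<bar>(1 - s) * \<rho> + s * N\<bar>"
        by (simp add: norm_mult del: of_real_add of_real_mult)
      moreover have "(1 - s) * \<rho> + s * N \<ge> \<rho>"
        using mult_left_mono[OF r(3) s(1)] by (simp add: algebra_simps)
      ultimately show "w \<in> {w. norm (w - c) > r}" using r by auto
    qed
  qed auto
qed auto

text \<open>By Cauchy's formula in the exterior, F(z) - l is, up to sign, the mean of F(w) / (w - z)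
  over the circle of radius \<rho>, taken with dw / (2 pi i). There Q contributes nothing since z
  lies outside, and |w - z| >= \<rho> gives the bound \<open>B\<close>.\<close>

lemma exterior_part_bound:
  assumes Q: "Q holomorphic_on UNIV" and T: "T holomorphic_on {w. norm (w - c) > r}"
    and r: "0 \<le> r" "r < \<rho>" and lim: "((\<lambda>w. Q w + T w) \<longlongrightarrow> l) at_infinity"
    and B: "\<And>w. norm (w - c) = \<rho> \<Longrightarrow> norm (T w) \<le> B" and z: "norm (z - c) = 2 * \<rho>"
  shows "norm (Q z + T z - l) \<le> B"
proof -
  define F where "F w = Q w + T w" for w
  define S where "S = {w. norm (w - c) > r}"
  have S: "open S" unfolding S_def by (intro open_Collect_less continuous_intros)
  have F: "F holomorphic_on S"
    unfolding F_def[abs_def] S_def by (intro holomorphic_intros T holomorphic_on_subset[OF Q]) auto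
  \<comment> \<open>The removed singularity at z lets the circle grow from radius \<rho> past z to
    infinity.\<close>
  define k where "k w = (if w = z then deriv F z else (F w - F z) / (w - z))" for w
  have k: "k holomorphic_on S"
    unfolding k_def[abs_def] by (rule pole_lemma_open[OF F S])
  have \<rho>: "\<rho> > 0" using r by simp
  have B0: "0 \<le> B" using B[of "c + of_real \<rho>"] \<rho> by (simp add: order_trans[OF norm_ge_zero])
  have inner: "contour_integral (circlepath c \<rho>) k = contour_integral (circlepath c \<rho>) (\<lambda>w. T w / (w - z))"
  proof -
    have z_off: "w \<noteq> z" if "norm (w - c) = \<rho>" for w using that z \<rho> by auto
    have TT: "(\<lambda>w. T w / (w - z)) contour_integrable_on circlepath c \<rho>"
      using r \<rho> z_off
      by (intro contour_integrable_continuous_circlepath continuous_intros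
          holomorphic_on_imp_continuous_on holomorphic_on_subset[OF T]) (auto simp: dist_norm
            norm_minus_commute)
    have Q0: "((\<lambda>w. (Q w - F z) / (w - z)) has_contour_integral 0) (circlepath c \<rho>)"
      by (rule Cauchy_theorem_disc_simple[of _ c "2 * \<rho>"])
         (use z \<rho> in \<open>auto intro!: holomorphic_intros holomorphic_on_subset[OF Q] simp: dist_norm
           norm_minus_commute\<close>)
    have "((\<lambda>w. (Q w - F z) / (w - z) + T w / (w - z)) has_contour_integral
      (0 + contour_integral (circlepath c \<rho>) (\<lambda>w. T w / (w - z)))) (circlepath c \<rho>)"
      by (intro has_contour_integral_add Q0 has_contour_integral_integral TT)
    then have "(k has_contour_integral (0 + contour_integral (circlepath c \<rho>) (\<lambda>w. T w / (w - z))))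
      (circlepath c \<rho>)"
    proof (rule has_contour_integral_eq)
      fix w assume "w \<in> path_image (circlepath c \<rho>)"
      then have "w \<noteq> z" using \<rho> z_off by (auto simp: dist_norm norm_minus_commute)
      then show "(Q w - F z) / (w - z) + T w / (w - z) = k w"
        by (simp add: k_def F_def diff_divide_distrib add_divide_distrib)
    qed
    then show ?thesis using TT has_contour_integral_integral by (simp add: contour_integral_unique)
  qed
  have inner_bound: "norm (contour_integral (circlepath c \<rho>) k) \<le> B / \<rho> * (2 * pi * \<rho>)"
  proof (rule has_contour_integral_bound_circlepath[of "\<lambda>w. T w / (w - z)"])
    show "((\<lambda>w. T w / (w - z)) has_contour_integral contour_integral (circlepath c \<rho>) k) (circlepath c \<rho>)"
      unfolding inner using r \<rho> z
      by (intro has_contour_integral_integral contour_integrable_continuous_circlepath continuous_intros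
          holomorphic_on_imp_continuous_on holomorphic_on_subset[OF T]) (auto simp: dist_norm
            norm_minus_commute)
    fix w assume w: "norm (w - c) = \<rho>"
    have "\<rho> \<le> norm (w - z)"
      using norm_triangle_ineq2[of "z - c" "w - c"] w z by (simp add: norm_minus_commute)
    then show "norm (T w / (w - z)) \<le> B / \<rho>"
      using B[OF w] B0 \<rho> by (simp add: norm_divide frac_le)
  qed (use B0 \<rho> in auto)
  have "norm (F z - l) \<le> B + 2 * \<epsilon>" if \<epsilon>: "\<epsilon> > 0" for \<epsilon>
  proof -
    have "\<forall>\<^sub>F w in at_infinity. norm (F w - l) < \<epsilon>"
      using tendstoD[OF lim \<epsilon>] by (simp add: F_def dist_norm)
    then obtain b where b: "\<And>w. norm w \<ge> b \<Longrightarrow> norm (F w - l) < \<epsilon>"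
      unfolding eventually_at_infinity by blast
    \<comment> \<open>The part 4 \<rho> gives |w - z| >= N / 2 on the large circle; the other part
      makes F there close to l.\<close>
    define N where "N = max (4 * \<rho>) (b + norm c)"
    have N: "N \<ge> 4 * \<rho>" "N \<ge> b + norm c" "N > 0" using \<rho> by (auto simp: N_def)
    have kN: "(k has_contour_integral contour_integral (circlepath c \<rho>) k) (circlepath c N)"
    proof -
      have "k contour_integrable_on circlepath c N"
        using r \<rho> N
        by (intro contour_integrable_continuous_circlepath holomorphic_on_imp_continuous_on
          holomorphic_on_subset[OF k])
           (auto simp: S_def dist_norm norm_minus_commute)
      then have "(k has_contour_integral contour_integral (circlepath c N) k) (circlepath c N)"
        by (rule has_contour_integral_integral)
      moreover have "contour_integral (circlepath c \<rho>) k = contour_integral (circlepath c N) k"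
        by (rule contour_integral_circlepaths_annulus[OF k[unfolded S_def] r]) (use N \<rho> in simp)
      ultimately show ?thesis by simp
    qed
    have "((\<lambda>w. (l - F z) / (w - z)) has_contour_integral 2 * of_real pi * \<i> * (l - F z)) (circlepath c N)"
      using z N \<rho> by (intro Cauchy_integral_circlepath_simple) (auto simp: dist_norm norm_minus_commute)
    from has_contour_integral_diff[OF kN this]
    have "((\<lambda>w. (F w - l) / (w - z)) has_contour_integral
       contour_integral (circlepath c \<rho>) k - 2 * of_real pi * \<i> * (l - F z)) (circlepath c N)"
    proof (rule has_contour_integral_eq)
      fix w assume "w \<in> path_image (circlepath c N)"
      then have "w \<noteq> z" using \<rho> N z by (auto simp: dist_norm norm_minus_commute)
      then show "k w - (l - F z) / (w - z) = (F w - l) / (w - z)"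
        by (simp add: k_def diff_divide_distrib)
    qed
    then have "norm (contour_integral (circlepath c \<rho>) k - 2 * of_real pi * \<i> * (l - F z))
      \<le> \<epsilon> / (N / 2) * (2 * pi * N)"
    proof (rule has_contour_integral_bound_circlepath)
      fix w assume w: "norm (w - c) = N"
      have "N \<le> norm w + norm c" using norm_triangle_ineq4[of w c] w by simp
      then have "norm (F w - l) \<le> \<epsilon>" using b[of w] N by simp
      moreover have "N / 2 \<le> norm (w - z)"
        using norm_triangle_ineq2[of "w - c" "z - c"] w z N by simp
      ultimately show "norm ((F w - l) / (w - z)) \<le> \<epsilon> / (N / 2)"
        unfolding norm_divide using \<epsilon> N by (intro frac_le) auto
    qed (use \<epsilon> N in auto)
    then have "norm (2 * of_real pi * \<i> * (l - F z)) \<le> B / \<rho> * (2 * pi * \<rho>) + \<epsilon> / (N / 2) * (2 * pi * N)"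
      using inner_bound norm_triangle_ineq4[of "contour_integral (circlepath c \<rho>) k"
        "contour_integral (circlepath c \<rho>) k - 2 * of_real pi * \<i> * (l - F z)"]
      by simp
    also have "\<dots> = 2 * pi * (B + 2 * \<epsilon>)" using \<rho> N by (simp add: field_simps)
    finally have "2 * pi * norm (l - F z) \<le> 2 * pi * (B + 2 * \<epsilon>)" by (simp add: norm_mult)
    then show ?thesis by (simp add: norm_minus_commute)
  qed
  note eps = this
  have "norm (F z - l) \<le> B"
  proof (rule field_le_epsilon)
    fix e :: real assume "e > 0"
    then show "norm (F z - l) \<le> B + e" using eps[of "e / 2"] by simp
  qed
  then show ?thesis by (simp add: F_def)
qed

text \<open>Inversion moves infinity to 0, where a bounded holomorphic function has a removable
  singularity.\<close>

lemma bounded_exterior_has_limit: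
  fixes f :: "complex \<Rightarrow> complex"
  assumes "f holomorphic_on {w. norm w > r}" "\<And>w. norm w > r \<Longrightarrow> norm (f w) \<le> K"
  obtains l where "(f \<longlongrightarrow> l) at_infinity"
proof -
  define R where "R = \<bar>r\<bar> + 1"
  have R: "R > 0" "R > r" by (auto simp: R_def)
  have inv: "norm (inverse w) > r" if "w \<in> ball 0 (inverse R) - {0}" for w :: complex
  proof -
    have "R < inverse (norm w)" using that R(1)
      by (simp add: field_simps)
    then show ?thesis using R(2) by (simp add: norm_inverse)
  qed
  have hol: "f \<circ> inverse holomorphic_on ball 0 (inverse R) - {0}"
    by (rule holomorphic_on_compose_gen[OF _ assms(1)]) (use inv in \<open>auto intro!: holomorphic_intros\<close>)
  have "\<forall>\<^sub>F w in at 0. w \<in> ball (0 :: complex) (inverse R) - {0}"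
    unfolding eventually_at using R(1) by (intro exI[of _ "inverse R"]) (auto simp: dist_commute)
  then have "\<forall>\<^sub>F w in at 0. norm ((f \<circ> inverse) w) \<le> K"
    by eventually_elim (use inv assms(2) in auto)
  then obtain g where g: "g holomorphic_on ball 0 (inverse R)" "\<forall>w\<in>ball 0 (inverse R) - {0}. g w
    = (f \<circ> inverse) w"
    using holomorphic_on_extend_bounded[OF hol] R(1) by auto
  have "isCont g 0" using holomorphic_on_imp_continuous_on[OF g(1)] R(1)
    by (simp add: continuous_on_eq_continuous_at)
  then have "(g \<longlongrightarrow> g 0) (at 0)" by (simp add: isCont_def)
  then have "((f \<circ> inverse) \<longlongrightarrow> g 0) (at 0)"
    by (rule Lim_transform_within_open[of g _ _ _ "ball 0 (inverse R)"]) (use g(2) R(1) in auto)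
  then show ?thesis using that lim_at_infinity_0 by blast
qed

text \<open>The limit \<open>C\<close> of the ratio of two frames at infinity has determinant one and is removed by
  passing to \<open>v = C\<inverse> u\<close>.\<close>

lemma frame_normalization:
  assumes F: "entire_frame u e" and F': "entire_frame u' e'" and P: "pairing_bounded \<alpha> u e \<beta> u' e'"
  obtains v h where "entire_frame v h" "\<And>x y. v 1 x * v 2 y - v 2 x * v 1 y = u 1 x * u 2 y - u 2 x * u 1 y"
    "\<And>i l. ((\<lambda>z. v i z * e' l z - h i z * u' l z + log_ratio \<alpha> \<beta> z * v i z * u' l z) \<longlongrightarrow>
        (if i = 1 \<and> l = 2 then 1 else if i = 2 \<and> l = 1 then - 1 else 0)) at_infinity"
proof -
  have hol: "u i holomorphic_on UNIV" "e i holomorphic_on UNIV" "u' i holomorphic_on UNIV"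
    "e' i holomorphic_on UNIV" for i
    using F F' unfolding entire_frame_def by blast+
  have det: "u 1 z * e 2 z - e 1 z * u 2 z = 1" "u' 1 z * e' 2 z - e' 1 z * u' 2 z = 1" for z
    using F F' unfolding entire_frame_def by blast+
  define W where "W i l z = u i z * e' l z - e i z * u' l z + log_ratio \<alpha> \<beta> z * u i z * u' l z" for i l z
  obtain K N where KN: "\<And>z i l. norm z \<ge> N \<Longrightarrow> norm (W i l z) \<le> K"
    using P unfolding pairing_bounded_def W_def by blast
  define r where "r = \<bar>N\<bar> + \<bar>\<alpha>\<bar> + \<bar>\<alpha> - \<beta>\<bar>"
  have large: "norm (z - of_real \<alpha>) > \<bar>\<alpha> - \<beta>\<bar>" if "norm z > r" for z :: complex
    using norm_triangle_ineq2[of z "of_real \<alpha>"] that unfolding r_def by simp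
  have "W i l holomorphic_on {z. norm z > r}" for i l
    unfolding W_def[abs_def] log_ratio_def using log_ratio_holomorphic_at[OF large]
    by (intro holomorphic_intros holomorphic_on_subset[OF hol(1)] holomorphic_on_subset[OF hol(2)]
       holomorphic_on_subset[OF hol(3)] holomorphic_on_subset[OF hol(4)]) auto
  moreover have "norm (W i l z) \<le> K" if "norm z > r" for i l z
    using KN that unfolding r_def by simp
  ultimately have "\<exists>c. (W i l \<longlongrightarrow> c) at_infinity" for i l
    using bounded_exterior_has_limit by metis
  then obtain c where c: "\<And>i l. (W i l \<longlongrightarrow> c i l) at_infinity" by metis
  \<comment> \<open>A product of matrices of determinant one; the logarithmic terms cancel
    identically, so the limit \<open>c\<close> has determinant one as well.\<close>
  have "W 1 1 z * W 2 2 z - W 1 2 z * W 2 1 z = 1" for z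
    using det[of z] unfolding W_def by algebra
  then have "((\<lambda>z. 1) \<longlongrightarrow> c 1 1 * c 2 2 - c 1 2 * c 2 1) (at_infinity :: complex filter)"
    using tendsto_diff[OF tendsto_mult[OF c c] tendsto_mult[OF c c], of 1 1 2 2 1 2 2 1] by simp
  then have dc: "c 1 1 * c 2 2 - c 1 2 * c 2 1 = 1"
    using tendsto_unique[OF trivial_limit_at_infinity _ tendsto_const] by metis
  \<comment> \<open>The limit \<open>c\<close> is C J with J as in \<open>pairing_bounded\<close>.
    Hence C has the rows (c12, -c11) and (c22, -c21), and the coefficients here are the entries of
    its inverse; the new limit is J.\<close>
  define v where "v i z = (if i = 1 then - c 2 1 * u 1 z + c 1 1 * u 2 z else - c 2 2 * u 1 z
    + c 1 2 * u 2 z)" for i :: 2 and z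
  define h where "h i z = (if i = 1 then - c 2 1 * e 1 z + c 1 1 * e 2 z else - c 2 2 * e 1 z
    + c 1 2 * e 2 z)" for i :: 2 and z
  have "v i holomorphic_on UNIV" "h i holomorphic_on UNIV" for i
    unfolding v_def[abs_def] h_def[abs_def] by (cases "i = 1"; auto intro!: holomorphic_intros hol)+
  moreover have "v 1 z * h 2 z - h 1 z * v 2 z = 1" for z
    unfolding v_def h_def using dc det(1)[of z] by simp algebra
  ultimately have "entire_frame v h" by (simp add: entire_frame_def)
  moreover have "v 1 x * v 2 y - v 2 x * v 1 y = u 1 x * u 2 y - u 2 x * u 1 y" for x y
    unfolding v_def using dc by simp algebra
  moreover have "((\<lambda>z. v i z * e' l z - h i z * u' l z + log_ratio \<alpha> \<beta> z * v i z * u' l z) \<longlongrightarrow>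
        (if i = 1 \<and> l = 2 then 1 else if i = 2 \<and> l = 1 then - 1 else 0)) at_infinity" for i l
  proof -
    have 1: "v 1 z * e' l z - h 1 z * u' l z + log_ratio \<alpha> \<beta> z * v 1 z * u' l z = - c 2 1 * W 1 l z
      + c 1 1 * W 2 l z" for z
      by (simp add: v_def h_def W_def algebra_simps)
    have 2: "v 2 z * e' l z - h 2 z * u' l z + log_ratio \<alpha> \<beta> z * v 2 z * u' l z = - c 2 2 * W 1 l z
      + c 1 2 * W 2 l z" for z
      by (simp add: v_def h_def W_def algebra_simps)
    have "((\<lambda>z. - c 2 1 * W 1 l z + c 1 1 * W 2 l z) \<longlongrightarrow> - c 2 1 * c 1 l + c 1 1 * c 2 l) at_infinity"
      "((\<lambda>z. - c 2 2 * W 1 l z + c 1 2 * W 2 l z) \<longlongrightarrow> - c 2 2 * c 1 l + c 1 2 * c 2 l) at_infinity"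
      by (intro tendsto_intros c)+
    moreover have "- c 2 1 * c 1 l + c 1 1 * c 2 l = (if l = 2 then 1 else 0)"
      "- c 2 2 * c 1 l + c 1 2 * c 2 l = (if l = 1 then - 1 else 0)"
      using exhaust_2[of l] dc by (auto simp: algebra_simps eq_neg_iff_add_eq_0)
    ultimately have lim: "((\<lambda>z. v 1 z * e' l z - h 1 z * u' l z + log_ratio \<alpha> \<beta> z * v 1 z * u' l z) \<longlongrightarrow> (if l
      = 2 then 1 else 0)) at_infinity"
      "((\<lambda>z. v 2 z * e' l z - h 2 z * u' l z + log_ratio \<alpha> \<beta> z * v 2 z * u' l z) \<longlongrightarrow> (if l
        = 1 then - 1 else 0)) at_infinity"
      unfolding 1 2 by simp_all
    consider "i = 1" "l = 1" | "i = 1" "l = 2" | "i = 2" "l = 1" | "i = 2" "l = 2" using exhaust_2 by metis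
    then show ?thesis by cases (use lim in simp_all)
  qed
  ultimately show ?thesis by (rule that)
qed

text \<open>Maximum principle. An attained maximum yields a number that can be moved across an
  inequality in \<open>frame_close\<close>.\<close>

lemma entire_attains_max_on_sphere:
  assumes f: "f holomorphic_on UNIV" and \<rho>: "\<rho> > 0"
  obtains w where "norm (w - c) = \<rho>" "\<And>z. z \<in> cball c \<rho> \<Longrightarrow> norm (f z) \<le> norm (f w :: complex)"
proof -
  have cont: "continuous_on S f" for S using f holomorphic_on_imp_continuous_on holomorphic_on_subset
    by blast
  obtain w where w: "w \<in> sphere c \<rho>" "\<And>z. z \<in> sphere c \<rho> \<Longrightarrow> norm (f z) \<le> norm (f w)"
    using continuous_attains_sup[OF compact_sphere _ continuous_on_norm[OF cont], of c \<rho>] \<rho> by auto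
  have "norm (f z) \<le> norm (f w)" if "z \<in> cball c \<rho>" for z
    by (rule maximum_modulus_frontier[of f "cball c \<rho>"]) (use w \<rho> that cont in
      \<open>auto intro: holomorphic_on_subset[OF f]\<close>)
  then show ?thesis using that w(1) by (auto simp: dist_norm norm_minus_commute)
qed

text \<open>The quotient is 1 + w with |w| < 1 / 2, and the factor 2 of the logarithm bound is
  swallowed by 2 pi.\<close>

lemma norm_log_ratio_le:
  assumes "norm (z - of_real \<beta>) = \<rho>" "4 * \<bar>\<alpha> - \<beta>\<bar> < \<rho>"
  shows "norm (log_ratio \<alpha> \<beta> z) \<le> 2 * \<bar>\<alpha> - \<beta>\<bar> / \<rho>"
proof -
  define w where "w = of_real (\<alpha> - \<beta>) / (z - of_real \<alpha>)"
  have d0: "norm (z - of_real \<alpha>) \<ge> norm (z - of_real \<beta>) - norm (of_real (\<alpha> - \<beta>) :: complex)"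
    using norm_triangle_ineq2[of "z - of_real \<beta>" "of_real (\<alpha> - \<beta>)"] by simp
  have d: "norm (z - of_real \<alpha>) \<ge> \<rho> / 2"
  proof -
    have "x - a \<le> y \<Longrightarrow> 4 * a < x \<Longrightarrow> 0 \<le> a \<Longrightarrow> x / 2 \<le> y" for x a y :: real by linarith
    then show ?thesis using d0 assms by (metis abs_ge_zero norm_of_real)
  qed
  have \<rho>: "\<rho> > 0" by (rule le_less_trans[OF _ assms(2)]) simp
  have "norm w = \<bar>\<alpha> - \<beta>\<bar> / norm (z - of_real \<alpha>)" by (simp add: w_def norm_divide del: of_real_diff)
  also have "\<dots> \<le> \<bar>\<alpha> - \<beta>\<bar> / (\<rho> / 2)" using d \<rho> by (intro divide_left_mono mult_pos_pos) auto
  finally have w: "norm w \<le> 2 * \<bar>\<alpha> - \<beta>\<bar> / \<rho>" by (simp add: mult.commute)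
  also have "\<dots> < 1 / 2" using assms(2) \<rho> by (simp add: field_simps)
  finally have "norm (Ln (1 + w)) \<le> 2 * norm w" by (rule norm_Ln_le)
  moreover have "(z - of_real \<beta>) / (z - of_real \<alpha>) = 1 + w"
  proof -
    have "z \<noteq> of_real \<alpha>" using d \<rho> by auto
    then show ?thesis by (simp add: w_def field_simps)
  qed
  ultimately have "norm (Ln ((z - of_real \<beta>) / (z - of_real \<alpha>))) \<le> 2 * norm w" by simp
  from divide_right_mono[OF this, of "2 * pi"]
  have "norm (log_ratio \<alpha> \<beta> z) \<le> 2 * norm w / (2 * pi)"
    unfolding log_ratio_def norm_divide norm_mult by simp
  also have "\<dots> \<le> norm w" using pi_ge_two mult_right_mono[of 1 pi "norm w"]
    by (simp add: divide_le_eq mult.commute)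
  finally show ?thesis using w by simp
qed

text \<open>\<open>K\<close> and \<delta> depend on the frame at \<beta> alone, uniformly over all
  nearby parameters. The logarithm is small on the circle of radius \<rho>; the exterior bound
  carries this to radius 2 \<rho>, and the maximum principle back inside.\<close>

lemma frame_close:
  assumes F': "entire_frame u' e'" and \<rho>: "\<rho> > 0"
  shows "\<exists>K \<delta>. \<delta> > 0 \<and> (\<forall>\<alpha> u e. \<bar>\<alpha> - \<beta>\<bar> < \<delta> \<longrightarrow> entire_frame u e \<longrightarrow> pairing_bounded \<alpha> u e \<beta> u' e' \<longrightarrow>
      (\<exists>v. (\<forall>x y. v 1 x * v 2 y - v 2 x * v 1 y = u 1 x * u 2 y - u 2 x * u 1 y) \<and>
          (\<forall>i. \<forall>z\<in>cball (of_real \<beta>) (2 * \<rho>). norm (v i z - u' i z) \<le> K * \<bar>\<alpha> - \<beta>\<bar>)))"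
proof -
  let ?D = "cball (complex_of_real \<beta>) (2 * \<rho>)"
  have hol': "u' i holomorphic_on UNIV" "e' i holomorphic_on UNIV" for i
    using F' unfolding entire_frame_def by blast+
  have det': "u' 1 z * e' 2 z - e' 1 z * u' 2 z = 1" for z using F' unfolding entire_frame_def by blast
  have "\<exists>B. \<forall>z\<in>?D. norm (u' i z) \<le> B" for i
    using entire_attains_max_on_sphere[OF hol'(1)[of i], of "2 * \<rho>" "of_real \<beta>"] \<rho>
      by (metis mult_pos_pos zero_less_numeral)
  then obtain B where B: "\<And>i z. z \<in> ?D \<Longrightarrow> norm (u' i z) \<le> B i" by metis
  define U where "U = \<bar>B 1\<bar> + \<bar>B 2\<bar> + 1"
  have U: "norm (u' i z) \<le> U" if "z \<in> ?D" for i z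
    using B[OF that, of i] exhaust_2[of i] unfolding U_def by auto
  have U1: "U \<ge> 1" by (simp add: U_def)
  \<comment> \<open>The first entry gives the distance that \<open>norm_log_ratio_le\<close> needs;
    the second makes the coefficient 2 L U^2 at most 1 / 2, as the absorption requires.\<close>
  define \<delta> where "\<delta> = min (\<rho> / 4) (\<rho> / (8 * U\<^sup>2))"
  have \<delta>: "\<delta> > 0" using \<rho> U1 by (simp add: \<delta>_def)
  show ?thesis
  proof (rule exI[of _ "8 * U ^ 3 / \<rho>"], rule exI[of _ \<delta>], intro conjI \<delta> allI impI)
    fix \<alpha> u e assume a: "\<bar>\<alpha> - \<beta>\<bar> < \<delta>" and F: "entire_frame u e" and P: "pairing_bounded \<alpha> u e \<beta> u' e'"
    define L where "L = 2 * \<bar>\<alpha> - \<beta>\<bar> / \<rho>"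
    have L0: "L \<ge> 0" using \<rho> by (simp add: L_def)
    have a4: "4 * \<bar>\<alpha> - \<beta>\<bar> < \<rho>" and a8: "8 * U\<^sup>2 * \<bar>\<alpha> - \<beta>\<bar> < \<rho>"
      using a \<rho> U1 by (auto simp: \<delta>_def field_simps)
    have a2: "2 * \<bar>\<alpha> - \<beta>\<bar> < \<rho>" by (rule le_less_trans[OF _ a4]) simp
    have LU: "2 * (L * U\<^sup>2) \<le> 1 / 2" using a8 \<rho> by (simp add: L_def field_simps)
    obtain v h where vh: "entire_frame v h" "\<And>x y. v 1 x * v 2 y - v 2 x * v 1 y = u 1 x * u 2 y
      - u 2 x * u 1 y"
      and lim: "\<And>i l. ((\<lambda>z. v i z * e' l z - h i z * u' l z + log_ratio \<alpha> \<beta> z * v i z * u' l z) \<longlongrightarrow>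
        (if i = 1 \<and> l = 2 then 1 else if i = 2 \<and> l = 1 then - 1 else 0)) at_infinity"
      using frame_normalization[OF F F' P] by blast
    have hol: "v i holomorphic_on UNIV" "h i holomorphic_on UNIV" for i
      using vh(1) unfolding entire_frame_def by blast+
    have "norm (v i z - u' i z) \<le> 8 * U ^ 3 / \<rho> * \<bar>\<alpha> - \<beta>\<bar>" if z: "z \<in> ?D" for i z
    proof -
      obtain w0 where w0: "norm (w0 - of_real \<beta>) = 2 * \<rho>" "\<And>z. z \<in> ?D \<Longrightarrow> norm (v i z) \<le> norm (v i w0)"
        using entire_attains_max_on_sphere[OF hol(1)[of i], of "2 * \<rho>" "of_real \<beta>"] \<rho> by auto
      define S where "S = norm (v i w0)"
      have S0: "S \<ge> 0" by (simp add: S_def)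
      have T: "norm (v i z * e' l z - h i z * u' l z + log_ratio \<alpha> \<beta> z * v i z * u' l z -
          (if i = 1 \<and> l = 2 then 1 else if i = 2 \<and> l = 1 then - 1 else 0)) \<le> L * S * U"
        if z: "norm (z - of_real \<beta>) = 2 * \<rho>" for l z
      \<comment> \<open>Outside radius 2 |\<alpha> - \<beta>| about \<beta> a point is farther than
        |\<alpha> - \<beta>| from \<alpha>, so the logarithm is holomorphic there.\<close>
      proof (rule exterior_part_bound[where r = "2 * \<bar>\<alpha> - \<beta>\<bar>" and c = "of_real \<beta>" and \<rho> = \<rho>
            and Q = "\<lambda>z. v i z * e' l z - h i z * u' l z" and T = "\<lambda>z. log_ratio \<alpha> \<beta> z * v i z * u' l z"])
        show "(\<lambda>z. v i z * e' l z - h i z * u' l z) holomorphic_on UNIV"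
          by (intro holomorphic_intros hol hol')
        have "norm (z - of_real \<alpha>) > \<bar>\<alpha> - \<beta>\<bar>" if "2 * \<bar>\<alpha> - \<beta>\<bar> < norm (z - of_real \<beta>)" for z :: complex
        proof -
          have "norm (z - of_real \<beta>) - norm (of_real (\<alpha> - \<beta>) :: complex) \<le> norm (z - of_real \<alpha>)"
            using norm_triangle_ineq2[of "z - of_real \<beta>" "of_real (\<alpha> - \<beta>)"] by simp
          moreover have "x - a \<le> y \<Longrightarrow> 2 * a < x \<Longrightarrow> a < y" for x a y :: real by linarith
          ultimately show ?thesis using that unfolding norm_of_real by blast
        qed
        note lr = log_ratio_holomorphic_at[OF this]
        show "(\<lambda>z. log_ratio \<alpha> \<beta> z * v i z * u' l z) holomorphic_on {w. 2 * \<bar>\<alpha> - \<beta>\<bar> < norm (w - of_real \<beta>)}"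
          unfolding log_ratio_def using lr
          by (intro holomorphic_intros holomorphic_on_subset[OF hol(1)] holomorphic_on_subset[OF hol'(1)])
            auto
        show "((\<lambda>z. v i z * e' l z - h i z * u' l z + log_ratio \<alpha> \<beta> z * v i z * u' l z) \<longlongrightarrow>
          (if i = 1 \<and> l = 2 then 1 else if i = 2 \<and> l = 1 then - 1 else 0)) at_infinity" by (rule lim)
        fix w :: complex assume w: "norm (w - of_real \<beta>) = \<rho>"
        then have wD: "w \<in> ?D" using \<rho> by (simp add: dist_norm norm_minus_commute)
        have "norm (log_ratio \<alpha> \<beta> w) \<le> L" unfolding L_def by (rule norm_log_ratio_le[OF w a4])
        then show "norm (log_ratio \<alpha> \<beta> w * v i w * u' l w) \<le> L * S * U"
          unfolding norm_mult using w0(2)[OF wD] U[OF wD] L0 S0 by (intro mult_mono) (auto simp: S_def)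
      qed (use a2 z in auto)
      have diff: "norm (v i z - u' i z) \<le> 2 * (L * U\<^sup>2) * S" if zs: "norm (z - of_real \<beta>) = 2 * \<rho>" for z
      proof -
        define J :: "2 \<Rightarrow> complex" where "J l = (if i = 1 \<and> l = 2 then 1 else if i = 2 \<and> l
          = 1 then - 1 else 0)" for l
        define V where "V l = v i z * e' l z - h i z * u' l z + log_ratio \<alpha> \<beta> z * v i z * u' l z" for l
        have zD: "z \<in> ?D" using zs by (simp add: dist_norm norm_minus_commute)
        have VJ: "norm (V l - J l) \<le> L * S * U" for l unfolding V_def J_def by (rule T[OF zs])
        \<comment> \<open>Pairing with u' removes the terms with \<open>h\<close> and with the
          logarithm; the determinant of the frame at \<beta> leaves v. Only bounds for u' are
          needed.\<close>
        have "v i z = V 2 * u' 1 z - V 1 * u' 2 z"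
          using det'[of z] unfolding V_def by algebra
        moreover have "u' i z = J 2 * u' 1 z - J 1 * u' 2 z"
          using exhaust_2[of i] by (auto simp: J_def)
        ultimately have "v i z - u' i z = (V 2 - J 2) * u' 1 z - (V 1 - J 1) * u' 2 z" by algebra
        also have "norm \<dots> \<le> norm (V 2 - J 2) * norm (u' 1 z) + norm (V 1 - J 1) * norm (u' 2 z)"
          by (rule order_trans[OF norm_triangle_ineq4]) (simp add: norm_mult)
        also have "\<dots> \<le> L * S * U * U + L * S * U * U"
          using VJ U[OF zD] U1 L0 S0 by (intro add_mono mult_mono mult_nonneg_nonneg) auto
        finally show ?thesis by (simp add: power2_eq_square algebra_simps)
      qed
      \<comment> \<open>The unknown maximum of v bounds itself: half of it is moved to the
        left.\<close>
      have "S \<le> U + norm (v i w0 - u' i w0)"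
        using U[of w0 i] w0(1) norm_triangle_sub[of "v i w0" "u' i w0"]
          by (simp add: S_def dist_norm norm_minus_commute)
      also have "\<dots> \<le> U + 1 / 2 * S"
        using diff[OF w0(1)] mult_right_mono[OF LU S0] by simp
      finally have S: "S \<le> 2 * U" by simp
      obtain w1 where w1: "norm (w1 - of_real \<beta>) = 2 * \<rho>" "\<And>z. z \<in> ?D \<Longrightarrow> norm (v i z - u' i z)
        \<le> norm (v i w1 - u' i w1)"
        by (rule entire_attains_max_on_sphere[OF holomorphic_on_diff[OF hol(1)[of i] hol'(1)[of i]], of
          "2 * \<rho>" "of_real \<beta>"])
           (use \<rho> in auto)
      have "norm (v i z - u' i z) \<le> 2 * (L * U\<^sup>2) * S" using w1(2)[OF z] diff[OF w1(1)] by simp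
      also have "\<dots> \<le> 2 * (L * U\<^sup>2) * (2 * U)" using S L0 by (intro mult_left_mono) auto
      also have "\<dots> = 8 * U ^ 3 / \<rho> * \<bar>\<alpha> - \<beta>\<bar>" by (simp add: L_def power2_eq_square power3_eq_cube)
      finally show ?thesis .
    qed
    then show "\<exists>v. (\<forall>x y. v 1 x * v 2 y - v 2 x * v 1 y = u 1 x * u 2 y - u 2 x * u 1 y) \<and>
          (\<forall>i. \<forall>z\<in>?D. norm (v i z - u' i z) \<le> 8 * U ^ 3 / \<rho> * \<bar>\<alpha> - \<beta>\<bar>)"
      using vh(2) by blast
  qed
qed

subsection \<open>Continuity of the kernels\<close>

definition wedge :: "(2 \<Rightarrow> complex \<Rightarrow> complex) \<Rightarrow> complex \<Rightarrow> complex \<Rightarrow> complex" where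
  "wedge u x y = u 1 x * u 2 y - u 2 x * u 1 y"

text \<open>The wedge vanishes at equal arguments, so the derivative is the continuous value on the
  diagonal.\<close>

definition wedge_kernel :: "(2 \<Rightarrow> complex \<Rightarrow> complex) \<Rightarrow> complex \<Rightarrow> complex \<Rightarrow> complex" where
  "wedge_kernel u x y = (if x \<noteq> y then wedge u x y / (x - y) else deriv (\<lambda>s. wedge u s y) y)"

lemma wedge_holomorphic: "(\<And>i. u i holomorphic_on UNIV) \<Longrightarrow> (\<lambda>s. wedge u s y) holomorphic_on UNIV"
  unfolding wedge_def by (intro holomorphic_intros)

text \<open>Both points move, so differentiability at x alone is not enough. Continuity of the
  derivative gives it: the mean value inequality is applied to F(z) - F'(x) z, whose derivative is
  small near x.\<close>

lemma difference_quotient_tendsto: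
  fixes x :: real
  assumes F: "F holomorphic_on UNIV"
  shows "((\<lambda>(s, t). (F (of_real s) - F (of_real t)) / of_real (s - t)) \<longlongrightarrow> deriv F (of_real x))
    (at (x, x) within {(s, t). s \<noteq> t})"
proof (rule tendstoI)
  fix e :: real assume e: "e > 0"
  have "isCont (deriv F) (of_real x)"
    by (rule entire_isCont) (simp add: holomorphic_deriv[OF F])
  then obtain d where d: "d > 0" "\<And>z. dist z (of_real x) < d \<Longrightarrow>
    dist (deriv F z) (deriv F (of_real x)) < e / 2"
    unfolding continuous_at_eps_delta using half_gt_zero[OF e] by metis
  have quot: "dist ((F (of_real s) - F (of_real t)) / of_real (s - t)) (deriv F (of_real x)) < e"
    if st: "s \<noteq> t" "dist s x < d" "dist t x < d" for s t
  proof -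
    have "norm ((F (of_real s) - deriv F (of_real x) * of_real s) - (F (of_real t) - deriv F (of_real x)
      * of_real t))
       \<le> e / 2 * norm (of_real s - of_real t :: complex)"
    proof (rule field_differentiable_bound[OF convex_ball[of "of_real x" d], where f' = "\<lambda>z. deriv F z
      - deriv F (of_real x)"])
      fix z :: complex assume z: "z \<in> ball (of_real x) d"
      have "(F has_field_derivative deriv F z) (at z)"
        using holomorphic_derivI[OF F open_UNIV] by simp
      then show "((\<lambda>z. F z - deriv F (of_real x) * z) has_field_derivative deriv F z - deriv F (of_real x))
        (at z within ball (of_real x) d)"
        by (auto intro!: derivative_eq_intros intro: has_field_derivative_at_within)
      show "norm (deriv F z - deriv F (of_real x)) \<le> e / 2"
        using d(2)[of z] z by (simp add: dist_norm norm_minus_commute)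
    qed (use st in \<open>auto simp: dist_commute dist_of_real\<close>)
    moreover have "(F (of_real s) - deriv F (of_real x) * of_real s) - (F (of_real t) - deriv F (of_real x)
      * of_real t)
        = F (of_real s) - F (of_real t) - deriv F (of_real x) * of_real (s - t)"
      by (simp add: algebra_simps)
    ultimately have "norm (F (of_real s) - F (of_real t) - deriv F (of_real x) * of_real (s - t))
      \<le> e / 2 * \<bar>s - t\<bar>"
      by (metis norm_of_real of_real_diff)
    moreover have "norm ((F (of_real s) - F (of_real t)) / of_real (s - t) - deriv F (of_real x))
        = norm (F (of_real s) - F (of_real t) - deriv F (of_real x) * of_real (s - t)) / \<bar>s - t\<bar>"
    proof -
      have "(F (of_real s) - F (of_real t)) / of_real (s - t) - deriv F (of_real x)
          = (F (of_real s) - F (of_real t) - deriv F (of_real x) * of_real (s - t)) / of_real (s - t)"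
        using st(1) by (simp add: field_simps)
      then show ?thesis by (simp only: norm_divide norm_of_real)
    qed
    ultimately have "norm ((F (of_real s) - F (of_real t)) / of_real (s - t) - deriv F (of_real x)) \<le> e / 2"
      using st(1) by (simp add: divide_le_eq)
    then show ?thesis using e unfolding dist_norm by linarith
  qed
  show "\<forall>\<^sub>F p in at (x, x) within {(s, t). s \<noteq> t}.
      dist (case p of (s, t) \<Rightarrow> (F (of_real s) - F (of_real t)) / of_real (s - t)) (deriv F (of_real x)) < e"
    unfolding eventually_at
  proof (intro exI[of _ d] conjI ballI impI d(1))
    fix p :: "real \<times> real" assume p: "p \<in> {(s, t). s \<noteq> t}" "p \<noteq> (x, x) \<and> dist p (x, x) < d"
    obtain s t where [simp]: "p = (s, t)" by (cases p)
    have "dist s x < d" "dist t x < d"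
      using p(2) dist_fst_le[of p "(x, x)"] dist_snd_le[of p "(x, x)"] by auto
    then show "dist (case p of (s, t) \<Rightarrow> (F (of_real s) - F (of_real t)) / of_real (s - t))
      (deriv F (of_real x)) < e"
      using quot p(1) by simp
  qed
qed

text \<open>Makes the filter in the diagonal case of \<open>integrable_kernel\<close> nontrivial, so
  that \<open>Lim\<close> is the limit.\<close>

lemma diagonal_islimpt: "(x :: real, x) islimpt {(s, t). s \<noteq> t}"
  unfolding islimpt_approachable
proof (intro allI impI)
  fix e :: real assume "e > 0"
  then show "\<exists>p\<in>{(s, t). s \<noteq> t}. p \<noteq> (x, x) \<and> dist p (x, x) < e"
    by (intro bexI[of _ "(x + e / 2, x)"]) (auto simp: dist_Pair_Pair dist_real_def)
qed

lemma integrable_kernel_eq_wedge_kernel: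
  assumes u: "\<And>i. u i holomorphic_on UNIV"
    and f: "\<And>t. t > \<alpha> \<Longrightarrow> f t = c * u 1 (of_real t)" and g: "\<And>t. t > \<alpha> \<Longrightarrow> g t = c * u 2 (of_real t)"
    and x: "x > \<alpha>" and y: "y > \<alpha>"
  shows "integrable_kernel f g x y = c\<^sup>2 * wedge_kernel u (of_real x) (of_real y)"
proof (cases "x = y")
  case False
  then show ?thesis
    using x y by (simp add: integrable_kernel_def kernel_quotient_def wedge_kernel_def wedge_def f g
      power2_eq_square field_simps)
next
  case True
  let ?G = "at (x, x) within {(s, t). s \<noteq> t}"
  let ?q = "\<lambda>i (s, t). (u i (of_real s) - u i (of_real t)) / of_real (s - t)"
  have snd: "((\<lambda>p. u i (of_real (snd p))) \<longlongrightarrow> u i (of_real x)) ?G" for i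
  proof -
    have "((\<lambda>p :: real \<times> real. complex_of_real (snd p)) \<longlongrightarrow> of_real (snd (x, x))) ?G"
      by (intro tendsto_intros)
    then show ?thesis using isCont_tendsto_compose[OF entire_isCont[OF u]] by force
  qed
  have "deriv (\<lambda>s. wedge u s (of_real x)) (of_real x) = deriv (u 1) (of_real x) * u 2 (of_real x)
    - deriv (u 2) (of_real x) * u 1 (of_real x)"
  proof (rule DERIV_imp_deriv)
    have "(u i has_field_derivative deriv (u i) (of_real x)) (at (of_real x))" for i
      using holomorphic_derivI[OF u open_UNIV] by simp
    then show "((\<lambda>s. wedge u s (of_real x)) has_field_derivative
       deriv (u 1) (of_real x) * u 2 (of_real x) - deriv (u 2) (of_real x) * u 1 (of_real x))
         (at (of_real x))"
      unfolding wedge_def by (auto intro!: derivative_eq_intros)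
  qed
  then have kernel: "wedge_kernel u (of_real x) (of_real x) = deriv (u 1) (of_real x) * u 2 (of_real x)
    - deriv (u 2) (of_real x) * u 1 (of_real x)"
    by (simp add: wedge_kernel_def)
  have "((\<lambda>p. c\<^sup>2 * (?q 1 p * u 2 (of_real (snd p)) - ?q 2 p * u 1 (of_real (snd p)))) \<longlongrightarrow> c\<^sup>2 * wedge_kernel
    u (of_real x) (of_real x)) ?G"
    unfolding kernel by (intro tendsto_intros difference_quotient_tendsto u snd)
  moreover have "\<forall>\<^sub>F p in ?G. c\<^sup>2 * (?q 1 p * u 2 (of_real (snd p)) - ?q 2 p * u 1 (of_real (snd p)))
    = (\<lambda>(s, t). kernel_quotient f g s t) p"
  proof -
    have "\<forall>\<^sub>F p in ?G. p \<in> {\<alpha><..} \<times> {\<alpha><..}"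
      by (rule eventually_at_open) (use x in \<open>auto intro: open_Times\<close>)
    then show ?thesis using eventually_at_in
    proof eventually_elim
      case (elim p)
      obtain s t where p: "p = (s, t)" by (cases p)
      have st: "s > \<alpha>" "t > \<alpha>" "s \<noteq> t" using elim p by auto
      \<comment> \<open>Subtracting and adding b1 b2 splits the kernel quotient into two difference
        quotients.\<close>
      have "c\<^sup>2 * ((a1 - b1) / d * b2 - (a2 - b2) / d * b1) = (c * a1 * (c * b2) - c * a2 * (c * b1)) / d"
        for a1 a2 b1 b2 d
        by (cases "d = 0") (simp_all add: field_simps power2_eq_square)
      then show ?case unfolding p kernel_quotient_def using st by (simp only: f g prod.case snd_conv)
    qed
  qed
  ultimately have "((\<lambda>(s, t). kernel_quotient f g s t) \<longlongrightarrow> c\<^sup>2 * wedge_kernel u (of_real x) (of_real x)) ?G"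
    by (rule Lim_transform_eventually)
  then show ?thesis
    unfolding integrable_kernel_def using True diagonal_islimpt
      by (auto intro!: tendsto_Lim simp: trivial_limit_within)
qed

text \<open>The kernel is locally Lipschitz in the parameter: the wedge does not see the passage
  from u to v, and v is Lipschitz close to the frame at \<beta>.\<close>

lemma wedge_kernel_continuous_on:
  assumes F: "\<And>\<alpha>. \<alpha> \<in> A \<Longrightarrow> entire_frame (u \<alpha>) (e \<alpha>)"
    and P: "\<And>\<alpha> \<beta>. \<alpha> \<in> A \<Longrightarrow> \<beta> \<in> A \<Longrightarrow> pairing_bounded \<alpha> (u \<alpha>) (e \<alpha>) \<beta> (u \<beta>) (e \<beta>)"
  shows "continuous_on A (\<lambda>\<alpha>. wedge_kernel (u \<alpha>) x y)"
  unfolding continuous_on_def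
proof
  fix \<beta> assume \<beta>: "\<beta> \<in> A"
  \<comment> \<open>The disc of radius 2 \<rho> has to contain x, y and the unit disc about y; the
    last serves Cauchy's inequality.\<close>
  define \<rho> where "\<rho> = norm (x - of_real \<beta>) + norm (y - of_real \<beta>) + 1"
  have \<rho>: "\<rho> > 0" by (simp add: \<rho>_def add_nonneg_pos)
  let ?D = "cball (complex_of_real \<beta>) (2 * \<rho>)"
  have D: "x \<in> ?D" "y \<in> ?D" "cball y 1 \<subseteq> ?D"
  proof -
    show "x \<in> ?D" "y \<in> ?D" by (simp_all add: \<rho>_def dist_norm norm_minus_commute)
    show "cball y 1 \<subseteq> ?D"
    proof
      fix s assume "s \<in> cball y 1"
      then have "norm (s - of_real \<beta>) \<le> 1 + norm (y - of_real \<beta>)"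
        using norm_triangle_ineq[of "s - y" "y - of_real \<beta>"] by (simp add: dist_norm norm_minus_commute)
      also have "\<dots> \<le> 2 * \<rho>" by (simp add: \<rho>_def)
      finally show "s \<in> ?D" by (simp add: dist_norm norm_minus_commute)
    qed
  qed
  obtain K \<delta> where \<delta>: "\<delta> > 0" and close: "\<And>\<alpha> u' e'. \<bar>\<alpha> - \<beta>\<bar> < \<delta> \<Longrightarrow> entire_frame u' e' \<Longrightarrow>
    pairing_bounded \<alpha> u' e' \<beta> (u \<beta>) (e \<beta>) \<Longrightarrow>
      \<exists>v. (\<forall>x y. v 1 x * v 2 y - v 2 x * v 1 y = u' 1 x * u' 2 y - u' 2 x * u' 1 y) \<and>
          (\<forall>i. \<forall>z\<in>?D. norm (v i z - u \<beta> i z) \<le> K * \<bar>\<alpha> - \<beta>\<bar>)"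
    using frame_close[OF F[OF \<beta>] \<rho>, of \<beta>] by blast
  have hol: "u \<alpha> i holomorphic_on UNIV" if "\<alpha> \<in> A" for \<alpha> i
    using F[OF that] unfolding entire_frame_def by blast
  have "\<exists>B. \<forall>z\<in>?D. norm (u \<beta> i z) \<le> B" for i
    using entire_attains_max_on_sphere[OF hol[OF \<beta>, of i], of "2 * \<rho>" "of_real \<beta>"] \<rho>
      by (metis mult_pos_pos zero_less_numeral)
  then obtain B where B: "\<And>i z. z \<in> ?D \<Longrightarrow> norm (u \<beta> i z) \<le> B i" by metis
  define U where "U = \<bar>B 1\<bar> + \<bar>B 2\<bar>"
  have U: "norm (u \<beta> i z) \<le> U" if "z \<in> ?D" for i z
    using B[OF that, of i] exhaust_2[of i] unfolding U_def by auto
  have U0: "U \<ge> 0" by (simp add: U_def)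
  define K' where "K' = 2 * (\<bar>K\<bar> * (U + \<bar>K\<bar> * \<delta>) + U * \<bar>K\<bar>)"
  have wedge_close: "norm (wedge (u \<alpha>) s y - wedge (u \<beta>) s y) \<le> K' * \<bar>\<alpha> - \<beta>\<bar>"
    if \<alpha>: "\<alpha> \<in> A" "\<bar>\<alpha> - \<beta>\<bar> < \<delta>" and s: "s \<in> ?D" for \<alpha> s
  proof -
    obtain v where v: "\<And>x y. v 1 x * v 2 y - v 2 x * v 1 y = u \<alpha> 1 x * u \<alpha> 2 y - u \<alpha> 2 x * u \<alpha> 1 y"
      "\<And>i z. z \<in> ?D \<Longrightarrow> norm (v i z - u \<beta> i z) \<le> K * \<bar>\<alpha> - \<beta>\<bar>"
      using close[OF \<alpha>(2) F[OF \<alpha>(1)] P[OF \<alpha>(1) \<beta>]] by blast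
    define \<epsilon> where "\<epsilon> = \<bar>K\<bar> * \<bar>\<alpha> - \<beta>\<bar>"
    have \<epsilon>: "norm (v i z - u \<beta> i z) \<le> \<epsilon>" if "z \<in> ?D" for i z
      using v(2)[OF that, of i] mult_right_mono[OF abs_ge_self[of K] abs_ge_zero[of "\<alpha> - \<beta>"]]
        unfolding \<epsilon>_def by (rule order_trans)
    have \<epsilon>0: "\<epsilon> \<ge> 0" by (simp add: \<epsilon>_def)
    have \<epsilon>\<delta>: "\<epsilon> \<le> \<bar>K\<bar> * \<delta>" unfolding \<epsilon>_def using \<alpha>(2) by (intro mult_left_mono) auto
    have prod: "norm (v i s * v j y - u \<beta> i s * u \<beta> j y) \<le> \<epsilon> * (U + \<bar>K\<bar> * \<delta>) + U * \<epsilon>" for i j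
    proof -
      have "norm (v j y) \<le> norm (u \<beta> j y) + norm (v j y - u \<beta> j y)" by (rule norm_triangle_sub)
      also have "\<dots> \<le> U + \<bar>K\<bar> * \<delta>" using U[OF D(2)] order_trans[OF \<epsilon>[OF D(2)] \<epsilon>\<delta>] by (rule add_mono)
      finally have vj: "norm (v j y) \<le> U + \<bar>K\<bar> * \<delta>" .
      have "v i s * v j y - u \<beta> i s * u \<beta> j y = (v i s - u \<beta> i s) * v j y + u \<beta> i s * (v j y - u \<beta> j y)"
        by (simp add: algebra_simps)
      then have "norm (v i s * v j y - u \<beta> i s * u \<beta> j y) \<le> norm (v i s - u \<beta> i s) * norm (v j y)
        + norm (u \<beta> i s) * norm (v j y - u \<beta> j y)"
        by (metis norm_mult norm_triangle_ineq)
      also have "\<dots> \<le> \<epsilon> * (U + \<bar>K\<bar> * \<delta>) + U * \<epsilon>"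
        by (intro add_mono mult_mono \<epsilon> s vj U D(2) norm_ge_zero \<epsilon>0 U0)
      finally show ?thesis .
    qed
    have "wedge (u \<alpha>) s y - wedge (u \<beta>) s y = (v 1 s * v 2 y - u \<beta> 1 s * u \<beta> 2 y) - (v 2 s * v 1 y
      - u \<beta> 2 s * u \<beta> 1 y)"
      unfolding wedge_def v(1)[symmetric] by simp
    also have "norm \<dots> \<le> (\<epsilon> * (U + \<bar>K\<bar> * \<delta>) + U * \<epsilon>) + (\<epsilon> * (U + \<bar>K\<bar> * \<delta>) + U * \<epsilon>)"
      by (rule order_trans[OF norm_triangle_ineq4 add_mono[OF prod prod]])
    also have "\<dots> = K' * \<bar>\<alpha> - \<beta>\<bar>" unfolding K'_def \<epsilon>_def by algebra
    finally show ?thesis .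
  qed
  define K'' where "K'' = (if x = y then K' else K' / norm (x - y))"
  have kernel_close: "norm (wedge_kernel (u \<alpha>) x y - wedge_kernel (u \<beta>) x y) \<le> K'' * \<bar>\<alpha> - \<beta>\<bar>"
    if \<alpha>: "\<alpha> \<in> A" "\<bar>\<alpha> - \<beta>\<bar> < \<delta>" for \<alpha>
  proof (cases "x = y")
    case False
    have "wedge_kernel (u \<alpha>) x y - wedge_kernel (u \<beta>) x y = (wedge (u \<alpha>) x y - wedge (u \<beta>) x y) / (x - y)"
      using False by (simp add: wedge_kernel_def diff_divide_distrib)
    then show ?thesis
      using wedge_close[OF \<alpha> D(1)] False by (simp add: norm_divide K''_def divide_right_mono)
  next
    case True
    let ?f = "\<lambda>s. wedge (u \<alpha>) s y - wedge (u \<beta>) s y"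
    have hw: "(\<lambda>s. wedge (u \<alpha>) s y) holomorphic_on UNIV" "(\<lambda>s. wedge (u \<beta>) s y) holomorphic_on UNIV"
      using hol \<alpha>(1) \<beta> by (auto intro: wedge_holomorphic)
    have hf: "?f holomorphic_on S" for S
      by (rule holomorphic_on_subset[OF holomorphic_on_diff[OF hw]]) simp
    \<comment> \<open>On the diagonal the kernels are derivatives; Cauchy's inequality on the unit
      circle about y reduces them to the wedges.\<close>
    have "norm ((deriv ^^ 1) ?f y) \<le> fact 1 * (K' * \<bar>\<alpha> - \<beta>\<bar>) / 1 ^ 1"
    proof (rule Cauchy_inequality[OF hf holomorphic_on_imp_continuous_on[OF hf]])
      fix s assume "norm (y - s) = 1"
      then have "s \<in> cball y 1" by (simp add: dist_norm)
      then show "norm (?f s) \<le> K' * \<bar>\<alpha> - \<beta>\<bar>" using wedge_close[OF \<alpha>] D(3) by blast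
    qed simp
    moreover have "deriv ?f y = deriv (\<lambda>s. wedge (u \<alpha>) s y) y - deriv (\<lambda>s. wedge (u \<beta>) s y) y"
      by (rule deriv_diff) (use hw in \<open>auto simp: holomorphic_on_open field_differentiable_def
        intro: holomorphic_on_imp_differentiable_at[OF _ open_UNIV]\<close>)
    ultimately show ?thesis using True by (simp add: wedge_kernel_def K''_def)
  qed
  show "((\<lambda>\<alpha>. wedge_kernel (u \<alpha>) x y) \<longlongrightarrow> wedge_kernel (u \<beta>) x y) (at \<beta> within A)"
  proof (rule LIM_zero_cancel, rule Lim_null_comparison)
    have "((\<lambda>\<alpha>. K'' * \<bar>\<alpha> - \<beta>\<bar>) \<longlongrightarrow> K'' * \<bar>\<beta> - \<beta>\<bar>) (at \<beta> within A)" by (intro tendsto_intros)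
    then show "((\<lambda>\<alpha>. K'' * \<bar>\<alpha> - \<beta>\<bar>) \<longlongrightarrow> 0) (at \<beta> within A)" by simp
    show "\<forall>\<^sub>F \<alpha> in at \<beta> within A. norm (wedge_kernel (u \<alpha>) x y - wedge_kernel (u \<beta>) x y) \<le> K'' * \<bar>\<alpha> - \<beta>\<bar>"
      unfolding eventually_at using \<delta> kernel_close by (intro exI[of _ \<delta>]) (auto simp: dist_real_def)
  qed
qed

section \<open>From the two problems to their kernels\<close>

lemma airy_rhp_of_right:
  assumes "\<alpha> \<ge> 0" "RHP_right \<alpha> M" shows "airy_rhp 0 \<alpha> M"
proof -
  have ph: "2 * phase 0 z = 4 / 3 * z powr (3 / 2)" for z by (simp add: phase_def)
  show ?thesis using assms unfolding RHP_right_def airy_rhp_def ph by simp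
qed

text \<open>For a = 0 the segment is empty, so its jump condition is vacuous.\<close>

lemma airy_rhp_of_left:
  assumes "RHP_left \<alpha> M" shows "airy_rhp \<alpha> 0 M"
proof -
  have ph: "2 * phase \<alpha> z = 4 / 3 * z powr (3 / 2) + 2 * of_real \<alpha> * z powr (1 / 2)" for z
    by (simp add: phase_def algebra_simps)
  have "has_jump M (segment0 0) d J" for d J by (simp add: has_jump_def segment0_def)
  then show ?thesis using assms unfolding RHP_left_def airy_rhp_def ph by (simp add: contour_right_0)
qed

text \<open>To the right of the endpoint the \<open>sector\<close> term vanishes, so the entire
  column is f or g up to the constant factor.\<close>

lemma col1_right_of_endpoint:
  assumes "a \<ge> 0" "t > a"
  shows "of_real t \<notin> contour_right a" "col1 \<kappa> M i (of_real t) = exp (- phase \<kappa> (of_real t)) * M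
    (of_real t) $ i $ 1"
  using assms mult_pos_pos[of "sqrt 3" t] by (auto simp: mem_contour_right col1_def sector_def)

theorem theorem1p3:
  fixes x y :: real
    and M_right M_left :: "real \<Rightarrow> complex \<Rightarrow> complex ^ 2 ^ 2"
  assumes "\<And>\<alpha>. 0 \<le> \<alpha> \<Longrightarrow> RHP_right \<alpha> (M_right \<alpha>)"
    and "\<And>\<alpha>. \<alpha> \<le> 0 \<Longrightarrow> RHP_left \<alpha> (M_left \<alpha>)"
  shows "continuous_on {\<alpha>. 0 \<le> \<alpha> \<and> \<alpha> < min x y} (\<lambda>\<alpha>. kernel_A (M_right \<alpha>) x y) \<and>
         continuous_on {\<alpha>. \<alpha> \<le> 0 \<and> \<alpha> < min x y} (\<lambda>\<alpha>. kernel_B \<alpha> (M_left \<alpha>) x y)"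
proof
  define c where "c = 1 / complex_of_real (sqrt (2 * pi)) * exp (of_real pi * \<i> / 4)"
  let ?A = "{\<alpha>. 0 \<le> \<alpha> \<and> \<alpha> < min x y}" and ?B = "{\<alpha>. \<alpha> \<le> 0 \<and> \<alpha> < min x y}"
  have rhp_A: "airy_rhp 0 \<alpha> (M_right \<alpha>)" if "0 \<le> \<alpha>" for \<alpha> using airy_rhp_of_right assms(1) that by blast
  then have "\<forall>\<alpha>. \<exists>u e. 0 \<le> \<alpha> \<longrightarrow> represents 0 \<alpha> (M_right \<alpha>) u e"
    using airy_rhp.represents_exists by blast
  then obtain u e where ue: "\<And>\<alpha>. 0 \<le> \<alpha> \<Longrightarrow> represents 0 \<alpha> (M_right \<alpha>) (u \<alpha>) (e \<alpha>)" by metis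
  have "kernel_A (M_right \<alpha>) x y = c\<^sup>2 * wedge_kernel (u \<alpha>) (of_real x) (of_real y)" if \<alpha>: "\<alpha> \<in> ?A" for \<alpha>
    unfolding kernel_A_def
  proof (rule integrable_kernel_eq_wedge_kernel)
    have rep: "represents 0 \<alpha> (M_right \<alpha>) (u \<alpha>) (e \<alpha>)" using ue \<alpha> by simp
    then show "u \<alpha> i holomorphic_on UNIV" for i by (simp add: represents_def entire_frame_def)
    have "u \<alpha> i (of_real t) = exp (- (2 / 3 * of_real t powr (3 / 2))) * M_right \<alpha> (of_real t) $ i $ 1"
      if "t > \<alpha>" for i t
      using rep col1_right_of_endpoint(1)[of \<alpha> t] col1_right_of_endpoint(2)[of \<alpha> t 0 "M_right \<alpha>" i] that \<alpha>
        by (simp add: represents_def phase_def)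
    then show "f_right (M_right \<alpha>) (of_real t) = c * u \<alpha> 1 (of_real t)" "g_right (M_right \<alpha>) (of_real t)
      = c * u \<alpha> 2 (of_real t)"
      if "t > \<alpha>" for t
      using that by (simp_all add: f_right_def g_right_def c_def)
  qed (use \<alpha> in auto)
  moreover have "continuous_on ?A (\<lambda>\<alpha>. c\<^sup>2 * wedge_kernel (u \<alpha>) (of_real x) (of_real y))"
  proof (intro continuous_intros wedge_kernel_continuous_on)
    fix \<alpha> \<beta> assume "\<alpha> \<in> ?A" "\<beta> \<in> ?A"
    then show "pairing_bounded \<alpha> (u \<alpha>) (e \<alpha>) \<beta> (u \<beta>) (e \<beta>)"
      using represents_pairing_bounded[OF rhp_A[of \<alpha>] rhp_A[of \<beta>] ue[of \<alpha>] ue[of \<beta>]] by simp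
  qed (use ue in \<open>auto simp: represents_def\<close>)
  ultimately show "continuous_on ?A (\<lambda>\<alpha>. kernel_A (M_right \<alpha>) x y)"
    by (metis (no_types, lifting) continuous_on_cong)

  have rhp_B: "airy_rhp \<alpha> 0 (M_left \<alpha>)" if "\<alpha> \<le> 0" for \<alpha> using airy_rhp_of_left assms(2) that by blast
  then have "\<forall>\<alpha>. \<exists>u e. \<alpha> \<le> 0 \<longrightarrow> represents \<alpha> 0 (M_left \<alpha>) u e"
    using airy_rhp.represents_exists by blast
  then obtain u e where ue: "\<And>\<alpha>. \<alpha> \<le> 0 \<Longrightarrow> represents \<alpha> 0 (M_left \<alpha>) (u \<alpha>) (e \<alpha>)" by metis
  have "kernel_B \<alpha> (M_left \<alpha>) x y = c\<^sup>2 * wedge_kernel (u \<alpha>) (of_real x) (of_real y)" if \<alpha>: "\<alpha> \<in> ?B" for \<alpha>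
    unfolding kernel_B_def
  proof (rule integrable_kernel_eq_wedge_kernel)
    have rep: "represents \<alpha> 0 (M_left \<alpha>) (u \<alpha>) (e \<alpha>)" using ue \<alpha> by simp
    then show "u \<alpha> i holomorphic_on UNIV" for i by (simp add: represents_def entire_frame_def)
    \<comment> \<open>The shift built into \<open>represents\<close> is exactly the shift by
      \<alpha> in the kernel; t > \<alpha> means t - \<alpha> > 0, to the right of the endpoint
      0.\<close>
    have "u \<alpha> i (of_real t) = exp (- phase \<alpha> (of_real (t - \<alpha>))) * M_left \<alpha> (of_real (t - \<alpha>)) $ i $ 1"
      if "t > \<alpha>" for i t
      using rep col1_right_of_endpoint(1)[of 0 "t - \<alpha>"] col1_right_of_endpoint(2)[of 0 "t - \<alpha>" \<alpha>
        "M_left \<alpha>" i] that by (simp add: represents_def)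
    then show "f_left \<alpha> (M_left \<alpha>) (of_real (t - \<alpha>)) = c * u \<alpha> 1 (of_real t)"
      "g_left \<alpha> (M_left \<alpha>) (of_real (t - \<alpha>)) = c * u \<alpha> 2 (of_real t)"
      if "t > \<alpha>" for t
      using that by (simp_all add: f_left_def g_left_def c_def phase_def)
  qed (use \<alpha> in auto)
  moreover have "continuous_on ?B (\<lambda>\<alpha>. c\<^sup>2 * wedge_kernel (u \<alpha>) (of_real x) (of_real y))"
  proof (intro continuous_intros wedge_kernel_continuous_on)
    fix \<alpha> \<beta> assume "\<alpha> \<in> ?B" "\<beta> \<in> ?B"
    then show "pairing_bounded \<alpha> (u \<alpha>) (e \<alpha>) \<beta> (u \<beta>) (e \<beta>)"
      using represents_pairing_bounded[OF rhp_B[of \<alpha>] rhp_B[of \<beta>] ue[of \<alpha>] ue[of \<beta>]] by simp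
  qed (use ue in \<open>auto simp: represents_def\<close>)
  ultimately show "continuous_on ?B (\<lambda>\<alpha>. kernel_B \<alpha> (M_left \<alpha>) x y)"
    by (metis (no_types, lifting) continuous_on_cong)
qed

end
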